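(* Let $\mu$ be a positive Radon measure on $\mathbb{R}$ such that, for some (equivalently, every) $a>0$, $\mu((x-a,x+a))\to0$ as $x\to\pm\infty$. Let $\{\lambda_\nu\}$ be the negative eigenvalues of $\mathbf{H}_\mu$. Then, for every $\gamma>0$, $$C_1\int_{\mathbb{R}}|q^*_1(x)|^{\frac12+\gamma}dx\ \le\ \sum_\nu|\lambda_\nu|^\gamma\ \le\ C_2\int_{\mathbb{R}}|q^*_1(x)|^{\frac12+\gamma}dx,$$ where $$C_1=\frac{\gamma}{\gamma+\frac12}\left(\frac1{2\pi^2+\frac32}\right)^{1+2\gamma},\qquad C_2=2^{4\gamma+3}.$$
   Context: $\Delta_x(d)=[x-\frac d2,x+\frac d2]$. A Radon measure here is a positive Borel measure on $\mathbb{R}$, finite on compact sets (and regular). The Otelbaev function of $\mu$ with parameter $1$ is $$q^*_1(x)=\inf\left\{\tfrac1{d^2}:\ d>0,\ \mu(\Delta_x(d))<\tfrac1{d}\right\}.$$ The form is $\mathbf{a}_\mu(f,g)=\int_{\mathbb{R}}f'\overline{g'}\,dx-\int_{\mathbb{R}}f\overline{g}\,d\mu$ on $\{f\in H^1(\mathbb{R}):\int|f|^2d\mu<\infty\}$; under the stated hypothesis on $\mu$ one has $\sup_x\mu([x,x+1])<\infty$, the form is densely defined, symmetric, lower semibounded and closed in $L^2(\mathbb{R})$, and $\mathbf{H}_\mu$ is the self-adjoint operator associated with it; its spectrum in $(-\infty,0)$ is discrete. Eigenvalues are counted with multiplicity; the sum and integrals take values in $[0,\infty]$. *)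

theory Defs
  imports "HOL-Analysis.Analysis" "HOL-Library.Function_Algebras"
begin

(* Every locally finite Borel measure on the real line is regular, so regularity
   is not listed separately. *)
definition radon_measure :: "real measure \<Rightarrow> bool" where
  "radon_measure \<mu> \<longleftrightarrow> sets \<mu> = sets borel \<and> (\<forall>K. compact K \<longrightarrow> emeasure \<mu> K < \<infinity>)"

(* For Radon measures the set is nonempty, since 1/d tends to infinity and
   \<mu>(\<Delta>_x(d)) stays bounded as d tends to 0; hence the real infimum is the intended one. *)
definition otelbaev :: "real measure \<Rightarrow> real \<Rightarrow> real" where
  "otelbaev \<mu> x =
     Inf {1 / d\<^sup>2 | d. 0 < d \<and> emeasure \<mu> {x - d / 2 .. x + d / 2} < ennreal (1 / d)}"

(* Elements of L^2 are represented by Borel functions. *)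
definition L2 :: "(real \<Rightarrow> complex) set" where
  "L2 = {f. f \<in> borel_measurable lborel \<and> integrable lborel (\<lambda>x. (cmod (f x))\<^sup>2)}"

definition L2_inner :: "(real \<Rightarrow> complex) \<Rightarrow> (real \<Rightarrow> complex) \<Rightarrow> complex" where
  "L2_inner f g = (\<integral>x. f x * cnj (g x) \<partial>lborel)"

(* Continuously differentiable functions with compact support: the test functions in
   the definition of Sobolev spaces on intervals in Brezis' textbook. *)
definition test_functions :: "(real \<Rightarrow> real) set" where
  "test_functions = {\<phi>. (\<forall>x. \<phi> differentiable at x) \<and> continuous_on UNIV (deriv \<phi>)
                       \<and> compact (closure {x. \<phi> x \<noteq> 0})}"

definition has_weak_derivative :: "(real \<Rightarrow> complex) \<Rightarrow> (real \<Rightarrow> complex) \<Rightarrow> bool" where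
  "has_weak_derivative f g \<longleftrightarrow>
     (\<forall>\<phi>\<in>test_functions. (\<integral>x. f x * of_real (deriv \<phi> x) \<partial>lborel)
                       = - (\<integral>x. g x * of_real (\<phi> x) \<partial>lborel))"

(* An element of H^1 is identified with its unique continuous representative; the
   integrals with respect to \<mu> below, where \<mu> may charge Lebesgue null sets, refer to it. *)
definition H1 :: "(real \<Rightarrow> complex) set" where
  "H1 = {f \<in> L2. continuous_on UNIV f \<and> (\<exists>g\<in>L2. has_weak_derivative f g)}"

(* Determined up to Lebesgue null sets. *)
definition weak_deriv :: "(real \<Rightarrow> complex) \<Rightarrow> real \<Rightarrow> complex" where
  "weak_deriv f = (SOME g. g \<in> L2 \<and> has_weak_derivative f g)"

definition form_dom :: "real measure \<Rightarrow> (real \<Rightarrow> complex) set" where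
  "form_dom \<mu> = {f \<in> H1. integrable \<mu> (\<lambda>x. (cmod (f x))\<^sup>2)}"

definition form :: "real measure \<Rightarrow> (real \<Rightarrow> complex) \<Rightarrow> (real \<Rightarrow> complex) \<Rightarrow> complex" where
  "form \<mu> f g = (\<integral>x. weak_deriv f x * cnj (weak_deriv g x) \<partial>lborel)
               - (\<integral>x. f x * cnj (g x) \<partial>\<mu>)"

(* Graph of the operator associated with the form by the first representation theorem:
   (u, w) is in the graph iff u is in the domain of the operator and w represents its value at u. *)
definition form_operator :: "real measure \<Rightarrow> ((real \<Rightarrow> complex) \<times> (real \<Rightarrow> complex)) set" where
  "form_operator \<mu> =
     {(u, w). u \<in> form_dom \<mu> \<and> w \<in> L2 \<and> (\<forall>v\<in>form_dom \<mu>. form \<mu> u v = L2_inner w v)}"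

interpretation cfun: vector_space "\<lambda>(c::complex) (f::real \<Rightarrow> complex) x. c * f x"
  by unfold_locales (auto simp: fun_eq_iff algebra_simps)

definition eigenspace :: "real measure \<Rightarrow> real \<Rightarrow> (real \<Rightarrow> complex) set" where
  "eigenspace \<mu> l = {u. (u, \<lambda>x. of_real l * u x) \<in> form_operator \<mu>}"

definition negative_eigenvalues :: "real measure \<Rightarrow> real set" where
  "negative_eigenvalues \<mu> = {l. l < 0 \<and> (\<exists>u\<in>eigenspace \<mu> l. u \<noteq> 0)}"

(* Dimension of the eigenspace over the complex numbers. Distinct continuous functions
   represent distinct classes, so it can be computed in the space of functions. The case
   distinction is needed because dim is 0 on infinite-dimensional spaces. *)
definition eigenvalue_mult :: "real measure \<Rightarrow> real \<Rightarrow> ennreal" where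
  "eigenvalue_mult \<mu> l =
     (if \<exists>B. finite B \<and> eigenspace \<mu> l \<subseteq> cfun.span B
      then of_nat (cfun.dim (eigenspace \<mu> l)) else \<infinity>)"

definition eigenvalue_moment :: "real measure \<Rightarrow> real \<Rightarrow> ennreal" where
  "eigenvalue_moment \<mu> \<gamma> =
     (\<Sum>\<^sub>\<infinity>l\<in>negative_eigenvalues \<mu>. eigenvalue_mult \<mu> l * ennreal (\<bar>l\<bar> powr \<gamma>))"

end

theory Submission
  imports Defs
begin

text \<open>
  Given \<open>\<lambda> > 0\<close>, cut the line into cells of length \<open>2 / \<surd>\<lambda>\<close>. On a cell with \<open>(b - a) \<mu>[a, b] \<le> 1\<close> the form
  plus \<open>\<lambda>\<close> is positive; the finitely many others are bisected until this holds, and then it suffices that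
  \<open>f\<close> vanishes at both endpoints. A cell obtained by bisection has \<open>q* \<ge> 1 / (16 (b - a)\<^sup>2)\<close>, so its two endpoints
  are paid for by \<open>8 \<integral> \<surd>q*\<close> over the cell. Hence the number \<open>N(\<lambda>)\<close> of eigenvalues up to \<open>-\<lambda>\<close> is at most the
  integral of \<open>8 \<surd>q*\<close> over \<open>{q* \<ge> \<lambda> / 16}\<close>.

  Conversely, around a point with \<open>q* > 64 \<lambda>\<close> a tent of width \<open>1 / \<surd>\<lambda>\<close> has energy below \<open>-\<lambda>\<close>, and disjoint tents
  give \<open>N(\<lambda>) \<ge> \<surd>\<lambda> |{q* \<ge> c\<^sup>2 \<lambda>}|\<close> for \<open>c > 8\<close>. Negative energy produces an eigenfunction: a
  minimizing sequence for the Rayleigh quotient, thinned out so that it converges at the finitely many cut points, is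
  Cauchy in the Sobolev norm by the parallelogram law. Integrating both bounds against \<open>\<gamma> \<lambda>\<^sup>\<gamma>\<^sup>-\<^sup>1\<close> gives the theorem.
\<close>

section \<open>Square integrable functions and Hermitian forms\<close>

text \<open>No spectral theorem or min-max principle is invoked: both counts speak directly about
  eigenfunctions. For the lower count these are produced one at a time, each by minimizing on the
  orthogonal complement of those already found. One estimate carries everything:
  \<open>nsq \<mu> f\<close> is at most 5/8 of the gradient term plus 5/6 \<open>l\<close> times the
  L^2 term, up to finitely many point values. Both factors are below 1, so for functions vanishing
  at those points the form plus \<open>l\<close> still dominates 3/8 of the gradient and 1/6
  \<open>l\<close> of the norm. The point values are a defect of finite rank, so compactness is
  needed only for finitely many complex numbers. The same estimate shows that every H^1 function is
  square integrable for \<mu>, so the form domain is all of H^1. The final constants come from the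
  layer-cake formula: 8 times 16^\<gamma> is 2^(4 \<gamma> + 3), and integrating sqrt l against the
  weight gives \<gamma>/(\<gamma> + 1/2) times (1/c)^(1 + 2 \<gamma>) for each c > 8; the number 2
  pi^2 + 3/2 of the theorem is about 21.2.\<close>

abbreviation abs2 :: "complex \<Rightarrow> real" where
  "abs2 z \<equiv> (cmod z)\<^sup>2"

text \<open>The measure is a parameter because the same L^2 calculus runs over Lebesgue measure and
  over \<mu>. Functions are used rather than classes, since \<mu> may charge Lebesgue null
  sets.\<close>

definition sqint :: "real measure \<Rightarrow> (real \<Rightarrow> complex) set" where
  "sqint M = {f \<in> borel_measurable M. integrable M (\<lambda>x. abs2 (f x))}"

definition ip :: "real measure \<Rightarrow> (real \<Rightarrow> complex) \<Rightarrow> (real \<Rightarrow> complex) \<Rightarrow> complex" where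
  "ip M f g = (\<integral>x. f x * cnj (g x) \<partial>M)"

definition nsq :: "real measure \<Rightarrow> (real \<Rightarrow> complex) \<Rightarrow> real" where
  "nsq M f = (\<integral>x. abs2 (f x) \<partial>M)"

abbreviation "sqintL \<equiv> sqint lborel"
abbreviation "ipL \<equiv> ip lborel"
abbreviation "nsqL \<equiv> nsq lborel"

lemma L2_eq_sqint: "L2 = sqintL"
  by (simp add: L2_def sqint_def)

lemma L2_inner_eq_ip: "L2_inner f g = ipL f g"
  by (simp add: L2_inner_def ip_def)

lemma sqintD:
  assumes "f \<in> sqint M"
  shows "f \<in> borel_measurable M" "integrable M (\<lambda>x. abs2 (f x))"
  using assms by (auto simp: sqint_def)

lemma two_mult_le_squares: "2 * (a * b) \<le> a\<^sup>2 + b\<^sup>2" for a b :: real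
  using sum_squares_bound[of a b] by simp

lemma sqint_add:
  assumes f: "f \<in> sqint M" and g: "g \<in> sqint M"
  shows "f + g \<in> sqint M"
proof -
  note [measurable] = sqintD(1)[OF f] sqintD(1)[OF g]
  have "integrable M (\<lambda>x. abs2 (f x + g x))"
  proof (rule Bochner_Integration.integrable_bound)
    show "integrable M (\<lambda>x. 2 * abs2 (f x) + 2 * abs2 (g x))"
      using sqintD(2)[OF f] sqintD(2)[OF g] by simp
    have "abs2 (f x + g x) \<le> 2 * abs2 (f x) + 2 * abs2 (g x)" for x
    proof -
      have "abs2 (f x + g x) \<le> (cmod (f x) + cmod (g x))\<^sup>2"
        by (intro power_mono norm_triangle_ineq) auto
      also have "\<dots> \<le> 2 * abs2 (f x) + 2 * abs2 (g x)"
        using two_mult_le_squares[of "cmod (f x)" "cmod (g x)"] by (simp add: power2_sum)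
      finally show ?thesis .
    qed
    then show "AE x in M. norm (abs2 (f x + g x)) \<le> norm (2 * abs2 (f x) + 2 * abs2 (g x))"
      by simp
  qed measurable
  then show ?thesis by (simp add: sqint_def plus_fun_def)
qed

lemma sqint_scale:
  assumes f: "f \<in> sqint M"
  shows "(\<lambda>x. c * f x) \<in> sqint M"
  using sqintD[OF f] by (simp add: sqint_def norm_mult power_mult_distrib)

lemma sqint_zero [simp]: "0 \<in> sqint M"
  by (simp add: sqint_def zero_fun_def)

lemma sqint_diff:
  assumes "f \<in> sqint M" "g \<in> sqint M"
  shows "f - g \<in> sqint M"
  using sqint_add[OF assms(1) sqint_scale[OF assms(2), of "-1"]]
  by (simp add: plus_fun_def fun_diff_def)

lemma cnj_measurable:
  assumes "f \<in> borel_measurable M"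
  shows "(\<lambda>x. cnj (f x)) \<in> borel_measurable M"
  by (rule borel_measurable_continuous_on[OF _ assms]) (intro continuous_intros)

lemma integrable_mult_cnj:
  assumes f: "f \<in> sqint M" and g: "g \<in> sqint M"
  shows "integrable M (\<lambda>x. f x * cnj (g x))"
proof (rule Bochner_Integration.integrable_bound)
  note [measurable] = sqintD(1)[OF f] sqintD(1)[OF g]
  show "(\<lambda>x. f x * cnj (g x)) \<in> borel_measurable M"
    by (intro borel_measurable_times cnj_measurable) measurable
  show "integrable M (\<lambda>x. abs2 (f x) + abs2 (g x))"
    using sqintD(2)[OF f] sqintD(2)[OF g] by simp
  have "cmod (f x * cnj (g x)) \<le> abs2 (f x) + abs2 (g x)" for x
  proof -
    have "0 \<le> cmod (f x) * cmod (g x)" by simp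
    then have "cmod (f x) * cmod (g x) \<le> abs2 (f x) + abs2 (g x)"
      using two_mult_le_squares[of "cmod (f x)" "cmod (g x)"] by linarith
    then show ?thesis by (simp add: norm_mult)
  qed
  then show "AE x in M. norm (f x * cnj (g x)) \<le> norm (abs2 (f x) + abs2 (g x))"
    by simp
qed

lemma ip_add_left:
  assumes "f \<in> sqint M" "g \<in> sqint M" "h \<in> sqint M"
  shows "ip M (f + g) h = ip M f h + ip M g h"
  using integrable_mult_cnj[OF assms(1,3)] integrable_mult_cnj[OF assms(2,3)]
  by (simp add: ip_def distrib_right)

lemma ip_scale_left: "ip M (\<lambda>x. c * f x) h = c * ip M f h"
  by (simp add: ip_def mult.assoc)

lemma ip_cnj: "cnj (ip M f g) = ip M g f"
proof -
  have "cnj (ip M f g) = (\<integral>x. cnj (f x * cnj (g x)) \<partial>M)"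
    unfolding ip_def by (rule Bochner_Integration.integral_cnj [symmetric])
  then show ?thesis by (simp add: ip_def mult.commute)
qed

lemma ip_self:
  shows "ip M f f = of_real (nsq M f)"
  unfolding ip_def nsq_def
  by (simp add: complex_norm_square[symmetric] flip: integral_complex_of_real)

lemma nsq_nonneg [simp]: "0 \<le> nsq M f"
  by (simp add: nsq_def)

lemma nsq_scale: "nsq M (\<lambda>x. c * f x) = abs2 c * nsq M f"
  by (simp add: nsq_def norm_mult power_mult_distrib)

lemma nsq_0 [simp]: "nsq M 0 = 0"
  by (simp add: nsq_def)

lemma ip_cong_AE:
  assumes "AE x in M. f x = f' x" "AE x in M. g x = g' x"
    and "f \<in> borel_measurable M" "f' \<in> borel_measurable M"
      "g \<in> borel_measurable M" "g' \<in> borel_measurable M"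
  shows "ip M f g = ip M f' g'"
  unfolding ip_def
proof (rule integral_cong_AE)
  show "AE x in M. f x * cnj (g x) = f' x * cnj (g' x)"
    using assms(1,2) by eventually_elim simp
qed (use assms(3-6) in \<open>auto intro!: borel_measurable_times cnj_measurable\<close>)

lemma nsq_cong_AE:
  assumes "AE x in M. f x = f' x"
    and [measurable]: "f \<in> borel_measurable M" "f' \<in> borel_measurable M"
  shows "nsq M f = nsq M f'"
  unfolding nsq_def
proof (rule integral_cong_AE)
  show "AE x in M. abs2 (f x) = abs2 (f' x)"
    using assms(1) by eventually_elim simp
qed measurable

text \<open>No positivity is assumed: besides the L^2 product, the instances are the indefinite form
  of \<mu> and its shift by the infimum of a Rayleigh quotient, which is known to be nonnegative
  only on a subspace.\<close>

locale hermitian_form =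
  fixes X :: "(real \<Rightarrow> complex) set" and q :: "(real \<Rightarrow> complex) \<Rightarrow> (real \<Rightarrow> complex) \<Rightarrow> complex"
  assumes X_add: "f \<in> X \<Longrightarrow> g \<in> X \<Longrightarrow> f + g \<in> X"
    and X_scale: "f \<in> X \<Longrightarrow> (\<lambda>x. c * f x) \<in> X"
    and X_zero: "0 \<in> X"
    and add_left: "f \<in> X \<Longrightarrow> g \<in> X \<Longrightarrow> h \<in> X \<Longrightarrow> q (f + g) h = q f h + q g h"
    and scale_left: "f \<in> X \<Longrightarrow> h \<in> X \<Longrightarrow> q (\<lambda>x. c * f x) h = c * q f h"
    and cnj_sym: "f \<in> X \<Longrightarrow> g \<in> X \<Longrightarrow> cnj (q f g) = q g f"
begin

lemma X_diff: "f \<in> X \<Longrightarrow> g \<in> X \<Longrightarrow> f - g \<in> X"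
  using X_add[of f "\<lambda>x. -1 * g x"] X_scale[of g "-1"] by (simp add: plus_fun_def fun_diff_def)

lemma X_sum: "(\<And>i. i \<in> I \<Longrightarrow> f i \<in> X) \<Longrightarrow> (\<Sum>i\<in>I. f i) \<in> X"
  by (induction I rule: infinite_finite_induct) (auto intro: X_add X_zero)

lemma add_right: "f \<in> X \<Longrightarrow> g \<in> X \<Longrightarrow> h \<in> X \<Longrightarrow> q h (f + g) = q h f + q h g"
  by (metis add_left cnj_sym complex_cnj_add X_add)

lemma scale_right: "f \<in> X \<Longrightarrow> h \<in> X \<Longrightarrow> q h (\<lambda>x. c * f x) = cnj c * q h f"
  by (metis scale_left cnj_sym complex_cnj_mult X_scale)

lemma diff_left: "f \<in> X \<Longrightarrow> g \<in> X \<Longrightarrow> h \<in> X \<Longrightarrow> q (f - g) h = q f h - q g h"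
  using add_left[of "f - g" g h] X_diff[of f g] by simp

lemma diff_right: "f \<in> X \<Longrightarrow> g \<in> X \<Longrightarrow> h \<in> X \<Longrightarrow> q h (f - g) = q h f - q h g"
  using add_right[of "f - g" g h] X_diff[of f g] by simp

lemma zero_left [simp]: "h \<in> X \<Longrightarrow> q 0 h = 0"
  using add_left[of 0 0 h] X_zero by simp

lemma zero_right [simp]: "h \<in> X \<Longrightarrow> q h 0 = 0"
  using add_right[of 0 0 h] X_zero by simp

lemma sum_left: "(\<And>i. i \<in> I \<Longrightarrow> f i \<in> X) \<Longrightarrow> h \<in> X \<Longrightarrow> q (\<Sum>i\<in>I. f i) h = (\<Sum>i\<in>I. q (f i) h)"
proof (induction I rule: infinite_finite_induct)
  case (insert x F)
  have "q (f x + sum f F) h = q (f x) h + q (sum f F) h"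
    using insert by (intro add_left X_sum) auto
  then show ?case using insert by (simp add: sum.insert[OF insert(1,2)] del: plus_fun_apply)
qed auto

lemma sum_right: "(\<And>i. i \<in> I \<Longrightarrow> f i \<in> X) \<Longrightarrow> h \<in> X \<Longrightarrow> q h (\<Sum>i\<in>I. f i) = (\<Sum>i\<in>I. q h (f i))"
proof (induction I rule: infinite_finite_induct)
  case (insert x F)
  have "q h (f x + sum f F) = q h (f x) + q h (sum f F)"
    using insert by (intro add_right X_sum) auto
  then show ?case using insert by (simp add: sum.insert[OF insert(1,2)] del: plus_fun_apply)
qed auto

lemma Re_sym: "f \<in> X \<Longrightarrow> g \<in> X \<Longrightarrow> Re (q g f) = Re (q f g)"
  using cnj_sym[of f g] by (metis cnj.sel(1))

lemma expand_scale:
  assumes "f \<in> X" "v \<in> X"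
  shows "Re (q (f + (\<lambda>x. t * v x)) (f + (\<lambda>x. t * v x)))
    = Re (q f f) + 2 * Re (cnj t * q f v) + abs2 t * Re (q v v)"
proof -
  let ?w = "\<lambda>x. t * v x"
  have w: "?w \<in> X" using X_scale assms by auto
  have "q (f + ?w) (f + ?w) = q f f + cnj t * q f v + t * q v f + t * cnj t * q v v"
    using assms w by (simp add: add_left add_right X_add scale_left scale_right algebra_simps)
  moreover have "t * q v f = cnj (cnj t * q f v)" using assms by (simp add: cnj_sym)
  then have "Re (t * q v f) = Re (cnj t * q f v)" by (simp only: cnj.sel)
  moreover have "Re (t * cnj t * q v v) = abs2 t * Re (q v v)"
    by (simp add: complex_norm_square[symmetric] power2_eq_square)
  ultimately show ?thesis by simp
qed

lemma parallelogram:
  assumes "f \<in> X" "g \<in> X"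
  shows "Re (q (f - g) (f - g)) + Re (q (f + g) (f + g)) = 2 * Re (q f f) + 2 * Re (q g g)"
  using assms by (simp add: add_left add_right diff_left diff_right X_add X_diff)

text \<open>Testing positivity at \<open>f - s q(f,v) v\<close> for small \<open>s > 0\<close> makes the linear term dominate.\<close>

lemma minimizer_orthogonal:
  assumes f: "f \<in> X" and v: "v \<in> X" and zero: "Re (q f f) = 0"
    and pos: "\<And>t. 0 \<le> Re (q (f + (\<lambda>x. t * v x)) (f + (\<lambda>x. t * v x)))"
  shows "q f v = 0"
proof (rule ccontr)
  assume nz: "q f v \<noteq> 0"
  define z where "z = q f v"
  \<comment> \<open>The summand 1 keeps \<open>B\<close> positive even when \<open>q v v\<close>
    vanishes; then \<open>s * Re (q v v) < 1\<close> contradicts the lower bound 2 that positivity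
    forces.\<close>
  define B where "B = \<bar>Re (q v v)\<bar> + 1"
  define s where "s = 1 / B"
  have B: "B > 0" "Re (q v v) < B" by (auto simp: B_def)
  have s: "s > 0" using B by (simp add: s_def)
  define t where "t = - of_real s * z"
  have "0 \<le> 2 * Re (cnj t * z) + abs2 t * Re (q v v)"
    using pos[of t] expand_scale[OF f v, of t] zero by (simp add: z_def)
  also have "Re (cnj t * z) = - s * abs2 z"
    unfolding cmod_power2 by (simp add: t_def power2_eq_square algebra_simps)
  also have "abs2 t = s\<^sup>2 * abs2 z"
    by (simp add: t_def norm_mult power_mult_distrib)
  finally have "0 \<le> abs2 z * s * (s * Re (q v v) - 2)"
    by (simp add: algebra_simps power2_eq_square)
  moreover have "abs2 z * s > 0" using nz s by (simp add: z_def)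
  ultimately have "s * Re (q v v) \<ge> 2"
    by (smt (verit) mult_pos_neg)
  moreover have "s * Re (q v v) < s * B" using s B by simp
  moreover have "s * B = 1" using B by (simp add: s_def)
  ultimately show False by simp
qed

lemma Cauchy_Schwarz:
  assumes f: "f \<in> X" and g: "g \<in> X" and pos: "\<And>h. h \<in> X \<Longrightarrow> 0 \<le> Re (q h h)"
  shows "abs2 (q f g) \<le> Re (q f f) * Re (q g g)"
proof -
  define z where "z = q f g"
  have *: "0 \<le> Re (q f f) - 2 * s * abs2 z + s\<^sup>2 * abs2 z * Re (q g g)" for s
  proof -
    define t where "t = - of_real s * z"
    have "0 \<le> Re (q f f) + 2 * Re (cnj t * z) + abs2 t * Re (q g g)"
      using pos[OF X_add[OF f X_scale[OF g, of t]]] expand_scale[OF f g, of t] by (simp add: z_def)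
    also have "Re (cnj t * z) = - s * abs2 z"
      unfolding cmod_power2 by (simp add: t_def power2_eq_square algebra_simps)
    also have "abs2 t = s\<^sup>2 * abs2 z"
      by (simp add: t_def norm_mult power_mult_distrib)
    finally show ?thesis by simp
  qed
  show ?thesis
  proof (cases "Re (q g g) = 0")
    case True
    have "cmod z = 0"
    proof (rule ccontr)
      assume "cmod z \<noteq> 0"
      then have "abs2 z > 0" by simp
      \<comment> \<open>For a null vector \<open>g\<close> the quadratic term drops out, and this
        value of \<open>s\<close> makes the right-hand side equal to -1.\<close>
      then have "2 * ((Re (q f f) + 1) / (2 * abs2 z)) * abs2 z = Re (q f f) + 1" by simp
      then show False using *[of "(Re (q f f) + 1) / (2 * abs2 z)"] True by simp
    qed
    then show ?thesis using True by (simp add: z_def)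
  next
    case False
    then have gp: "Re (q g g) > 0" using pos[OF g] by simp
    have "0 \<le> Re (q f f) - abs2 z / Re (q g g)"
      using *[of "1 / Re (q g g)"] gp by (simp add: field_simps power2_eq_square)
    then show ?thesis using gp by (simp add: z_def field_simps)
  qed
qed

end

lemma hermitian_ip: "hermitian_form (sqint M) (ip M)"
  by unfold_locales (auto intro: sqint_add sqint_scale ip_add_left simp: ip_scale_left ip_cnj)

lemma ip_Cauchy_Schwarz:
  assumes "f \<in> sqint M" "g \<in> sqint M"
  shows "abs2 (ip M f g) \<le> nsq M f * nsq M g"
  using hermitian_form.Cauchy_Schwarz[OF hermitian_ip assms] by (simp add: ip_self)

section \<open>Convergence and completeness in L^2\<close>

lemma tendsto_ip_left:
  assumes "\<And>n. f n \<in> sqint M" "g \<in> sqint M" "h \<in> sqint M"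
    and "(\<lambda>n. nsq M (f n - g)) \<longlonglongrightarrow> 0"
  shows "(\<lambda>n. ip M (f n) h) \<longlonglongrightarrow> ip M g h"
proof -
  interpret hermitian_form "sqint M" "ip M" by (rule hermitian_ip)
  have "(\<lambda>n. abs2 (ip M (f n) h - ip M g h)) \<longlonglongrightarrow> 0"
  proof (rule tendsto_sandwich[of "\<lambda>_. 0"])
    show "(\<lambda>n. nsq M (f n - g) * nsq M h) \<longlonglongrightarrow> 0"
      using tendsto_mult_right[OF assms(4), of "nsq M h"] by (simp add: mult.commute)
    show "\<forall>\<^sub>F n in sequentially. abs2 (ip M (f n) h - ip M g h) \<le> nsq M (f n - g) * nsq M h"
      using ip_Cauchy_Schwarz[OF X_diff[OF assms(1,2)] assms(3)] assms
      by (simp add: diff_left)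
  qed auto
  then have "(\<lambda>n. sqrt (abs2 (ip M (f n) h - ip M g h))) \<longlonglongrightarrow> sqrt 0"
    by (rule tendsto_real_sqrt)
  then have "(\<lambda>n. cmod (ip M (f n) h - ip M g h)) \<longlonglongrightarrow> 0" by simp
  then have "(\<lambda>n. ip M (f n) h - ip M g h) \<longlonglongrightarrow> 0" by (rule tendsto_norm_zero_cancel)
  then show ?thesis by (rule LIM_zero_cancel)
qed

text \<open>Expanding the square of \<open>f n - g\<close> reduces the claim to inner products with
  the fixed function \<open>g\<close>.\<close>

lemma tendsto_nsq:
  assumes f: "\<And>n. f n \<in> sqint M" and g: "g \<in> sqint M"
    and lim: "(\<lambda>n. nsq M (f n - g)) \<longlonglongrightarrow> 0"
  shows "(\<lambda>n. nsq M (f n)) \<longlonglongrightarrow> nsq M g"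
proof -
  interpret hermitian_form "sqint M" "ip M" by (rule hermitian_ip)
  have eq: "nsq M (f n) = nsq M (f n - g) + 2 * Re (ip M (f n) g) - nsq M g" for n
  proof -
    have "Re (ip M (f n - g) (f n - g)) = Re (ip M (f n) (f n)) - 2 * Re (ip M (f n) g) + Re (ip M g g)"
      using f[of n] g Re_sym[OF f[of n] g] by (simp add: diff_left diff_right X_diff)
    then show ?thesis by (simp add: ip_self)
  qed
  have "(\<lambda>n. nsq M (f n - g) + 2 * Re (ip M (f n) g) - nsq M g) \<longlonglongrightarrow> 0 + 2 * Re (ip M g g) - nsq M g"
    by (intro tendsto_intros lim tendsto_ip_left f g)
  then show ?thesis by (simp add: eq[symmetric] ip_self)
qed

text \<open>Fatou in the second index of \<open>f m - f n\<close> turns the Cauchy property into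
  convergence to a pointwise limit. Only a subsequence has to converge pointwise: completeness of
  L^2 supplies no more, while for H^1 the whole sequence converges uniformly.\<close>

lemma sqint_Fatou:
  assumes f: "\<And>n. f n \<in> sqint M" and [measurable]: "g \<in> borel_measurable M"
    and r: "strict_mono (r :: nat \<Rightarrow> nat)"
    and ae: "AE x in M. (\<lambda>n. f (r n) x) \<longlonglongrightarrow> g x"
    and cauchy: "\<And>e. e > 0 \<Longrightarrow> \<exists>N. \<forall>m\<ge>N. \<forall>n\<ge>N. nsq M (f m - f n) < e"
  shows "g \<in> sqint M \<and> (\<lambda>n. nsq M (f n - g)) \<longlonglongrightarrow> 0"
proof -
  note [measurable] = sqintD(1)[OF f]
  have key: "(\<integral>\<^sup>+x. ennreal (abs2 (f m x - g x)) \<partial>M) \<le> ennreal e"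
    if N: "\<forall>m\<ge>N. \<forall>n\<ge>N. nsq M (f m - f n) < e" and m: "m \<ge> N" and "e > 0" for N m e
  proof -
    have "(\<integral>\<^sup>+x. ennreal (abs2 (f m x - g x)) \<partial>M)
        = (\<integral>\<^sup>+x. liminf (\<lambda>n. ennreal (abs2 (f m x - f (r n) x))) \<partial>M)"
    proof (rule nn_integral_cong_AE, use ae in eventually_elim)
      case (elim x)
      have "(\<lambda>n. ennreal (abs2 (f m x - f (r n) x))) \<longlonglongrightarrow> ennreal (abs2 (f m x - g x))"
        by (intro tendsto_intros elim tendsto_ennrealI)
      then show ?case by (metis lim_imp_Liminf trivial_limit_sequentially)
    qed
    also have "\<dots> \<le> liminf (\<lambda>n. \<integral>\<^sup>+x. ennreal (abs2 (f m x - f (r n) x)) \<partial>M)"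
      by (rule nn_integral_liminf) measurable
    also have "\<dots> \<le> ennreal e"
    proof (rule Liminf_le)
      have "(\<integral>\<^sup>+x. ennreal (abs2 (f m x - f (r n) x)) \<partial>M) \<le> ennreal e" if "n \<ge> N" for n
      proof -
        have "r n \<ge> N" using seq_suble[OF r, of n] that by simp
        then have "nsq M (f m - f (r n)) < e" using N m by blast
        moreover have "(\<integral>\<^sup>+x. ennreal (abs2 (f m x - f (r n) x)) \<partial>M) = ennreal (nsq M (f m - f (r n)))"
          using sqintD(2)[OF sqint_diff[OF f[of m] f[of "r n"]]]
          by (simp add: nsq_def nn_integral_eq_integral)
        ultimately show ?thesis by (simp add: ennreal_leI)
      qed
      then show "\<forall>\<^sub>F n in sequentially. (\<integral>\<^sup>+x. ennreal (abs2 (f m x - f (r n) x)) \<partial>M) \<le> ennreal e"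
        by (auto simp: eventually_sequentially)
    qed simp
    finally show ?thesis .
  qed
  have diff: "f m - g \<in> sqint M" if "\<forall>m\<ge>N. \<forall>n\<ge>N. nsq M (f m - f n) < 1" "m \<ge> N" for N m
  proof -
    have "integrable M (\<lambda>x. abs2 (f m x - g x))"
      using key[OF that] by (intro integrableI_nonneg) (auto simp: less_top[symmetric] top_unique)
    then show ?thesis by (simp add: sqint_def fun_diff_def)
  qed
  obtain N1 where N1: "\<forall>m\<ge>N1. \<forall>n\<ge>N1. nsq M (f m - f n) < 1" using cauchy[of 1] by auto
  have g: "g \<in> sqint M"
    using sqint_diff[OF f[of N1] diff[OF N1 order_refl]] by simp
  have "(\<lambda>n. nsq M (f n - g)) \<longlonglongrightarrow> 0"
  proof (rule LIMSEQ_I)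
    fix e :: real assume e: "e > 0"
    obtain N where N: "\<forall>m\<ge>N. \<forall>n\<ge>N. nsq M (f m - f n) < e / 2" using cauchy[of "e/2"] e by auto
    have "norm (nsq M (f n - g) - 0) < e" if "n \<ge> N" for n
    proof -
      have "ennreal (nsq M (f n - g)) = (\<integral>\<^sup>+x. ennreal (abs2 (f n x - g x)) \<partial>M)"
        using sqintD(2)[OF sqint_diff[OF f[of n] g]] by (simp add: nsq_def nn_integral_eq_integral)
      also have "\<dots> \<le> ennreal (e / 2)" using key[OF N that] e by simp
      finally have "nsq M (f n - g) \<le> e / 2" using e by simp
      then show ?thesis using e by simp
    qed
    then show "\<exists>no. \<forall>n\<ge>no. norm (nsq M (f n - g) - 0) < e" by blast
  qed
  with g show ?thesis by simp
qed

text \<open>Riesz-Fischer: a rapidly Cauchy subsequence converges almost everywhere, and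
  \<open>sqint_Fatou\<close> upgrades this to norm convergence of the whole sequence.\<close>

lemma sqint_complete:
  assumes f: "\<And>n. f n \<in> sqint M"
    and cauchy: "\<And>e. e > 0 \<Longrightarrow> \<exists>N. \<forall>m\<ge>N. \<forall>n\<ge>N. nsq M (f m - f n) < e"
  shows "\<exists>g\<in>sqint M. (\<lambda>n. nsq M (f n - g)) \<longlonglongrightarrow> 0"
proof -
  note [measurable] = sqintD(1)[OF f]
  \<comment> \<open>The rate 1/8 survives multiplication by the weight \<open>4 ^ k\<close>, leaving
    the summable \<open>(1/2) ^ k\<close>. Finiteness of the weighted sum then bounds
    \<open>d k x\<close> by a multiple of \<open>(1/2) ^ k\<close> at almost every \<open>x\<close>,
    so the increments are summable.\<close>
  have "\<forall>k. \<exists>N. \<forall>m\<ge>N. \<forall>n\<ge>N. nsq M (f m - f n) < (1/8) ^ k"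
    using cauchy by simp
  then obtain N where N: "\<And>k m n. m \<ge> N k \<Longrightarrow> n \<ge> N k \<Longrightarrow> nsq M (f m - f n) < (1/8) ^ k"
    by metis
  define r where "r = rec_nat (N 0) (\<lambda>k s. max (Suc s) (N (Suc k)))"
  have r_Suc: "r (Suc k) = max (Suc (r k)) (N (Suc k))" for k by (simp add: r_def)
  have r: "strict_mono r" by (simp add: strict_mono_Suc_iff r_Suc less_max_iff_disj)
  have rN: "r k \<ge> N k" for k by (cases k) (simp_all add: r_def)
  define d where "d k = (\<lambda>x. cmod (f (r (Suc k)) x - f (r k) x))" for k
  have [measurable]: "d k \<in> borel_measurable M" for k unfolding d_def by measurable
  have dint: "(\<integral>\<^sup>+x. ennreal (4^k * (d k x)\<^sup>2) \<partial>M) \<le> ennreal ((1/2)^k)" for k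
  proof -
    have "(\<integral>\<^sup>+x. ennreal (4^k * (d k x)\<^sup>2) \<partial>M) = ennreal (4^k * nsq M (f (r (Suc k)) - f (r k)))"
      using sqintD(2)[OF sqint_diff[OF f[of "r (Suc k)"] f[of "r k"]]]
      by (subst nn_integral_eq_integral) (auto simp: nsq_def d_def)
    also have "\<dots> \<le> ennreal (4^k * (1/8)^k)"
    proof -
      have "r (Suc k) \<ge> r k" using r_Suc[of k] by simp
      then have "r (Suc k) \<ge> N k" using rN[of k] by simp
      then have "nsq M (f (r (Suc k)) - f (r k)) \<le> (1/8)^k" using N rN[of k] by (simp add: less_imp_le)
      then show ?thesis by (intro ennreal_leI mult_left_mono) auto
    qed
    also have "4^k * (1/8)^k = ((1/2::real)^k)" by (simp flip: power_mult_distrib)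
    finally show ?thesis .
  qed
  have "(\<integral>\<^sup>+x. (\<Sum>k. ennreal (4^k * (d k x)\<^sup>2)) \<partial>M) = (\<Sum>k. \<integral>\<^sup>+x. ennreal (4^k * (d k x)\<^sup>2) \<partial>M)"
    by (rule nn_integral_suminf) measurable
  also have "\<dots> \<le> (\<Sum>k. ennreal ((1/2)^k))"
    by (intro suminf_le dint) auto
  also have "\<dots> = ennreal (\<Sum>k. (1/2)^k)" by (intro suminf_ennreal2) (auto simp: summable_geometric)
  also have "\<dots> < \<infinity>" by simp
  finally have "AE x in M. (\<Sum>k. ennreal (4^k * (d k x)\<^sup>2)) \<noteq> \<infinity>"
    by (intro nn_integral_PInf_AE) auto
  then have conv: "AE x in M. convergent (\<lambda>k. f (r k) x)"
  proof eventually_elim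
    case (elim x)
    have "summable (\<lambda>k. 4^k * (d k x)\<^sup>2)"
      using elim by (intro summable_suminf_not_top) auto
    then have "(\<lambda>k. 4^k * (d k x)\<^sup>2) \<longlonglongrightarrow> 0" by (rule summable_LIMSEQ_zero)
    then have "Bseq (\<lambda>k. 4^k * (d k x)\<^sup>2)" using convergent_imp_Bseq convergent_def by blast
    then obtain C where C: "C > 0" "\<And>k. norm (4^k * (d k x)\<^sup>2) \<le> C" by (auto simp: Bseq_def)
    have bd: "norm (f (r (Suc k)) x - f (r k) x) \<le> sqrt C * (1/2)^k" for k
    proof -
      have four: "((2::real)^k)\<^sup>2 = 4^k" by (simp add: power2_eq_square flip: power_mult_distrib)
      have "(2^k * d k x)\<^sup>2 \<le> C" using C(2)[of k]
        using four by (simp add: power_mult_distrib)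
      then have "2^k * d k x \<le> sqrt C" by (rule real_le_rsqrt)
      then show ?thesis by (simp add: d_def field_simps power_divide)
    qed
    have sg: "summable (\<lambda>k. sqrt C * (1/2)^k)" by (intro summable_mult summable_geometric) auto
    have "summable (\<lambda>k. f (r (Suc k)) x - f (r k) x)"
      by (rule summable_comparison_test'[OF sg, of 0]) (rule bd)
    then have "convergent (\<lambda>n. \<Sum>k<n. f (r (Suc k)) x - f (r k) x)"
      by (simp only: summable_iff_convergent)
    then have "convergent (\<lambda>n. f (r n) x - f (r 0) x)"
      by (simp only: sum_lessThan_telescope[of "\<lambda>k. f (r k) x"])
    then show ?case by (simp only: convergent_diff_const_right_iff)
  qed
  define g where "g = (\<lambda>x. lim (\<lambda>k. f (r k) x))"
  have gm: "g \<in> borel_measurable M" unfolding g_def by measurable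
  have ae: "AE x in M. (\<lambda>k. f (r k) x) \<longlonglongrightarrow> g x"
    using conv by eventually_elim (simp add: g_def convergent_LIMSEQ_iff)
  show ?thesis using sqint_Fatou[OF f gm r ae cauchy] by blast
qed

lemma nsq_sum_orthogonal:
  assumes "finite X" "\<And>x. x \<in> X \<Longrightarrow> f x \<in> sqint M"
    and orth: "\<And>x y. x \<in> X \<Longrightarrow> y \<in> X \<Longrightarrow> x \<noteq> y \<Longrightarrow> ip M (f x) (f y) = 0"
  shows "nsq M (\<Sum>x\<in>X. (\<lambda>t. c x * f x t)) = (\<Sum>x\<in>X. abs2 (c x) * nsq M (f x))"
proof -
  interpret I: hermitian_form "sqint M" "ip M" by (rule hermitian_ip)
  let ?F = "\<Sum>x\<in>X. (\<lambda>t. c x * f x t)"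
  have F: "?F \<in> sqint M" using assms by (intro I.X_sum I.X_scale)
  have *: "ip M (f x) ?F = cnj (c x) * of_real (nsq M (f x))" if x: "x \<in> X" for x
  proof -
    have "ip M (f x) ?F = (\<Sum>y\<in>X. ip M (f x) (\<lambda>t. c y * f y t))"
      using assms x by (intro I.sum_right I.X_scale)
    also have "\<dots> = (\<Sum>y\<in>X. if x = y then cnj (c x) * of_real (nsq M (f x)) else 0)"
      using assms x by (intro sum.cong) (auto simp: I.scale_right ip_self)
    also have "\<dots> = cnj (c x) * of_real (nsq M (f x))" using assms(1) x by simp
    finally show ?thesis .
  qed
  have "of_real (nsq M ?F) = ip M ?F ?F" by (simp only: ip_self)
  also have "\<dots> = (\<Sum>x\<in>X. ip M (\<lambda>t. c x * f x t) ?F)"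
    using assms by (intro I.sum_left I.X_scale F)
  also have "\<dots> = (\<Sum>x\<in>X. of_real (abs2 (c x) * nsq M (f x)))"
    using * by (intro sum.cong) (auto simp: ip_scale_left complex_norm_square mult.assoc simp del: of_real_power)
  finally show ?thesis by (simp only: of_real_sum[symmetric] of_real_eq_iff)
qed

section \<open>Underdetermined systems and subsequences converging at finitely many points\<close>

lemma sum_fun_apply: "(\<Sum>i\<in>I. f i) x = (\<Sum>i\<in>I. f i x)" for f :: "'i \<Rightarrow> 'b \<Rightarrow> 'c::comm_monoid_add"
  by (induction I rule: infinite_finite_induct) auto

text \<open>Unknowns are indexed by \<open>I\<close>, equations by \<open>P\<close>. Used twice: to
  make a combination of eigenfunctions vanish at the cut points, and to make a combination of trial
  functions orthogonal to the eigenfunctions already found.\<close>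

lemma underdetermined_system:
  fixes a :: "'i \<Rightarrow> 'p \<Rightarrow> complex"
  assumes "finite P" "finite I" "card P < card I"
  shows "\<exists>c. (\<exists>i\<in>I. c i \<noteq> 0) \<and> (\<forall>p\<in>P. (\<Sum>i\<in>I. c i * a i p) = 0)"
  using assms
proof (induction P arbitrary: I a rule: finite_induct)
  case empty
  then have "I \<noteq> {}" by auto
  then show ?case by (intro exI[of _ "\<lambda>_. 1"]) auto
next
  case (insert p P)
  show ?case
  proof (cases "\<forall>i\<in>I. a i p = 0")
    case True
    have "card P < card I" using insert by auto
    then obtain c where "\<exists>i\<in>I. c i \<noteq> 0" "\<forall>p\<in>P. (\<Sum>i\<in>I. c i * a i p) = 0"
      using insert.IH[OF insert.prems(1)] by blast
    then show ?thesis using True by (intro exI[of _ c]) auto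
  next
    case False
    then obtain j where j: "j \<in> I" "a j p \<noteq> 0" by auto
    \<comment> \<open>Gaussian elimination: equation \<open>p\<close> is solved for the unknown
      \<open>j\<close> and substituted into the others, which costs one equation and one
      unknown.\<close>
    define a' where "a' i q = a i q - a i p / a j p * a j q" for i q
    have "card P < card (I - {j})" using insert j by auto
    then obtain c where c: "\<exists>i\<in>I - {j}. c i \<noteq> 0" "\<And>q. q \<in> P \<Longrightarrow> (\<Sum>i\<in>I - {j}. c i * a' i q) = 0"
      using insert.IH[of "I - {j}" a'] insert.prems(1) by auto
    define d where "d = c(j := - (\<Sum>i\<in>I - {j}. c i * a i p) / a j p)"
    have d: "(\<Sum>i\<in>I. d i * a i q) = (\<Sum>i\<in>I - {j}. c i * a i q) - (\<Sum>i\<in>I - {j}. c i * a i p) / a j p * a j q" for q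
    proof -
      have "(\<Sum>i\<in>I. d i * a i q) = d j * a j q + (\<Sum>i\<in>I - {j}. d i * a i q)"
        using j insert.prems(1) by (simp add: sum.remove)
      also have "(\<Sum>i\<in>I - {j}. d i * a i q) = (\<Sum>i\<in>I - {j}. c i * a i q)"
        by (intro sum.cong) (auto simp: d_def)
      finally show ?thesis by (simp add: d_def)
    qed
    have "(\<Sum>i\<in>I. d i * a i q) = 0" if "q \<in> insert p P" for q
    proof (cases "q = p")
      case True
      then show ?thesis using j by (simp add: d)
    next
      case False
      then have "(\<Sum>i\<in>I - {j}. c i * a' i q) = 0" using c(2) that by auto
      moreover have "(\<Sum>i\<in>I - {j}. c i * a' i q) = (\<Sum>i\<in>I - {j}. c i * a i q) - (\<Sum>i\<in>I - {j}. c i * a i p) / a j p * a j q"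
        by (simp add: a'_def right_diff_distrib sum_subtractf sum_distrib_right sum_divide_distrib mult.assoc)
      ultimately show ?thesis by (simp add: d)
    qed
    moreover have "\<exists>i\<in>I. d i \<noteq> 0" using c(1) by (auto simp: d_def)
    ultimately show ?thesis by blast
  qed
qed

text \<open>Bolzano-Weierstrass is applied once per point, each time thinning the previous
  subsequence.\<close>

lemma finite_pointwise_subsequence:
  fixes u :: "nat \<Rightarrow> 'p \<Rightarrow> complex"
  assumes "finite P" "\<And>n p. cmod (u n p) \<le> M"
  shows "\<exists>r l. strict_mono r \<and> (\<forall>p\<in>P. (\<lambda>n. u (r n) p) \<longlonglongrightarrow> l p)"
  using assms(1)
proof (induction P rule: finite_induct)
  case empty
  then show ?case by (intro exI[of _ id]) (auto simp: strict_mono_def)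
next
  case (insert p P)
  then obtain r l where r: "strict_mono r" "\<forall>p\<in>P. (\<lambda>n. u (r n) p) \<longlonglongrightarrow> l p" by auto
  have "bounded (range (\<lambda>n. u (r n) p))" using assms(2) by (auto simp: bounded_iff)
  then obtain z s where s: "strict_mono s" "((\<lambda>n. u (r n) p) \<circ> s) \<longlonglongrightarrow> z"
    using bounded_imp_convergent_subsequence by blast
  have "(\<lambda>n. u ((r \<circ> s) n) q) \<longlonglongrightarrow> (l(p := z)) q" if "q \<in> insert p P" for q
  proof (cases "q = p")
    case True
    then show ?thesis using s by (simp add: o_def)
  next
    case False
    then have "(\<lambda>n. u (r n) q) \<longlonglongrightarrow> l q" using r that by auto
    from LIMSEQ_subseq_LIMSEQ[OF this s(1)] show ?thesis using False by (simp add: o_def)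
  qed
  then show ?case using strict_mono_o[OF r(1) s(1)] by blast
qed

section \<open>Weak derivatives\<close>

lemma continuous_measurable_lborel:
  fixes f :: "real \<Rightarrow> complex"
  assumes "continuous_on UNIV f"
  shows "f \<in> borel_measurable lborel"
  using borel_measurable_continuous_onI[OF assms] by simp

lemma integrable_continuous_compact_support:
  fixes f :: "real \<Rightarrow> 'a::{banach, second_countable_topology}"
  assumes "continuous_on UNIV f" "\<And>x. \<bar>x\<bar> > R \<Longrightarrow> f x = 0"
  shows "integrable lborel f"
proof -
  have "integrable lborel (\<lambda>x. indicator {-R..R} x *\<^sub>R f x)"
    by (rule borel_integrable_compact) (use assms(1) continuous_on_subset in auto)
  moreover have "(\<lambda>x. indicator {-R..R} x *\<^sub>R f x) = f"
    using assms(2) by (force simp: indicator_def fun_eq_iff)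
  ultimately show ?thesis by simp
qed

lemma sqint_continuous_compact_support:
  assumes "continuous_on UNIV f" "\<And>x. \<bar>x\<bar> > R \<Longrightarrow> f x = 0"
  shows "f \<in> sqintL"
proof -
  have "integrable lborel (\<lambda>x. abs2 (f x))"
    using assms by (intro integrable_continuous_compact_support[where R=R] continuous_intros) auto
  then show ?thesis using continuous_measurable_lborel[OF assms(1)] by (simp add: sqint_def)
qed

lemma test_functions_support:
  assumes "\<phi> \<in> test_functions"
  obtains R where "\<And>x. \<bar>x\<bar> > R \<Longrightarrow> \<phi> x = 0" "\<And>x. \<bar>x\<bar> > R \<Longrightarrow> deriv \<phi> x = 0"
proof -
  have "bounded {x. \<phi> x \<noteq> 0}"
    using assms compact_imp_bounded bounded_subset[OF _ closure_subset] by (auto simp: test_functions_def)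
  then obtain R where R: "\<And>x. \<phi> x \<noteq> 0 \<Longrightarrow> \<bar>x\<bar> \<le> R" by (auto simp: bounded_iff)
  have "deriv \<phi> x = 0" if "\<bar>x\<bar> > R" for x
  proof -
    have "eventually (\<lambda>y. y \<in> {y. \<bar>y\<bar> > R}) (nhds x)"
      using that by (intro eventually_nhds_in_open open_Collect_less continuous_intros) auto
    then have "eventually (\<lambda>y. \<phi> y = 0) (nhds x)"
      by eventually_elim (use R in force)
    then have "deriv \<phi> x = deriv (\<lambda>_. 0) x" by (intro deriv_cong_ev) auto
    then show ?thesis by simp
  qed
  then show ?thesis using that[of R] R by force
qed

lemma test_functions_sqint:
  assumes "\<phi> \<in> test_functions"
  shows "(\<lambda>x. of_real (\<phi> x)) \<in> sqintL" "(\<lambda>x. of_real (deriv \<phi> x)) \<in> sqintL"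
proof -
  obtain R where R: "\<And>x. \<bar>x\<bar> > R \<Longrightarrow> \<phi> x = 0" "\<And>x. \<bar>x\<bar> > R \<Longrightarrow> deriv \<phi> x = 0"
    using test_functions_support[OF assms] by blast
  have "continuous_on UNIV \<phi>" "continuous_on UNIV (deriv \<phi>)"
    using assms by (auto simp: test_functions_def differentiable_imp_continuous_within continuous_on_eq_continuous_within)
  then show "(\<lambda>x. of_real (\<phi> x)) \<in> sqintL" "(\<lambda>x. of_real (deriv \<phi> x)) \<in> sqintL"
    using R by (auto intro!: sqint_continuous_compact_support[where R=R] continuous_intros)
qed

section \<open>Sobolev pairs of a function and a weak derivative\<close>

lemma has_weak_derivative_ip:
  "has_weak_derivative f g \<longleftrightarrow>
    (\<forall>\<phi>\<in>test_functions. ipL f (\<lambda>x. of_real (deriv \<phi> x)) = - ipL g (\<lambda>x. of_real (\<phi> x)))"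
  by (simp add: has_weak_derivative_def ip_def)

text \<open>A pair carries a concrete derivative because \<open>weak_deriv\<close> is an unspecified
  choice: sums, multiples and limits can be formed without uniqueness, which enters only when
  returning to \<open>form\<close>.\<close>

definition H1_pair :: "(real \<Rightarrow> complex) \<Rightarrow> (real \<Rightarrow> complex) \<Rightarrow> bool" where
  "H1_pair f g \<longleftrightarrow> f \<in> sqintL \<and> g \<in> sqintL \<and> continuous_on UNIV f \<and> has_weak_derivative f g"

lemma H1_pairD:
  assumes "H1_pair f g"
  shows "f \<in> sqintL" "g \<in> sqintL" "continuous_on UNIV f" "has_weak_derivative f g"
  using assms by (auto simp: H1_pair_def)

lemma H1_iff: "f \<in> H1 \<longleftrightarrow> (\<exists>g. H1_pair f g)"
  by (auto simp: H1_def H1_pair_def L2_eq_sqint)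

lemma H1_pair_weak_deriv:
  assumes "f \<in> H1"
  shows "H1_pair f (weak_deriv f)"
proof -
  have "\<exists>g. g \<in> L2 \<and> has_weak_derivative f g" using assms by (auto simp: H1_def)
  then have "weak_deriv f \<in> L2 \<and> has_weak_derivative f (weak_deriv f)"
    unfolding weak_deriv_def by (rule someI_ex)
  then show ?thesis using assms by (auto simp: H1_pair_def H1_def L2_eq_sqint)
qed

lemma H1_pair_add:
  assumes "H1_pair f g" "H1_pair f' g'"
  shows "H1_pair (f + f') (g + g')"
proof -
  note 1 = H1_pairD[OF assms(1)] and 2 = H1_pairD[OF assms(2)]
  have "continuous_on UNIV (f + f')"
    using 1 2 by (auto simp: plus_fun_def intro!: continuous_intros)
  moreover have "has_weak_derivative (f + f') (g + g')"
    using 1 2 test_functions_sqint by (simp add: has_weak_derivative_ip ip_add_left)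
  ultimately show ?thesis using 1 2 by (auto simp: H1_pair_def intro: sqint_add)
qed

lemma H1_pair_scale:
  assumes "H1_pair f g"
  shows "H1_pair (\<lambda>x. c * f x) (\<lambda>x. c * g x)"
proof -
  note 1 = H1_pairD[OF assms(1)]
  have "has_weak_derivative (\<lambda>x. c * f x) (\<lambda>x. c * g x)"
    using 1(4) by (simp add: has_weak_derivative_ip ip_scale_left)
  then show ?thesis using 1 by (auto simp: H1_pair_def intro!: sqint_scale continuous_intros)
qed

lemma H1_pair_diff:
  assumes "H1_pair f g" "H1_pair f' g'"
  shows "H1_pair (f - f') (g - g')"
  using H1_pair_add[OF assms(1) H1_pair_scale[OF assms(2), of "-1"]]
  by (simp add: plus_fun_def fun_diff_def)

lemma H1_pair_zero: "H1_pair 0 0"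
  by (auto simp: H1_pair_def has_weak_derivative_def zero_fun_def[symmetric] intro!: continuous_intros)
    (simp add: zero_fun_def)

lemma H1_pair_sum:
  assumes "\<And>i. i \<in> I \<Longrightarrow> H1_pair (f i) (g i)"
  shows "H1_pair (\<Sum>i\<in>I. f i) (\<Sum>i\<in>I. g i)"
  using assms by (induction I rule: infinite_finite_induct) (auto intro: H1_pair_add H1_pair_zero)

text \<open>Both sides of the defining identity are L^2 products with a fixed function.\<close>

lemma has_weak_derivative_limit:
  assumes "\<And>n. H1_pair (f n) (g n)" "f' \<in> sqintL" "g' \<in> sqintL"
    and "(\<lambda>n. nsqL (f n - f')) \<longlonglongrightarrow> 0" "(\<lambda>n. nsqL (g n - g')) \<longlonglongrightarrow> 0"
  shows "has_weak_derivative f' g'"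
  unfolding has_weak_derivative_ip
proof
  fix \<phi> assume \<phi>: "\<phi> \<in> test_functions"
  note tf = test_functions_sqint[OF \<phi>]
  have "(\<lambda>n. ipL (f n) (\<lambda>x. of_real (deriv \<phi> x))) \<longlonglongrightarrow> ipL f' (\<lambda>x. of_real (deriv \<phi> x))"
    using H1_pairD[OF assms(1)] assms tf by (intro tendsto_ip_left) auto
  moreover have "ipL (f n) (\<lambda>x. of_real (deriv \<phi> x)) = - ipL (g n) (\<lambda>x. of_real (\<phi> x))" for n
    using H1_pairD(4)[OF assms(1)] \<phi> by (auto simp: has_weak_derivative_ip)
  moreover have "(\<lambda>n. - ipL (g n) (\<lambda>x. of_real (\<phi> x))) \<longlonglongrightarrow> - ipL g' (\<lambda>x. of_real (\<phi> x))"
    using H1_pairD[OF assms(1)] assms tf by (intro tendsto_minus tendsto_ip_left) auto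
  ultimately show "ipL f' (\<lambda>x. of_real (deriv \<phi> x)) = - ipL g' (\<lambda>x. of_real (\<phi> x))"
    using LIMSEQ_unique by simp
qed

section \<open>C^1 cutoffs and one-sided mollifiers\<close>

definition step :: "real \<Rightarrow> real" where
  "step t = ((max 0 t)\<^sup>2 - 2 * (max 0 (t - 1))\<^sup>2 + (max 0 (t - 2))\<^sup>2) / 2"

text \<open>The hat function on [0, 2] with peak 1 and integral 1. Its antiderivative
  \<open>step\<close> is a combination of truncated squares and so has the C^1 smoothness that
  \<open>test_functions\<close> asks for.\<close>

definition step' :: "real \<Rightarrow> real" where
  "step' t = max 0 t - 2 * max 0 (t - 1) + max 0 (t - 2)"

lemma DERIV_max_0_square: "((\<lambda>t. (max 0 t)\<^sup>2) has_real_derivative 2 * max 0 t) (at t)" for t :: real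
proof -
  consider "t < 0" | "t > 0" | "t = 0" by linarith
  then show ?thesis
  proof cases
    case 1
    have "((\<lambda>t. 0) has_real_derivative 2 * max 0 t) (at t)" using 1 by auto
    moreover have "eventually (\<lambda>s. s \<in> {..<0}) (nhds t)" using 1 by (intro eventually_nhds_in_open) auto
    then have "eventually (\<lambda>s. 0 = (max 0 s)\<^sup>2) (nhds t)" by eventually_elim (auto simp: max_def)
    ultimately show ?thesis by (subst DERIV_cong_ev[OF refl _ refl, of _ "\<lambda>_. 0"]) (auto elim: eventually_mono)
  next
    case 2
    have "((\<lambda>t. t\<^sup>2) has_real_derivative 2 * max 0 t) (at t)" using 2 by (auto intro!: derivative_eq_intros)
    moreover have "eventually (\<lambda>s. s \<in> {0<..}) (nhds t)" using 2 by (intro eventually_nhds_in_open) auto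
    then have "eventually (\<lambda>s. (max 0 s)\<^sup>2 = s\<^sup>2) (nhds t)" by eventually_elim (auto simp: max_def)
    ultimately show ?thesis by (subst DERIV_cong_ev[OF refl _ refl, of _ "\<lambda>t. t\<^sup>2"]) auto
  next
    case 3
    have "(\<lambda>h. (max 0 h)\<^sup>2 / h) \<midarrow>0\<rightarrow> (0::real)"
    proof (rule Lim_null_comparison)
      show "\<forall>\<^sub>F h in at (0::real). norm ((max 0 h)\<^sup>2 / h) \<le> \<bar>h\<bar>"
        by (rule always_eventually) (auto simp: max_def power2_eq_square)
      show "(\<lambda>h. \<bar>h\<bar>) \<midarrow>0\<rightarrow> (0::real)" by (rule tendsto_rabs_zero) auto
    qed
    then show ?thesis using 3 by (simp add: DERIV_def)
  qed
qed

lemma DERIV_step: "(step has_real_derivative step' t) (at t)"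
proof -
  have *: "((\<lambda>t. (max 0 (t - c))\<^sup>2) has_real_derivative 2 * max 0 (t - c)) (at t)" for c :: real
    using DERIV_shift[of "\<lambda>t. (max 0 t)\<^sup>2" "2 * max 0 (t - c)" t "- c"] DERIV_max_0_square[of "t - c"]
    by simp
  have "((\<lambda>t. ((max 0 t)\<^sup>2 - 2 * (max 0 (t - 1))\<^sup>2 + (max 0 (t - 2))\<^sup>2) / 2) has_real_derivative
      (2 * max 0 t - 2 * (2 * max 0 (t - 1)) + 2 * max 0 (t - 2)) / 2) (at t)"
    by (intro DERIV_cdivide DERIV_add DERIV_diff DERIV_cmult DERIV_max_0_square *)
  then show ?thesis unfolding step_def[abs_def] step'_def
    by (rule DERIV_cong) simp
qed

lemma step_simps:
  "t \<le> 0 \<Longrightarrow> step t = 0" "t \<ge> 2 \<Longrightarrow> step t = 1"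
  "t \<le> 0 \<Longrightarrow> step' t = 0" "t \<ge> 2 \<Longrightarrow> step' t = 0"
  by (auto simp: step_def step'_def max_def power2_eq_square algebra_simps)

lemma step'_bounds: "0 \<le> step' t" "step' t \<le> 1"
  by (auto simp: step'_def max_def)

lemma continuous_step': "continuous_on A step'"
  unfolding step'_def[abs_def] by (intro continuous_intros)

lemma step_bounds: "0 \<le> step t" "step t \<le> 1"
proof -
  have mono: "step s \<le> step t" if "s \<le> t" for s t
  proof (rule DERIV_nonneg_imp_nondecreasing[OF that])
    show "\<exists>y. (step has_real_derivative y) (at r) \<and> 0 \<le> y" for r
      using DERIV_step[of r] step'_bounds(1)[of r] by blast
  qed
  show "0 \<le> step t" using mono[of "min 0 t" t] by (simp add: step_simps)
  show "step t \<le> 1" using mono[of t "max 2 t"] by (simp add: step_simps)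
qed

lemma integral_step': "(\<integral>s. of_real (step' s) \<partial>lborel) = (1::complex)"
proof -
  have "(\<integral>s. step' s * indicator {0..2} s \<partial>lborel) = step 2 - step 0"
    using continuous_step'[of UNIV] by (intro integral_FTC_Icc_real DERIV_step)
      (auto simp: continuous_on_eq_continuous_at)
  moreover have "(\<lambda>s. step' s * indicator {0..2} s) = step'"
  proof
    show "step' s * indicator {0..2} s = step' s" for s
      using step_simps(3,4)[of s] by (cases "s \<in> {0..2}") auto
  qed
  ultimately have "(\<integral>s. step' s \<partial>lborel) = 1" by (simp add: step_simps)
  then show ?thesis by (simp add: integral_complex_of_real)
qed

text \<open>A rising ramp on [x, x + 2e] and a falling one on [y, y + 2e]; the derivative is a
  mollifier at \<open>x\<close> minus a mollifier at \<open>y\<close>. Both ramps lie to the right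
  of their endpoints, which is why the limit as e tends to 0 is the indicator of a half-open
  interval.\<close>

definition plateau :: "real \<Rightarrow> real \<Rightarrow> real \<Rightarrow> real \<Rightarrow> real" where
  "plateau x y e t = step ((t - x) / e) - step ((t - y) / e)"

lemma DERIV_plateau:
  assumes "e > 0"
  shows "(plateau x y e has_real_derivative (step' ((t - x) / e) / e - step' ((t - y) / e) / e)) (at t)"
proof -
  have *: "((\<lambda>t. step ((t - c) / e)) has_real_derivative step' ((t - c) / e) / e) (at t)" for c
  proof -
    have "((\<lambda>t. (t - c) / e) has_real_derivative 1 / e) (at t)"
      using assms by (auto intro!: derivative_eq_intros)
    then show ?thesis
      using DERIV_chain2[where f = step and g = "\<lambda>t. (t - c) / e", OF DERIV_step] by fastforce
  qed
  show ?thesis unfolding plateau_def[abs_def] by (intro DERIV_diff *)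
qed

lemma plateau_outside:
  assumes "e > 0" "x \<le> y" and t: "t \<notin> {x..y + 2 * e}"
  shows "plateau x y e t = 0"
proof -
  consider "t < x" | "t > y + 2 * e" using t by force
  then show ?thesis
  proof cases
    case 1
    then have "(t - x) / e \<le> 0" "(t - y) / e \<le> 0" using assms by (auto simp: field_simps)
    then show ?thesis by (simp add: plateau_def step_simps)
  next
    case 2
    then have "(t - x) / e \<ge> 2" "(t - y) / e \<ge> 2" using assms by (auto simp: field_simps)
    then show ?thesis by (simp add: plateau_def step_simps)
  qed
qed

lemma plateau_test_function:
  assumes "e > 0" "x \<le> y"
  shows "plateau x y e \<in> test_functions"
    and "deriv (plateau x y e) t = step' ((t - x) / e) / e - step' ((t - y) / e) / e"
proof -
  show d: "deriv (plateau x y e) t = step' ((t - x) / e) / e - step' ((t - y) / e) / e" for t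
    using DERIV_plateau[OF assms(1)] by (rule DERIV_imp_deriv)
  have "{t. plateau x y e t \<noteq> 0} \<subseteq> {x..y + 2 * e}"
    using plateau_outside[OF assms] by blast
  then have "bounded {t. plateau x y e t \<noteq> 0}" using bounded_closed_interval bounded_subset by blast
  then have "compact (closure {t. plateau x y e t \<noteq> 0})" by (simp only: compact_closure)
  moreover have "continuous_on UNIV (deriv (plateau x y e))"
    unfolding d[abs_def] using assms
    by (intro continuous_intros continuous_on_compose2[OF continuous_step'[of UNIV]]) auto
  ultimately show "plateau x y e \<in> test_functions"
    using DERIV_plateau[OF assms(1)] by (auto simp: test_functions_def real_differentiable_def)
qed

lemma plateau_bound: "\<bar>plateau x y e t\<bar> \<le> 1"
  using step_bounds[of "(t - x) / e"] step_bounds[of "(t - y) / e"]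
  by (auto simp: plateau_def)

lemma plateau_limit:
  assumes "x \<le> y"
  shows "(\<lambda>n. plateau x y (1 / real (Suc n)) t) \<longlonglongrightarrow> indicator {x<..y} t"
proof -
  let ?e = "\<lambda>n. 1 / real (Suc n)"
  have *: "(\<lambda>n. step ((t - c) / (?e n))) \<longlonglongrightarrow> (if t > c then 1 else 0)" for c
  proof (cases "t > c")
    case True
    obtain N where N: "real N > 2 / (t - c)" using reals_Archimedean2 by blast
    have "step ((t - c) / (?e n)) = 1" if "n \<ge> N" for n
    proof -
      have "2 / (t - c) \<le> real (Suc n)" using N that by linarith
      then have "2 \<le> (t - c) * real (Suc n)" using True by (simp add: field_simps)
      then show ?thesis by (simp add: step_simps)
    qed
    then have "\<forall>\<^sub>F n in sequentially. step ((t - c) / (?e n)) = 1"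
      using eventually_sequentially by blast
    then show ?thesis using True by (simp add: tendsto_eventually)
  next
    case False
    then have "step ((t - c) / (?e n)) = 0" for n
      by (intro step_simps) (simp add: mult_nonpos_nonneg)
    then show ?thesis using False by simp
  qed
  have "(\<lambda>n. plateau x y (?e n) t) \<longlonglongrightarrow> (if t > x then 1 else 0) - (if t > y then 1 else 0)"
    unfolding plateau_def by (intro tendsto_diff *)
  moreover have "(if t > x then 1 else 0) - (if t > y then 1 else 0) = (indicator {x<..y} t :: real)"
    using assms by (auto simp: indicator_def)
  ultimately show ?thesis by simp
qed

text \<open>After the substitution t = x + e s the kernel is the fixed hat \<open>step'\<close>;
  continuity of \<open>f\<close> at \<open>x\<close> and dominated convergence give the
  limit.\<close>

lemma approximate_identity:
  fixes f :: "real \<Rightarrow> complex"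
  assumes f: "continuous_on UNIV f"
  shows "(\<lambda>n. \<integral>t. f t * of_real (step' ((t - x) / (1 / real (Suc n))) / (1 / real (Suc n))) \<partial>lborel) \<longlonglongrightarrow> f x"
proof -
  let ?e = "\<lambda>n. 1 / real (Suc n)"
  have [measurable]: "f \<in> borel_measurable borel" using f by (rule borel_measurable_continuous_onI)
  have [measurable]: "step' \<in> borel_measurable borel"
    using continuous_step' by (rule borel_measurable_continuous_onI)
  \<comment> \<open>Since the scale is at most 1 and \<open>step'\<close> lives on [0, 2], every
    relevant value of \<open>f\<close> is taken in [x, x + 2].\<close>
  have "compact (f ` {x..x+2})" using f by (intro compact_continuous_image) (auto intro: continuous_on_subset)
  then obtain M where M: "\<And>t. t \<in> {x..x+2} \<Longrightarrow> cmod (f t) \<le> M"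
    using compact_imp_bounded by (fastforce simp: bounded_iff)
  have eq: "(\<integral>t. f t * of_real (step' ((t - x) / e) / e) \<partial>lborel) = (\<integral>s. f (x + e * s) * of_real (step' s) \<partial>lborel)"
    if "e > 0" for e
  proof -
    have "(\<integral>t. f t * of_real (step' ((t - x) / e) / e) \<partial>lborel)
       = e *\<^sub>R (\<integral>s. f (x + e * s) * of_real (step' s / e) \<partial>lborel)"
      using that by (subst lborel_integral_real_affine[of e _ x]) auto
    also have "\<dots> = (\<integral>s. e *\<^sub>R (f (x + e * s) * of_real (step' s / e)) \<partial>lborel)"
      by simp
    also have "\<dots> = (\<integral>s. f (x + e * s) * of_real (step' s) \<partial>lborel)"
      using that by (intro Bochner_Integration.integral_cong) (auto simp: scaleR_conv_of_real)
    finally show ?thesis .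
  qed
  have "(\<lambda>n. \<integral>s. f (x + (?e n) * s) * of_real (step' s) \<partial>lborel) \<longlonglongrightarrow>
      (\<integral>s. f x * of_real (step' s) \<partial>lborel)"
  proof (rule integral_dominated_convergence[where w = "\<lambda>s. M * indicator {0..2} s"])
    show "integrable lborel (\<lambda>s :: real. M * indicator {0..2} s)"
      by (intro integrable_mult_right integrable_real_indicator) auto
    show "AE s in lborel. (\<lambda>n. f (x + (?e n) * s) * of_real (step' s)) \<longlonglongrightarrow> f x * of_real (step' s)"
    proof (rule AE_I2)
      fix s
      have "(\<lambda>n. x + (?e n) * s) \<longlonglongrightarrow> x + 0 * s"
        using LIMSEQ_inverse_real_of_nat by (intro tendsto_intros) (simp add: inverse_eq_divide)
      then have "(\<lambda>n. f (x + (?e n) * s)) \<longlonglongrightarrow> f x"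
        using f by (intro isCont_tendsto_compose[of x f]) (auto simp: continuous_on_eq_continuous_at)
      then show "(\<lambda>n. f (x + (?e n) * s) * of_real (step' s)) \<longlonglongrightarrow> f x * of_real (step' s)"
        by (rule tendsto_mult_right)
    qed
    show "AE s in lborel. norm (f (x + (?e n) * s) * of_real (step' s)) \<le> M * indicator {0..2} s" for n
    proof (rule AE_I2)
      fix s
      show "norm (f (x + (?e n) * s) * of_real (step' s)) \<le> M * indicator {0..2} s"
      proof (cases "s \<in> {0..2}")
        case True
        then have "(?e n) * s \<le> 1 * s" by (intro mult_right_mono) auto
        then have "x + (?e n) * s \<in> {x..x+2}" using True by auto
        from M[OF this] have "cmod (f (x + (?e n) * s)) * step' s \<le> M * 1"
          using step'_bounds[of s] order_trans[OF norm_ge_zero M[OF \<open>x + (?e n) * s \<in> {x..x+2}\<close>]]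
          by (intro mult_mono) auto
        then show ?thesis using True step'_bounds(1)[of s] by (simp only: norm_mult norm_of_real abs_of_nonneg indicator_simps)
      next
        case False
        then show ?thesis by (auto simp: step_simps)
      qed
    qed
  qed measurable
  moreover have "(\<integral>s. f x * of_real (step' s) \<partial>lborel) = f x"
    using integral_step' by simp
  moreover have "(\<integral>t. f t * of_real (step' ((t - x) / (?e n)) / (?e n)) \<partial>lborel)
      = (\<integral>s. f (x + (?e n) * s) * of_real (step' s) \<partial>lborel)" for n
    by (rule eq) simp
  ultimately show ?thesis by (simp only:)
qed

section \<open>The fundamental theorem of calculus for Sobolev pairs\<close>

lemma indicator_sqint:
  assumes "f \<in> sqint M" "A \<in> sets M"
  shows "(\<lambda>x. indicator A x * f x) \<in> sqint M"
proof -
  have "integrable M (\<lambda>x. indicator A x *\<^sub>R abs2 (f x))"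
    using sqintD(2)[OF assms(1)] assms(2) by (intro integrable_mult_indicator)
  moreover have "(\<lambda>x. abs2 (indicator A x * f x)) = (\<lambda>x. indicator A x *\<^sub>R abs2 (f x))"
    by (auto simp: fun_eq_iff indicator_def)
  ultimately show ?thesis using sqintD(1)[OF assms(1)] assms(2) by (simp add: sqint_def)
qed

lemma indicator_Icc_sqint: "(indicator {a..b} :: real \<Rightarrow> complex) \<in> sqintL"
proof -
  have "integrable lborel (indicator {a..b} :: real \<Rightarrow> real)"
    by (intro integrable_real_indicator) (auto simp: emeasure_lborel_Icc_eq)
  moreover have "(\<lambda>x. abs2 (indicator {a..b} x)) = (indicator {a..b} :: real \<Rightarrow> real)"
    by (auto simp: fun_eq_iff indicator_def)
  ultimately show ?thesis by (simp add: sqint_def)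
qed

lemma integrable_indicator_Icc:
  assumes "g \<in> sqintL"
  shows "integrable lborel (\<lambda>x. indicator {a..b} x *\<^sub>R g x)"
proof -
  have "integrable lborel (\<lambda>x. g x * cnj (indicator {a..b} x))"
    using assms indicator_Icc_sqint by (rule integrable_mult_cnj)
  moreover have "(\<lambda>x. g x * cnj (indicator {a..b} x)) = (\<lambda>x. indicator {a..b} x *\<^sub>R g x)"
    by (auto simp: fun_eq_iff indicator_def)
  ultimately show ?thesis by simp
qed

lemma integrable_mult_mollifier:
  fixes f :: "real \<Rightarrow> complex"
  assumes f: "continuous_on UNIV f" and e: "0 < e"
  shows "integrable lborel (\<lambda>t. f t * of_real (step' ((t - c) / e) / e))"
proof (rule integrable_continuous_compact_support[where R = "\<bar>c\<bar> + 2 * e"])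
  show "continuous_on UNIV (\<lambda>t. f t * of_real (step' ((t - c) / e) / e))"
    using e by (intro continuous_intros f continuous_on_compose2[OF continuous_step'[of UNIV]]) auto
  fix t assume t: "\<bar>c\<bar> + 2 * e < \<bar>t\<bar>"
  then consider "t < c" | "t > c + 2 * e" using e by linarith
  then have "step' ((t - c) / e) = 0"
  proof cases
    case 1
    then have "(t - c) / e \<le> 0" using e by (simp add: field_simps)
    then show ?thesis by (rule step_simps)
  next
    case 2
    then have "(t - c) / e \<ge> 2" using e by (simp add: field_simps)
    then show ?thesis by (rule step_simps)
  qed
  then show "f t * of_real (step' ((t - c) / e) / e) = 0" by simp
qed

text \<open>The weak derivative is tested against \<open>plateau\<close>: continuity of
  \<open>f\<close> makes the mollified values converge at every point, and dominated convergence
  handles \<open>g\<close>. A dominating function supported on [x, y + 2] exists because the scale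
  is at most 1.\<close>

lemma H1_pair_FTC:
  assumes fg: "H1_pair f g" and xy: "x \<le> y"
  shows "f y - f x = (LINT t:{x..y}|lborel. g t)"
proof -
  note H = H1_pairD[OF fg]
  note [measurable] = sqintD(1)[OF H(2)]
  let ?e = "\<lambda>n. 1 / real (Suc n)"
  have int_f: "integrable lborel (\<lambda>t. f t * of_real (step' ((t - c) / ?e n) / ?e n))" for c n
    using integrable_mult_mollifier[OF H(3), of "?e n" c] by simp
  have lim1: "(\<lambda>n. (\<integral>t. f t * of_real (step' ((t - x) / ?e n) / ?e n) \<partial>lborel)
         - (\<integral>t. f t * of_real (step' ((t - y) / ?e n) / ?e n) \<partial>lborel)) \<longlonglongrightarrow> f x - f y"
    by (intro tendsto_diff approximate_identity H)
  have eq: "(\<integral>t. f t * of_real (step' ((t - x) / ?e n) / ?e n) \<partial>lborel)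
         - (\<integral>t. f t * of_real (step' ((t - y) / ?e n) / ?e n) \<partial>lborel)
         = - (\<integral>t. g t * of_real (plateau x y (?e n) t) \<partial>lborel)" for n
  proof -
    have "(\<integral>t. f t * of_real (deriv (plateau x y (?e n)) t) \<partial>lborel) = - (\<integral>t. g t * of_real (plateau x y (?e n) t) \<partial>lborel)"
      using H(4) plateau_test_function(1)[of "?e n" x y] xy by (simp add: has_weak_derivative_def)
    moreover have "(\<lambda>t. f t * of_real (deriv (plateau x y (?e n)) t)) = (\<lambda>t. f t * of_real (step' ((t - x) / ?e n) / ?e n)
        - f t * of_real (step' ((t - y) / ?e n) / ?e n))"
      using xy by (subst plateau_test_function(2)) (auto simp: algebra_simps)
    ultimately show ?thesis using Bochner_Integration.integral_diff[OF int_f int_f, of x n y n] by simp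
  qed
  have lim2: "(\<lambda>n. \<integral>t. g t * of_real (plateau x y (?e n) t) \<partial>lborel) \<longlonglongrightarrow> (\<integral>t. g t * indicator {x<..y} t \<partial>lborel)"
  proof (rule integral_dominated_convergence[where w = "\<lambda>t. cmod (indicator {x..y+2} t *\<^sub>R g t)"])
    show "integrable lborel (\<lambda>t. cmod (indicator {x..y+2} t *\<^sub>R g t))"
      by (intro integrable_norm integrable_indicator_Icc H)
    show "AE t in lborel. (\<lambda>n. g t * of_real (plateau x y (?e n) t)) \<longlonglongrightarrow> g t * indicator {x<..y} t"
    proof (rule AE_I2)
      fix t
      have "(\<lambda>n. g t * of_real (plateau x y (?e n) t)) \<longlonglongrightarrow> g t * of_real (indicator {x<..y} t)"
        by (intro tendsto_intros plateau_limit xy)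
      then show "(\<lambda>n. g t * of_real (plateau x y (?e n) t)) \<longlonglongrightarrow> g t * indicator {x<..y} t"
        by (auto simp: indicator_def)
    qed
    show "AE t in lborel. norm (g t * of_real (plateau x y (?e n) t)) \<le> cmod (indicator {x..y+2} t *\<^sub>R g t)" for n
    proof (rule AE_I2)
      fix t
      show "norm (g t * of_real (plateau x y (?e n) t)) \<le> cmod (indicator {x..y+2} t *\<^sub>R g t)"
      proof (cases "t \<in> {x..y+2}")
        case True
        then show ?thesis using plateau_bound[of x y "?e n" t] by (simp add: norm_mult mult_left_le)
      next
        case False
        moreover have "?e n \<le> 1" by simp
        then have "y + 2 * ?e n \<le> y + 2" by linarith
        ultimately have "t \<notin> {x..y + 2 * ?e n}" unfolding atLeastAtMost_iff by linarith
        then have "plateau x y (?e n) t = 0" using xy by (intro plateau_outside) auto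
        then show ?thesis by simp
      qed
    qed
    have "continuous_on UNIV (plateau x y (?e n))" for n
      using DERIV_plateau[of "?e n" x y] DERIV_isCont by (auto simp: continuous_on_eq_continuous_at)
    then have "plateau x y (?e n) \<in> borel_measurable borel" for n by (rule borel_measurable_continuous_onI)
    then show "(\<lambda>t. g t * of_real (plateau x y (?e n) t)) \<in> borel_measurable lborel" for n
      by (intro borel_measurable_times borel_measurable_of_real) auto
  qed measurable
  have "f x - f y = - (\<integral>t. g t * indicator {x<..y} t \<partial>lborel)"
    using lim1 tendsto_minus[OF lim2] unfolding eq by (rule LIMSEQ_unique)
  moreover have "(\<integral>t. g t * indicator {x<..y} t \<partial>lborel) = (LINT t:{x..y}|lborel. g t)"
    unfolding set_lebesgue_integral_def
  proof (rule integral_cong_AE)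
    show "AE t in lborel. g t * indicator {x<..y} t = indicator {x..y} t *\<^sub>R g t"
      using AE_lborel_singleton[of x] by eventually_elim (auto simp: indicator_def)
  qed measurable
  ultimately show ?thesis by (simp add: algebra_simps)
qed

text \<open>The sets over which the truncated function integrates to zero form a Dynkin system
  containing the intervals. Truncation to [-n, n] comes first because an L^2 function need not be
  integrable on the whole line.\<close>

lemma integral_Icc_zero_imp_AE_zero:
  fixes h :: "real \<Rightarrow> complex"
  assumes h: "h \<in> sqintL" and zero: "\<And>a b. a \<le> b \<Longrightarrow> (LINT t:{a..b}|lborel. h t) = 0"
  shows "AE x in lborel. h x = 0"
proof -
  have "AE x in lborel. indicator {- real n..real n} x *\<^sub>R h x = 0" for n
  proof (rule sigma_finite_measure.density_zero[OF lborel.sigma_finite_measure_axioms])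
    define k where "k = (\<lambda>x. indicator {- real n..real n} x *\<^sub>R h x)"
    show int: "integrable lborel k" unfolding k_def by (rule integrable_indicator_Icc[OF h])
    have sint: "set_integrable lborel A k" if "A \<in> sets lborel" for A
      using integrable_mult_indicator[OF that int] by (simp add: set_integrable_def)
    \<comment> \<open>Complements are handled by subtraction from the whole line.\<close>
    have whole: "(LINT x:UNIV|lborel. k x) = 0"
      using zero[of "- real n" "real n"] by (simp add: k_def set_lebesgue_integral_def)
    fix A :: "real set" assume "A \<in> sets lborel"
    then have gen: "A \<in> sigma_sets UNIV (range (\<lambda>(a,b). {a..b}))"
      by (simp add: borel_eq_atLeastAtMost[where 'a=real])
    have "Int_stable (range (\<lambda>(a,b). {a..b::real}))"
      by (auto simp: Int_stable_def)
    moreover have "range (\<lambda>(a,b). {a..b::real}) \<subseteq> Pow UNIV" by simp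
    ultimately show "(LINT x:A|lborel. k x) = 0" using gen
    proof (induction A rule: sigma_sets_induct_disjoint)
      case (basic A)
      then obtain a b where A: "A = {a..b}" by auto
      have "(LINT x:A|lborel. k x) = (LINT x:{max a (- real n)..min b (real n)}|lborel. h x)"
        unfolding set_lebesgue_integral_def k_def A
        by (intro Bochner_Integration.integral_cong) (auto simp: indicator_def)
      also have "\<dots> = 0"
      proof (cases "max a (- real n) \<le> min b (real n)")
        case False
        then have "{max a (- real n)..min b (real n)} = {}" by simp
        then show ?thesis by (simp add: set_lebesgue_integral_def)
      qed (rule zero)
      finally show ?case .
    next
      case empty
      then show ?case by (simp add: set_lebesgue_integral_def)
    next
      case (compl A)
      then have A: "A \<in> sets lborel" by (simp add: borel_eq_atLeastAtMost[where 'a=real])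
      have "(LINT x:A \<union> (UNIV - A)|lborel. k x) = (LINT x:A|lborel. k x) + (LINT x:(UNIV - A)|lborel. k x)"
        using A by (intro set_integral_Un sint) auto
      then show ?case using compl whole by (simp add: Un_absorb1)
    next
      case (union A)
      then have "A i \<in> sets lborel" for i by (auto simp: borel_eq_atLeastAtMost[where 'a=real])
      then have "(LINT x:(\<Union>i. A i)|lborel. k x) = (\<Sum>i. (LINT x:(A i)|lborel. k x))"
        using union(1) by (intro lebesgue_integral_countable_add sint) (auto simp: disjoint_family_on_def)
      then show ?case using union by simp
    qed
  qed
  then have "AE x in lborel. \<forall>n. indicator {- real n..real n} x *\<^sub>R h x = 0"
    by (subst AE_all_countable) blast
  then show ?thesis
  proof eventually_elim
    case (elim x)
    obtain n where "\<bar>x\<bar> \<le> real n" using real_arch_simple by blast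
    then show ?case using elim[rule_format, of n] by (auto simp: indicator_def)
  qed
qed

text \<open>The difference is a weak derivative of the zero function, so all its interval integrals
  vanish.\<close>

lemma H1_pair_unique:
  assumes "H1_pair f g" "H1_pair f g'"
  shows "AE x in lborel. g x = g' x"
proof -
  have "AE x in lborel. (g - g') x = 0"
  proof (rule integral_Icc_zero_imp_AE_zero)
    show "g - g' \<in> sqintL" using assms H1_pairD(2) sqint_diff by blast
    have "H1_pair 0 (g - g')" using H1_pair_diff[OF assms] by simp
    from H1_pair_FTC[OF this] show "(LINT t:{a..b}|lborel. (g - g') t) = 0" if "a \<le> b" for a b
      using that by simp
  qed
  then show ?thesis by simp
qed

lemma weak_deriv_AE:
  assumes "H1_pair f g"
  shows "AE x in lborel. weak_deriv f x = g x"
  using H1_pair_unique[OF H1_pair_weak_deriv assms] assms by (auto simp: H1_iff)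

section \<open>Local estimates in the Sobolev space\<close>

text \<open>Encoded through the truncated function so that the L^2 lemmas apply on a bounded cell
  even before \<open>f\<close> is known to be square integrable with respect to \<mu>.\<close>

definition loc :: "real measure \<Rightarrow> real set \<Rightarrow> (real \<Rightarrow> complex) \<Rightarrow> real" where
  "loc M A f = nsq M (\<lambda>x. indicator A x * f x)"

abbreviation "locL \<equiv> loc lborel"

lemma loc_eq: "loc M A f = (\<integral>x. indicator A x * abs2 (f x) \<partial>M)"
  unfolding loc_def nsq_def
  by (intro Bochner_Integration.integral_cong) (auto simp: indicator_def)

lemma loc_nonneg [simp]: "0 \<le> loc M A f"
  by (simp add: loc_def)

lemma loc_integrable:
  assumes "f \<in> sqint M" "A \<in> sets M"
  shows "integrable M (\<lambda>x. indicator A x * abs2 (f x))"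
  using integrable_mult_indicator[OF assms(2) sqintD(2)[OF assms(1)]] by simp

lemma loc_mono:
  assumes "f \<in> sqint M" "A \<in> sets M" "B \<in> sets M" "A \<subseteq> B"
  shows "loc M A f \<le> loc M B f"
  unfolding loc_eq using assms(4)
  by (intro integral_mono loc_integrable assms(1-3)) (auto simp: indicator_def)

lemma loc_le_nsq:
  assumes "f \<in> sqint M" "A \<in> sets M"
  shows "loc M A f \<le> nsq M f"
  unfolding loc_eq nsq_def
  by (intro integral_mono loc_integrable assms sqintD(2)[OF assms(1)]) (auto simp: indicator_def)

text \<open>Cells are half-open so that an atom of \<mu> at a cut point is counted once, while the
  pointwise estimates live on closed cells; for Lebesgue measure the two agree.\<close>

lemma loc_lborel_Icc:
  assumes "f \<in> sqintL"
  shows "locL {a..b} f = locL {a..<b} f"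
  unfolding loc_def
proof (rule nsq_cong_AE)
  note [measurable] = sqintD(1)[OF assms]
  show "AE x in lborel. indicator {a..b} x * f x = indicator {a..<b} x * f x"
    using AE_lborel_singleton[of b] by eventually_elim (auto simp: indicator_def)
  show "(\<lambda>x. indicator {a..b} x * f x) \<in> borel_measurable lborel" by measurable
  show "(\<lambda>x. indicator {a..<b} x * f x) \<in> borel_measurable lborel" by measurable
qed

lemma loc_add:
  assumes f: "(\<lambda>x. indicator {a..<c} x * f x) \<in> sqint M" and M: "sets M = sets borel" and abc: "a \<le> b" "b \<le> c"
  shows "loc M {a..<c} f = loc M {a..<b} f + loc M {b..<c} f"
proof -
  have int: "integrable M (\<lambda>x. indicator {d..<e} x * abs2 (f x))" if "a \<le> d" "e \<le> c" for d e
  proof -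
    have "(\<lambda>x. indicator {d..<e} x * abs2 (indicator {a..<c} x * f x)) = (\<lambda>x. indicator {d..<e} x * abs2 (f x))"
      using that by (auto simp: fun_eq_iff indicator_def)
    then show ?thesis using loc_integrable[OF f, of "{d..<e}"] M by simp
  qed
  have "loc M {a..<b} f + loc M {b..<c} f
      = (\<integral>x. indicator {a..<b} x * abs2 (f x) + indicator {b..<c} x * abs2 (f x) \<partial>M)"
    unfolding loc_eq using abc by (intro Bochner_Integration.integral_add[symmetric] int) auto
  also have "\<dots> = loc M {a..<c} f"
    unfolding loc_eq using abc by (intro Bochner_Integration.integral_cong) (auto simp: indicator_def)
  finally show ?thesis by simp
qed

lemma H1_pair_Hoelder:
  assumes fg: "H1_pair f g" and xy: "x \<in> {a..b}" "y \<in> {a..b}"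
  shows "abs2 (f y - f x) \<le> \<bar>y - x\<bar> * locL {a..b} g"
proof -
  have *: "abs2 (f y - f x) \<le> (y - x) * locL {a..b} g"
    if xy: "x \<in> {a..b}" "y \<in> {a..b}" "x \<le> y" for x y
  proof -
    have g: "(\<lambda>t. indicator {a..b} t * g t) \<in> sqintL"
      by (intro indicator_sqint H1_pairD[OF fg]) auto
    have "f y - f x = (LINT t:{x..y}|lborel. g t)" by (rule H1_pair_FTC[OF fg that(3)])
    also have "\<dots> = ipL (\<lambda>t. indicator {a..b} t * g t) (indicator {x..y})"
      unfolding set_lebesgue_integral_def ip_def using xy
      by (intro Bochner_Integration.integral_cong) (auto simp: indicator_def)
    finally have "abs2 (f y - f x) \<le> locL {a..b} g * nsqL (indicator {x..y})"
      using ip_Cauchy_Schwarz[OF g indicator_Icc_sqint] by (simp add: loc_def)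
    also have "nsqL (indicator {x..y}) = (\<integral>t. indicator {x..y} t \<partial>lborel)"
      unfolding nsq_def by (intro Bochner_Integration.integral_cong) (auto simp: indicator_def)
    also have "\<dots> = y - x" using that by simp
    finally show ?thesis by (simp add: mult.commute)
  qed
  show ?thesis
  proof (cases "x \<le> y")
    case True
    then show ?thesis using *[OF xy] by simp
  next
    case False
    then show ?thesis using *[OF xy(2,1)] by (simp add: norm_minus_commute)
  qed
qed

text \<open>Young's inequality with a free weight; the values 4, 2/3 and 1 of \<open>t\<close>
  occur.\<close>

lemma norm_add_square_le:
  fixes u v :: complex
  assumes "t > 0"
  shows "abs2 (u + v) \<le> (1 + t) * abs2 u + (1 + 1 / t) * abs2 v"
proof -
  have "abs2 (u + v) \<le> (cmod u + cmod v)\<^sup>2"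
    by (intro power_mono norm_triangle_ineq) auto
  also have "\<dots> \<le> (1 + t) * abs2 u + (1 + 1 / t) * abs2 v"
  proof -
    have "0 \<le> (t * cmod u - cmod v)\<^sup>2 / t" using assms by simp
    also have "\<dots> = t * abs2 u + (1 / t) * abs2 v - 2 * cmod u * cmod v"
      using assms by (simp add: power2_eq_square field_simps)
    finally show ?thesis by (simp add: power2_sum algebra_simps)
  qed
  finally show ?thesis .
qed

text \<open>The nearer endpoint is at distance at most (b - a)/2, and Young with weight 4
  contributes the factor 5/4. The product 5/8 is the gradient coefficient of
  \<open>H1_pair_sup_bound\<close> as well, so cells of both kinds can be added up.\<close>

lemma H1_pair_endpoint_bound:
  assumes fg: "H1_pair f g" and x: "x \<in> {a..b}"
  shows "abs2 (f x) \<le> 5 * (abs2 (f a) + abs2 (f b)) + 5 / 8 * (b - a) * locL {a..b} g"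
proof -
  let ?G = "locL {a..b} g"
  have *: "abs2 (f x) \<le> 5 * abs2 (f c) + 5 / 8 * (b - a) * ?G"
    if c: "c \<in> {a..b}" "\<bar>x - c\<bar> \<le> (b - a) / 2" for c
  proof -
    have "abs2 (f x) \<le> 5 * abs2 (f c) + 5 / 4 * abs2 (f x - f c)"
      using norm_add_square_le[of 4 "f c" "f x - f c"] by simp
    also have "abs2 (f x - f c) \<le> \<bar>x - c\<bar> * ?G" by (rule H1_pair_Hoelder[OF fg c(1) x])
    also have "\<dots> \<le> (b - a) / 2 * ?G" using c by (intro mult_right_mono) auto
    finally show ?thesis by (simp add: field_simps)
  qed
  show ?thesis
  proof (cases "x - a \<le> (b - a) / 2")
    case True
    then show ?thesis using *[of a] x by (auto intro: order_trans)
  next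
    case False
    then have "\<bar>x - b\<bar> \<le> (b - a) / 2" using x by (auto simp: field_simps)
    then show ?thesis using *[of b] x by (auto intro: order_trans)
  qed
qed

lemma integral_distance_to_endpoint:
  fixes c d x :: real
  assumes "c \<le> d" "x = c \<or> x = d"
  shows "has_bochner_integral lborel (\<lambda>y. indicator {c..d} y * \<bar>y - x\<bar>) ((d - c)\<^sup>2 / 2)"
  using assms(2)
proof
  assume x: "x = c"
  have "has_bochner_integral lborel (\<lambda>y. (y - c) * indicator {c..d} y) ((d - c)\<^sup>2 / 2 - (c - c)\<^sup>2 / 2)"
    using assms(1) by (intro has_bochner_integral_FTC_Icc_real) (auto intro!: derivative_eq_intros)
  moreover have "(\<lambda>y. (y - c) * indicator {c..d} y) = (\<lambda>y. indicator {c..d} y * \<bar>y - x\<bar>)"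
    using x by (auto simp: fun_eq_iff indicator_def)
  ultimately show ?thesis by simp
next
  assume x: "x = d"
  have "has_bochner_integral lborel (\<lambda>y. (d - y) * indicator {c..d} y) (- ((d - d)\<^sup>2 / 2) - (- ((d - c)\<^sup>2 / 2)))"
    using assms(1) by (intro has_bochner_integral_FTC_Icc_real) (auto intro!: derivative_eq_intros simp: field_simps)
  moreover have "(\<lambda>y. (d - y) * indicator {c..d} y) = (\<lambda>y. indicator {c..d} y * \<bar>y - x\<bar>)"
    using x by (auto simp: fun_eq_iff indicator_def)
  ultimately show ?thesis by simp
qed

text \<open>Average \<open>|f x|\<^sup>2 \<le> (5/3) |f y|\<^sup>2 + (5/2) |y - x| \<parallel>g\<parallel>\<^sup>2\<close> over \<open>y\<close> in an interval of length
  \<open>(b - a) / 2\<close> with endpoint \<open>x\<close>.\<close>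

lemma H1_pair_sup_bound:
  assumes fg: "H1_pair f g" and x: "x \<in> {a..b}" and ab: "a < b"
  shows "abs2 (f x) \<le> 10 / (3 * (b - a)) * locL {a..b} f + 5 / 8 * (b - a) * locL {a..b} g"
proof -
  let ?F = "locL {a..b} f" and ?G = "locL {a..b} g"
  note H = H1_pairD[OF fg]
  define L where "L = b - a"
  have L: "L > 0" using ab by (simp add: L_def)
  \<comment> \<open>The averaging interval is taken on the side of \<open>x\<close> where at least
    half of [a, b] remains.\<close>
  define c where "c = (if x - a \<le> L / 2 then x else x - L / 2)"
  define d where "d = c + L / 2"
  have cd: "c \<le> d" "x = c \<or> x = d" "{c..d} \<subseteq> {a..b}" "x \<in> {a..b}"
    using x L by (auto simp: c_def d_def L_def field_simps split: if_splits)
  have I: "has_bochner_integral lborel (\<lambda>y. indicator {c..d} y * \<bar>y - x\<bar>) ((d - c)\<^sup>2 / 2)"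
    by (rule integral_distance_to_endpoint[OF cd(1,2)])
  have intf: "integrable lborel (\<lambda>y. indicator {c..d} y * abs2 (f y))"
    using H by (intro loc_integrable) auto
  let ?r = "\<lambda>y. 5 / 3 * (indicator {c..d} y * abs2 (f y)) + 5 / 2 * ?G * (indicator {c..d} y * \<bar>y - x\<bar>)"
  have "L / 2 * abs2 (f x) = (\<integral>y. indicator {c..d} y * abs2 (f x) \<partial>lborel)"
    using cd L by (simp add: d_def)
  also have "\<dots> \<le> (\<integral>y. ?r y \<partial>lborel)"
  proof (rule integral_mono)
    show "integrable lborel (\<lambda>y. indicator {c..d} y * abs2 (f x))"
      by (intro integrable_mult_left integrable_real_indicator) (auto simp: emeasure_lborel_Icc_eq)
    show "integrable lborel (\<lambda>y. ?r y)"
      using I intf by (intro Bochner_Integration.integrable_add integrable_mult_right) (auto simp: has_bochner_integral_iff)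
    fix y
    show "indicator {c..d} y * abs2 (f x) \<le> ?r y"
    proof (cases "y \<in> {c..d}")
      case True
      then have y: "y \<in> {a..b}" using cd by blast
      have "abs2 (f x) \<le> 5 / 3 * abs2 (f y) + 5 / 2 * abs2 (f x - f y)"
        using norm_add_square_le[of "2/3" "f y" "f x - f y"] by simp
      also have "abs2 (f x - f y) \<le> \<bar>x - y\<bar> * ?G" by (rule H1_pair_Hoelder[OF fg y x])
      finally show ?thesis using True by (simp add: abs_minus_commute mult.commute mult.assoc)
    qed simp
  qed
  also have "\<dots> = 5 / 3 * locL {c..d} f + 5 / 2 * ?G * ((d - c)\<^sup>2 / 2)"
    using I intf by (simp add: has_bochner_integral_iff loc_eq)
  also have "\<dots> \<le> 5 / 3 * ?F + 5 / 2 * ?G * ((d - c)\<^sup>2 / 2)"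
    using H cd by (intro add_right_mono mult_left_mono loc_mono) auto
  also have "5 / 2 * ?G * ((d - c)\<^sup>2 / 2) = 5 / 16 * L\<^sup>2 * ?G" by (simp add: d_def power2_eq_square)
  finally have "L / 2 * abs2 (f x) \<le> 5 / 3 * ?F + 5 / 16 * L\<^sup>2 * ?G" .
  then have "2 / L * (L / 2 * abs2 (f x)) \<le> 2 / L * (5 / 3 * ?F + 5 / 16 * L\<^sup>2 * ?G)"
    using L by (intro mult_left_mono) auto
  also have "2 / L * (L / 2 * abs2 (f x)) = abs2 (f x)" using L by simp
  also have "2 / L * (5 / 3 * ?F + 5 / 16 * L\<^sup>2 * ?G) = 10 / (3 * L) * ?F + 5 / 8 * L * ?G"
    using L by (simp add: field_simps power2_eq_square)
  finally show ?thesis by (simp add: L_def)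
qed

text \<open>By uniqueness almost everywhere, the derivative chosen by \<open>weak_deriv\<close> may
  be replaced by any known one.\<close>

lemma form_eq:
  assumes "H1_pair f g" "H1_pair f' g'"
  shows "form \<mu> f f' = ipL g g' - ip \<mu> f f'"
proof -
  have "ipL (weak_deriv f) (weak_deriv f') = ipL g g'"
    by (intro ip_cong_AE weak_deriv_AE assms sqintD H1_pairD[OF assms(1)] H1_pairD[OF assms(2)]
        H1_pairD(2)[OF H1_pair_weak_deriv]) (use assms H1_iff in blast)+
  then show ?thesis by (simp add: form_def ip_def)
qed

lemma Re_form_self:
  assumes "H1_pair f g"
  shows "Re (form \<mu> f f) = nsqL g - nsq \<mu> f"
  by (simp add: form_eq[OF assms assms] ip_self)

lemma H1_sqint: "f \<in> H1 \<Longrightarrow> f \<in> sqintL"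
  by (auto simp: H1_iff H1_pair_def)

interpretation I: hermitian_form H1 ipL
proof
  show "0 \<in> H1" using H1_pair_zero by (auto simp: H1_iff)
  show "f + g \<in> H1" if "f \<in> H1" "g \<in> H1" for f g
    using that H1_pair_add unfolding H1_iff by blast
  show "(\<lambda>x. c * f x) \<in> H1" if "f \<in> H1" for f c
    using that H1_pair_scale by (auto simp: H1_iff)
qed (auto simp: ip_add_left H1_sqint ip_scale_left ip_cnj)

text \<open>For a continuous function the set of nonzero values is open, and an open null set is
  empty.\<close>

lemma H1_nsq_eq_0:
  assumes f: "f \<in> H1" and 0: "nsqL f = 0"
  shows "f = 0"
proof -
  have c: "continuous_on UNIV f" using f by (simp add: H1_def)
  have "AE x in lborel. abs2 (f x) = 0"
    using 0 sqintD(2)[OF H1_sqint[OF f]] unfolding nsq_def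
    by (subst (asm) integral_nonneg_eq_0_iff_AE) auto
  then have "AE x in lborel. f x = 0" by simp
  moreover have o: "open {x. f x \<noteq> 0}" using c by (intro open_Collect_neq) auto
  ultimately have "{x. f x \<noteq> 0} \<in> null_sets lborel"
    using borel_open[OF o] by (simp add: AE_iff_null_sets)
  then have "negligible {x. f x \<noteq> 0}" using negligible_iff_null_sets null_sets_completionI by blast
  then have "{x. f x \<noteq> 0} = {}" using open_not_negligible[OF o] by blast
  then show ?thesis by (auto simp: fun_eq_iff)
qed

text \<open>Sobolev embedding with a free length: a small \<open>L\<close> makes the gradient
  coefficient as small as desired, at the price of the L^2 term.\<close>

lemma H1_pair_global_bound:
  assumes fg: "H1_pair f g" and L: "L > 0"
  shows "abs2 (f x) \<le> 10 / (3 * L) * nsqL f + 5 / 8 * L * nsqL g"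
proof -
  note H = H1_pairD[OF fg]
  have "abs2 (f x) \<le> 10 / (3 * L) * locL {x..x+L} f + 5 / 8 * L * locL {x..x+L} g"
    using H1_pair_sup_bound[OF fg, of x x "x + L"] L by simp
  also have "\<dots> \<le> 10 / (3 * L) * nsqL f + 5 / 8 * L * nsqL g"
    using L H by (intro add_mono mult_left_mono loc_le_nsq) auto
  finally show ?thesis .
qed

text \<open>L^2 completeness alone yields no continuous representative. The sup bound makes the
  sequence uniformly Cauchy, and the uniform limit is that representative.\<close>

lemma H1_complete:
  assumes fg: "\<And>n. H1_pair (f n) (g n)"
    and cf: "\<And>e. e > 0 \<Longrightarrow> \<exists>N. \<forall>m\<ge>N. \<forall>n\<ge>N. nsqL (f m - f n) < e"
    and cg: "\<And>e. e > 0 \<Longrightarrow> \<exists>N. \<forall>m\<ge>N. \<forall>n\<ge>N. nsqL (g m - g n) < e"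
  shows "\<exists>F G. H1_pair F G \<and> (\<lambda>n. nsqL (f n - F)) \<longlonglongrightarrow> 0 \<and> (\<lambda>n. nsqL (g n - G)) \<longlonglongrightarrow> 0"
proof -
  note H = H1_pairD[OF fg]
  have "uniformly_Cauchy_on UNIV f"
    unfolding uniformly_Cauchy_on_def
  proof safe
    fix e :: real assume e: "e > 0"
    \<comment> \<open>At length 1 the sup bound has coefficients 10/3 and 5/8, whose sum is below
      10.\<close>
    have e': "e\<^sup>2 / 10 > 0" using e by simp
    obtain N1 where N1: "\<forall>m\<ge>N1. \<forall>n\<ge>N1. nsqL (f m - f n) < e\<^sup>2 / 10" using cf[OF e'] by blast
    obtain N2 where N2: "\<forall>m\<ge>N2. \<forall>n\<ge>N2. nsqL (g m - g n) < e\<^sup>2 / 10" using cg[OF e'] by blast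
    have "dist (f m x) (f n x) < e" if "m \<ge> max N1 N2" "n \<ge> max N1 N2" for m n x
    proof -
      have "abs2 ((f m - f n) x) \<le> 10 / (3 * 1) * nsqL (f m - f n) + 5 / 8 * 1 * nsqL (g m - g n)"
        by (rule H1_pair_global_bound[OF H1_pair_diff[OF fg fg]]) simp
      moreover have "nsqL (f m - f n) < e\<^sup>2 / 10" "nsqL (g m - g n) < e\<^sup>2 / 10" using N1 N2 that by auto
      ultimately have "abs2 ((f m - f n) x) < e\<^sup>2" using e' by linarith
      then show ?thesis using e by (auto simp: dist_norm intro: power2_less_imp_less)
    qed
    then show "\<exists>M. \<forall>x\<in>UNIV. \<forall>m\<ge>M. \<forall>n\<ge>M. dist (f m x) (f n x) < e" by blast
  qed
  then obtain F where F: "uniform_limit UNIV f F sequentially"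
    using Cauchy_uniformly_convergent uniformly_convergent_on_def by metis
  have cF: "continuous_on UNIV F"
    by (rule uniform_limit_theorem[OF _ F]) (use H(3) in auto)
  have pt: "(\<lambda>n. f n x) \<longlonglongrightarrow> F x" for x using tendsto_uniform_limitI[OF F] by simp
  have FL: "F \<in> sqintL \<and> (\<lambda>n. nsqL (f n - F)) \<longlonglongrightarrow> 0"
    using sqint_Fatou[OF H(1) continuous_measurable_lborel[OF cF] strict_mono_id _ cf] pt by simp
  obtain G where G: "G \<in> sqintL" "(\<lambda>n. nsqL (g n - G)) \<longlonglongrightarrow> 0"
    using sqint_complete[OF H(2) cg] by blast
  have "has_weak_derivative F G" using FL G by (intro has_weak_derivative_limit[OF fg]) auto
  then show ?thesis using FL G cF by (auto simp: H1_pair_def)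
qed

abbreviation orthonormal :: "(real \<Rightarrow> complex) set \<Rightarrow> bool" where
  "orthonormal S \<equiv> \<forall>e\<in>S. \<forall>e'\<in>S. ipL e e' = (if e = e' then 1 else 0)"

lemma orthonormal_independent:
  assumes "finite S" "\<And>e. e \<in> S \<Longrightarrow> e \<in> H1" "\<And>e e'. e \<in> S \<Longrightarrow> e' \<in> S \<Longrightarrow> ipL e e' = (if e = e' then 1 else 0)"
  shows "cfun.independent S"
proof (rule cfun.independent_if_scalars_zero[OF assms(1)])
  fix c e assume c: "(\<Sum>e\<in>S. (\<lambda>x. c e * e x)) = 0" and e: "e \<in> S"
  have "ipL (\<Sum>e\<in>S. (\<lambda>x. c e * e x)) e = (\<Sum>e'\<in>S. ipL (\<lambda>x. c e' * e' x) e)"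
    using assms(2) e by (intro I.sum_left I.X_scale)
  also have "\<dots> = (\<Sum>e'\<in>S. if e = e' then c e else 0)"
    using assms(3)[OF _ e] by (intro sum.cong) (auto simp: ip_scale_left)
  also have "\<dots> = c e" using assms(1) e by simp
  finally show "c e = 0" using c assms(2)[OF e] by simp
qed

section \<open>Tent functions\<close>

definition tent :: "real \<Rightarrow> real \<Rightarrow> real \<Rightarrow> real" where
  "tent w x t = max 0 (1 - \<bar>t - x\<bar> / w)"

text \<open>The value is 0 at the kinks, so the derivatives of two tents whose supports merely touch
  have product zero at every point.\<close>

definition tent' :: "real \<Rightarrow> real \<Rightarrow> real \<Rightarrow> real" where
  "tent' w x t = (if x - w < t \<and> t < x then 1 / w else if x < t \<and> t < x + w then - 1 / w else 0)"

lemma tent_bounds: "w > 0 \<Longrightarrow> 0 \<le> tent w x t" "w > 0 \<Longrightarrow> tent w x t \<le> 1"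
  by (auto simp: tent_def)

lemma tent_outside: "w > 0 \<Longrightarrow> w \<le> \<bar>t - x\<bar> \<Longrightarrow> tent w x t = 0"
  by (auto simp: tent_def field_simps)

lemma continuous_tent: "w > 0 \<Longrightarrow> continuous_on A (tent w x)"
  unfolding tent_def[abs_def] by (intro continuous_intros) auto

lemma DERIV_tent:
  assumes w: "w > 0" and t: "t \<in> {x - w<..<x + w} - {x}"
  shows "(tent w x has_real_derivative tent' w x t) (at t)"
proof (cases "t < x")
  case True
  have "((\<lambda>t. 1 - (x - t) / w) has_real_derivative 1 / w) (at t)"
    using w by (auto intro!: derivative_eq_intros)
  moreover have "eventually (\<lambda>s. s \<in> {x - w<..<x}) (nhds t)"
    using True t by (intro eventually_nhds_in_open) auto
  then have "eventually (\<lambda>s. tent w x s = 1 - (x - s) / w) (nhds t)"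
    by eventually_elim (use w in \<open>auto simp: tent_def field_simps\<close>)
  moreover have "tent' w x t = 1 / w" using True t by (simp add: tent'_def)
  ultimately show ?thesis by (subst DERIV_cong_ev[OF refl _ refl]) auto
next
  case False
  then have "x < t" using t by auto
  have "((\<lambda>t. 1 - (t - x) / w) has_real_derivative - 1 / w) (at t)"
    using w by (auto intro!: derivative_eq_intros)
  moreover have "eventually (\<lambda>s. s \<in> {x<..<x + w}) (nhds t)"
    using \<open>x < t\<close> t by (intro eventually_nhds_in_open) auto
  then have "eventually (\<lambda>s. tent w x s = 1 - (s - x) / w) (nhds t)"
    by eventually_elim (use w in \<open>auto simp: tent_def field_simps\<close>)
  moreover have "tent' w x t = - 1 / w" using \<open>x < t\<close> t by (simp add: tent'_def)
  ultimately show ?thesis by (subst DERIV_cong_ev[OF refl _ refl]) auto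
qed

lemma tent'_square: "w > 0 \<Longrightarrow> (tent' w x t)\<^sup>2 \<le> (1 / w)\<^sup>2 * indicator {x - w..x + w} t"
  by (auto simp: tent'_def power2_eq_square)

lemma tent'_measurable [measurable]: "tent' w x \<in> borel_measurable borel"
  unfolding tent'_def[abs_def] by measurable

lemma tent_sqint: "w > 0 \<Longrightarrow> (\<lambda>t. of_real (tent w x t)) \<in> sqintL"
  using continuous_tent[of w UNIV x] tent_outside[of w _ x]
  by (intro sqint_continuous_compact_support[where R = "\<bar>x\<bar> + w"] continuous_intros) auto

lemma tent'_sqint:
  assumes "w > 0"
  shows "(\<lambda>t. of_real (tent' w x t)) \<in> sqintL" "nsqL (\<lambda>t. of_real (tent' w x t)) \<le> 2 / w"
proof -
  have i: "integrable lborel (\<lambda>t. (1 / w)\<^sup>2 * indicator {x - w..x + w} t)"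
    by (intro integrable_mult_right integrable_real_indicator) (auto simp: emeasure_lborel_Icc_eq)
  have int: "integrable lborel (\<lambda>t. (tent' w x t)\<^sup>2)"
    by (rule Bochner_Integration.integrable_bound[OF i]) (use tent'_square[OF assms] in auto)
  then show "(\<lambda>t. of_real (tent' w x t)) \<in> sqintL" by (simp add: sqint_def)
  have "nsqL (\<lambda>t. of_real (tent' w x t)) \<le> (\<integral>t. (1 / w)\<^sup>2 * indicator {x - w..x + w} t \<partial>lborel)"
    unfolding nsq_def using i int tent'_square[OF assms] by (intro integral_mono) auto
  also have "\<dots> = 2 / w" using assms by (simp add: power2_eq_square)
  finally show "nsqL (\<lambda>t. of_real (tent' w x t)) \<le> 2 / w" .
qed

lemma nsq_tent_le:
  assumes "w > 0"
  shows "nsqL (\<lambda>t. of_real (tent w x t)) \<le> 2 * w"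
proof -
  have i: "integrable lborel (indicator {x - w..x + w} :: real \<Rightarrow> real)"
    by (intro integrable_real_indicator) (auto simp: emeasure_lborel_Icc_eq)
  have "nsqL (\<lambda>t. of_real (tent w x t)) \<le> (\<integral>t. indicator {x - w..x + w} t \<partial>lborel)"
    unfolding nsq_def
  proof (rule integral_mono[OF sqintD(2)[OF tent_sqint[OF assms]] i])
    fix t
    show "abs2 (of_real (tent w x t)) \<le> indicator {x - w..x + w} t"
      using tent_bounds[OF assms, of x t] tent_outside[OF assms, of t x]
      by (auto simp: indicator_def power_le_one abs_le_iff)
  qed
  also have "\<dots> = 2 * w" using assms by simp
  finally show ?thesis .
qed

text \<open>Integration by parts over the support: the product with a test function is continuous,
  differentiable away from the kink \<open>x\<close>, and zero at both ends.\<close>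

lemma tent_H1_pair:
  assumes w: "w > 0"
  shows "H1_pair (\<lambda>t. of_real (tent w x t)) (\<lambda>t. of_real (tent' w x t))"
  unfolding H1_pair_def
proof (intro conjI tent_sqint tent'_sqint w)
  show "continuous_on UNIV (\<lambda>t. of_real (tent w x t) :: complex)" by (intro continuous_intros continuous_tent w)
  show "has_weak_derivative (\<lambda>t. of_real (tent w x t)) (\<lambda>t. of_real (tent' w x t))"
    unfolding has_weak_derivative_def
  proof
    fix \<phi> assume \<phi>: "\<phi> \<in> test_functions"
    have d\<phi>: "(\<phi> has_real_derivative deriv \<phi> t) (at t)" for t
      using \<phi> by (auto simp: test_functions_def DERIV_deriv_iff_real_differentiable)
    have c\<phi>: "continuous_on A \<phi>" for A
      using d\<phi> DERIV_isCont continuous_at_imp_continuous_on by blast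
    have i1: "integrable lborel (\<lambda>t. tent w x t * deriv \<phi> t)"
    proof (rule integrable_continuous_compact_support[where R = "\<bar>x\<bar> + w"])
      show "continuous_on UNIV (\<lambda>t. tent w x t * deriv \<phi> t)"
        using \<phi> by (intro continuous_intros continuous_tent w) (auto simp: test_functions_def)
      show "tent w x t * deriv \<phi> t = 0" if "\<bar>x\<bar> + w < \<bar>t\<bar>" for t
        using tent_outside[OF w, of t x] that by auto
    qed
    have i2: "integrable lborel (\<lambda>t. tent' w x t * \<phi> t)"
    proof -
      have "integrable lborel (\<lambda>t. of_real (tent' w x t) * cnj (of_real (\<phi> t)) :: complex)"
        by (rule integrable_mult_cnj[OF tent'_sqint(1)[OF w] test_functions_sqint(1)[OF \<phi>]])
      then have "integrable lborel (\<lambda>t. of_real (tent' w x t * \<phi> t) :: complex)" by simp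
      then show ?thesis by (simp only: complex_of_real_integrable_eq)
    qed
    let ?h = "\<lambda>t. tent' w x t * \<phi> t + tent w x t * deriv \<phi> t"
    have "(?h has_integral (tent w x (x + w) * \<phi> (x + w) - tent w x (x - w) * \<phi> (x - w))) {x - w..x + w}"
    proof (rule fundamental_theorem_of_calculus_interior_strong[where S = "{x}"])
      show "continuous_on {x - w..x + w} (\<lambda>t. tent w x t * \<phi> t)"
        by (intro continuous_intros continuous_tent w c\<phi>)
      show "((\<lambda>t. tent w x t * \<phi> t) has_vector_derivative ?h t) (at t)" if "t \<in> {x - w<..<x + w} - {x}" for t
        using DERIV_mult[OF DERIV_tent[OF w that] d\<phi>[of t]]
        by (simp add: has_real_derivative_iff_has_vector_derivative mult.commute)
    qed (use w in auto)
    then have "(?h has_integral 0) {x - w..x + w}" using tent_outside[OF w] w by simp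
    then have "((\<lambda>t. if t \<in> {x - w..x + w} then ?h t else 0) has_integral 0) UNIV"
      by (simp only: has_integral_restrict_UNIV)
    moreover have "(\<lambda>t. if t \<in> {x - w..x + w} then ?h t else 0) = ?h"
      using tent_outside[OF w, of _ x] by (auto simp: fun_eq_iff tent'_def)
    ultimately have "(?h has_integral 0) UNIV" by simp
    moreover have "(?h has_integral (\<integral>t. ?h t \<partial>lborel)) UNIV"
      using i1 i2 by (intro has_integral_integral_lborel) auto
    ultimately have "(\<integral>t. ?h t \<partial>lborel) = 0" using has_integral_unique by blast
    then have "(\<integral>t. tent w x t * deriv \<phi> t \<partial>lborel) = - (\<integral>t. tent' w x t * \<phi> t \<partial>lborel)"
      using i1 i2 by simp
    then have "of_real (\<integral>t. tent w x t * deriv \<phi> t \<partial>lborel) = - (of_real (\<integral>t. tent' w x t * \<phi> t \<partial>lborel) :: complex)"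
      by simp
    then show "(\<integral>t. of_real (tent w x t) * of_real (deriv \<phi> t) \<partial>lborel) = - (\<integral>t. of_real (tent' w x t) * of_real (\<phi> t) \<partial>lborel :: complex)"
      by (simp flip: of_real_mult integral_complex_of_real)
  qed
qed

section \<open>The Otelbaev function\<close>

definition otelbaev_set :: "real measure \<Rightarrow> real \<Rightarrow> real set" where
  "otelbaev_set \<mu> x = {1 / d\<^sup>2 | d. 0 < d \<and> emeasure \<mu> {x - d / 2 .. x + d / 2} < ennreal (1 / d)}"

lemma otelbaev_eq: "otelbaev \<mu> x = Inf (otelbaev_set \<mu> x)"
  by (simp add: otelbaev_def otelbaev_set_def)

lemma otelbaev_set_bdd_below: "bdd_below (otelbaev_set \<mu> x)"
  by (rule bdd_belowI[of _ 0]) (auto simp: otelbaev_set_def)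

lemma otelbaev_gt_imp:
  assumes d: "d > 0" and "1 / d\<^sup>2 < otelbaev \<mu> x"
  shows "ennreal (1 / d) \<le> emeasure \<mu> {x - d / 2 .. x + d / 2}"
proof (rule ccontr)
  assume "\<not> ?thesis"
  then have "1 / d\<^sup>2 \<in> otelbaev_set \<mu> x" using d by (auto simp: otelbaev_set_def not_le)
  then have "otelbaev \<mu> x \<le> 1 / d\<^sup>2"
    unfolding otelbaev_eq by (rule cInf_lower) (rule otelbaev_set_bdd_below)
  then show False using assms by simp
qed

locale radon =
  fixes \<mu> :: "real measure"
  assumes radon: "radon_measure \<mu>"
begin

lemma radon_sets [simp]: "sets \<mu> = sets borel"
  using radon by (simp add: radon_measure_def)

lemma measurable_radon:
  fixes f :: "real \<Rightarrow> complex"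
  assumes "continuous_on UNIV f"
  shows "f \<in> borel_measurable \<mu>"
  using borel_measurable_continuous_onI[OF assms] measurable_cong_sets[OF radon_sets refl] by blast

lemma radon_emeasure_Icc:
  shows "emeasure \<mu> {a..b} = ennreal (measure \<mu> {a..b})" "emeasure \<mu> {a..b} < \<infinity>"
proof -
  show fin: "emeasure \<mu> {a..b} < \<infinity>"
    using radon compact_Icc[of a b] unfolding radon_measure_def by blast
  show "emeasure \<mu> {a..b} = ennreal (measure \<mu> {a..b})"
    by (rule emeasure_eq_ennreal_measure) (use fin in simp)
qed

lemma radon_measure_mono:
  assumes "{c..d} \<subseteq> {a..b}"
  shows "measure \<mu> {c..d} \<le> measure \<mu> {a..b}"
  using assms radon_emeasure_Icc[of a b]
  by (intro measure_mono_fmeasurable) (auto simp: fmeasurable_def)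

lemma otelbaev_set_nonempty:
  shows "otelbaev_set \<mu> x \<noteq> {}"
proof -
  define m where "m = measure \<mu> {x - 1..x + 1}"
  \<comment> \<open>Width at most 1 keeps the window inside [x - 1, x + 1], whose mass
    \<open>m\<close> is below 1/d = m + 1.\<close>
  define d where "d = 1 / (m + 1)"
  have m: "m \<ge> 0" by (simp add: m_def)
  have d: "d > 0" "d \<le> 1" using m by (auto simp: d_def)
  have "emeasure \<mu> {x - d / 2 .. x + d / 2} \<le> emeasure \<mu> {x - 1..x + 1}"
    using d by (intro emeasure_mono) auto
  also have "\<dots> = ennreal m" using radon_emeasure_Icc by (simp add: m_def)
  also have "\<dots> < ennreal (1 / d)" using m by (simp add: d_def ennreal_less_iff)
  finally show ?thesis using d by (auto simp: otelbaev_set_def)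
qed

lemma otelbaev_nonneg:
  shows "0 \<le> otelbaev \<mu> x"
  unfolding otelbaev_eq using otelbaev_set_nonempty
  by (rule cInf_greatest) (auto simp: otelbaev_set_def)

text \<open>If the window of width \<open>d\<close> is too heavy, so is every wider one: its mass
  grows while its threshold 1/e falls. Hence all competitors in the infimum are narrower than
  \<open>d\<close>.\<close>

lemma otelbaev_ge:
  assumes d: "d > 0" and ge: "ennreal (1 / d) \<le> emeasure \<mu> {x - d / 2 .. x + d / 2}"
  shows "1 / d\<^sup>2 \<le> otelbaev \<mu> x"
  unfolding otelbaev_eq
proof (rule cInf_greatest[OF otelbaev_set_nonempty])
  fix z assume "z \<in> otelbaev_set \<mu> x"
  then obtain e where e: "z = 1 / e\<^sup>2" "e > 0" "emeasure \<mu> {x - e / 2 .. x + e / 2} < ennreal (1 / e)"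
    by (auto simp: otelbaev_set_def)
  have "e < d"
  proof (rule ccontr)
    assume "\<not> e < d"
    then have "emeasure \<mu> {x - d / 2 .. x + d / 2} \<le> emeasure \<mu> {x - e / 2 .. x + e / 2}"
      by (intro emeasure_mono) auto
    moreover have "ennreal (1 / e) \<le> ennreal (1 / d)"
      using \<open>\<not> e < d\<close> d by (intro ennreal_leI divide_left_mono) auto
    ultimately show False using ge e(3) by simp
  qed
  then show "1 / d\<^sup>2 \<le> z" using e d by (simp add: frac_le power_mono)
qed

text \<open>Upper semicontinuity: an admissible width \<open>d\<close> at \<open>x\<close> can be
  shrunk to some \<open>e\<close> with 1/e^2 still below \<open>c\<close>, and the narrower window
  around any nearby \<open>y\<close> lies inside the old one. This gives measurability and closed
  superlevel sets.\<close>

lemma otelbaev_less_open: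
  shows "open {x. otelbaev \<mu> x < c}"
  unfolding open_dist
proof safe
  fix x assume "otelbaev \<mu> x < c"
  then obtain d where d: "d > 0" "1 / d\<^sup>2 < c" "emeasure \<mu> {x - d / 2 .. x + d / 2} < ennreal (1 / d)"
    unfolding otelbaev_eq using otelbaev_set_nonempty by (subst (asm) cInf_less_iff) (auto simp: otelbaev_set_def bdd_below_def intro!: exI[of _ 0])
  have "((\<lambda>e. 1 / e\<^sup>2) \<longlongrightarrow> 1 / d\<^sup>2) (at_left d)" using d by (intro tendsto_intros) auto
  then have "eventually (\<lambda>e. 1 / e\<^sup>2 < c) (at_left d)" using d(2) by (rule order_tendstoD)
  moreover have "eventually (\<lambda>e. e \<in> {0<..<d}) (at_left d)" using d by (intro eventually_at_left_field[THEN iffD2] exI[of _ 0]) auto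
  ultimately have "\<exists>e. 1 / e\<^sup>2 < c \<and> e \<in> {0<..<d}"
    by (intro eventually_happens'[where F = "at_left d"] eventually_conj) auto
  then obtain e where e: "e > 0" "e < d" "1 / e\<^sup>2 < c" by auto
  show "\<exists>r>0. \<forall>y. dist y x < r \<longrightarrow> y \<in> {x. otelbaev \<mu> x < c}"
  proof (intro exI[of _ "(d - e) / 2"] conjI allI impI)
    fix y assume y: "dist y x < (d - e) / 2"
    have "emeasure \<mu> {y - e / 2 .. y + e / 2} \<le> emeasure \<mu> {x - d / 2 .. x + d / 2}"
    proof (rule emeasure_mono)
      have "\<bar>y - x\<bar> < (d - e) / 2" using y by (simp add: dist_real_def)
      then have "y - x < (d - e) / 2" "x - y < (d - e) / 2" unfolding abs_less_iff by linarith+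
      then show "{y - e / 2 .. y + e / 2} \<subseteq> {x - d / 2 .. x + d / 2}"
        by (intro atLeastatMost_subset_iff[THEN iffD2] disjI2 conjI) (simp_all add: field_simps)
    qed simp
    also note d(3)
    also have "ennreal (1 / d) \<le> ennreal (1 / e)"
      using e by (intro ennreal_leI divide_left_mono) auto
    finally have "1 / e\<^sup>2 \<in> otelbaev_set \<mu> y" using e by (auto simp: otelbaev_set_def)
    then have "otelbaev \<mu> y \<le> 1 / e\<^sup>2"
      unfolding otelbaev_eq by (rule cInf_lower) (rule otelbaev_set_bdd_below)
    then show "y \<in> {x. otelbaev \<mu> x < c}" using e by simp
  qed (use e in auto)
qed

lemma otelbaev_measurable [measurable]:
  shows "otelbaev \<mu> \<in> borel_measurable borel"
  by (rule borel_measurableI_less) (use otelbaev_less_open in auto)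

text \<open>A window of width 2 (b - a) centred anywhere in [a, b] covers the interval; this is the
  origin of the 4.\<close>

lemma otelbaev_ge_of_heavy_interval:
  assumes heavy: "1 \<le> (b - a) * measure \<mu> {a..b}" and x: "x \<in> {a..b}" and ab: "a < b"
  shows "1 / (4 * (b - a)\<^sup>2) \<le> otelbaev \<mu> x"
proof -
  define d where "d = 2 * (b - a)"
  have d: "d > 0" using ab by (simp add: d_def)
  have "1 / d \<le> 1 / (b - a)" using ab by (simp add: d_def field_simps)
  also have "\<dots> \<le> measure \<mu> {a..b}" using heavy ab by (simp add: field_simps)
  finally have "ennreal (1 / d) \<le> emeasure \<mu> {a..b}"
    using radon_emeasure_Icc by (simp add: ennreal_leI)
  also have "\<dots> \<le> emeasure \<mu> {x - d / 2 .. x + d / 2}"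
    using x by (intro emeasure_mono) (auto simp: d_def field_simps)
  finally have "1 / d\<^sup>2 \<le> otelbaev \<mu> x" by (rule otelbaev_ge[OF d])
  moreover have "d\<^sup>2 = 4 * (b - a)\<^sup>2" unfolding d_def by (simp only: power_mult_distrib) simp
  ultimately show ?thesis by simp
qed

text \<open>A window of any length is covered by finitely many translates of the small one. The
  filter is abstract so that one proof serves both ends of the line.\<close>

lemma tendsto_measure_translate:
  assumes a: "a > 0" and F: "\<And>c. filterlim (\<lambda>x. c + x) F F"
    and lim: "((\<lambda>x. emeasure \<mu> {x - a<..<x + a}) \<longlongrightarrow> 0) F"
  shows "((\<lambda>x. emeasure \<mu> {x..x + L}) \<longlongrightarrow> 0) F"
proof -
  have *: "((\<lambda>x. emeasure \<mu> {x..<x + real k * a}) \<longlongrightarrow> 0) F" for k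
  proof (induction k)
    case (Suc k)
    \<comment> \<open>Centred at the midpoint of the next block of length \<open>a\<close>, hence
      covering it.\<close>
    let ?B = "\<lambda>x. emeasure \<mu> {(real k * a + a / 2) + x - a<..<(real k * a + a / 2) + x + a}"
    have lim': "((\<lambda>x. ?B x) \<longlongrightarrow> 0) F"
      using filterlim_compose[OF lim F] .
    show ?case
    proof (rule tendsto_sandwich)
      show "((\<lambda>_. 0) \<longlongrightarrow> (0::ennreal)) F" by simp
      show "((\<lambda>x. emeasure \<mu> {x..<x + real k * a} + ?B x) \<longlongrightarrow> 0) F"
        using tendsto_add[OF Suc lim'] by simp
      show "\<forall>\<^sub>F x in F. emeasure \<mu> {x..<x + real (Suc k) * a}
         \<le> emeasure \<mu> {x..<x + real k * a} + ?B x"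
      proof (rule always_eventually, rule allI)
        fix x
        have "emeasure \<mu> {x..<x + real (Suc k) * a} \<le> emeasure \<mu> ({x..<x + real k * a} \<union> {(real k * a + a / 2) + x - a<..<(real k * a + a / 2) + x + a})"
          using a by (intro emeasure_mono) (auto simp: algebra_simps)
        also have "\<dots> \<le> emeasure \<mu> {x..<x + real k * a} + ?B x"
          by (intro emeasure_subadditive) auto
        finally show "emeasure \<mu> {x..<x + real (Suc k) * a} \<le> \<dots>" .
      qed
    qed simp
  qed simp
  obtain k where k: "L / a < real k" using reals_Archimedean2 by blast
  show ?thesis
  proof (rule tendsto_sandwich[OF _ _ _ *[of k]])
    show "\<forall>\<^sub>F x in F. emeasure \<mu> {x..x + L} \<le> emeasure \<mu> {x..<x + real k * a}"
      using k a by (intro always_eventually allI emeasure_mono) (auto simp: field_simps)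
  qed auto
qed

lemma small_measure_far_away:
  assumes a: "a > 0"
    and lim: "((\<lambda>x. emeasure \<mu> {x - a<..<x + a}) \<longlongrightarrow> 0) at_top" "((\<lambda>x. emeasure \<mu> {x - a<..<x + a}) \<longlongrightarrow> 0) at_bot"
    and e: "e > 0"
  shows "\<exists>R>0. \<forall>x. \<bar>x\<bar> \<ge> R \<longrightarrow> measure \<mu> {x..x + L} < e"
proof -
  have top: "((\<lambda>x. emeasure \<mu> {x..x + L}) \<longlongrightarrow> 0) at_top"
    by (rule tendsto_measure_translate[OF a _ lim(1)])
      (intro filterlim_tendsto_add_at_top[OF tendsto_const filterlim_ident])
  have bot: "((\<lambda>x. emeasure \<mu> {x..x + L}) \<longlongrightarrow> 0) at_bot"
    by (rule tendsto_measure_translate[OF a _ lim(2)])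
      (simp add: filterlim_tendsto_add_at_bot_iff[OF tendsto_const] filterlim_ident)
  have "ennreal e > 0" using e by simp
  from order_tendstoD(2)[OF top this] order_tendstoD(2)[OF bot this]
  obtain R1 R2 where R: "\<And>x. x \<ge> R1 \<Longrightarrow> emeasure \<mu> {x..x + L} < ennreal e" "\<And>x. x \<le> R2 \<Longrightarrow> emeasure \<mu> {x..x + L} < ennreal e"
    by (auto simp: eventually_at_top_linorder eventually_at_bot_linorder)
  have "measure \<mu> {x..x + L} < e" if "\<bar>x\<bar> \<ge> max 1 (max R1 (- R2))" for x
  proof -
    have "x \<ge> R1 \<or> x \<le> R2" using that by linarith
    then have "emeasure \<mu> {x..x + L} < ennreal e" using R by blast
    then show ?thesis using radon_emeasure_Icc e by (simp add: ennreal_less_iff)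
  qed
  then show ?thesis by (intro exI[of _ "max 1 (max R1 (- R2))"]) auto
qed

end

section \<open>The key inequality\<close>

abbreviation Ico_integral :: "real \<Rightarrow> real \<Rightarrow> (real \<Rightarrow> ennreal) \<Rightarrow> ennreal" where
  "Ico_integral a b h \<equiv> \<integral>\<^sup>+x\<in>{a..<b}. h x \<partial>lborel"

lemma nn_integral_Ico_split:
  fixes h :: "real \<Rightarrow> ennreal"
  assumes [measurable]: "h \<in> borel_measurable borel" and "a \<le> b" "b \<le> c"
  shows "(\<integral>\<^sup>+x\<in>{a..<c}. h x \<partial>lborel) = (\<integral>\<^sup>+x\<in>{a..<b}. h x \<partial>lborel) + (\<integral>\<^sup>+x\<in>{b..<c}. h x \<partial>lborel)"
proof -
  have "(\<integral>\<^sup>+x\<in>{a..<b}. h x \<partial>lborel) + (\<integral>\<^sup>+x\<in>{b..<c}. h x \<partial>lborel)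
      = (\<integral>\<^sup>+x. h x * indicator {a..<b} x + h x * indicator {b..<c} x \<partial>lborel)"
    by (rule nn_integral_add[symmetric]) auto
  also have "\<dots> = (\<integral>\<^sup>+x\<in>{a..<c}. h x \<partial>lborel)"
    using assms by (intro nn_integral_cong) (auto simp: indicator_def)
  finally show ?thesis by simp
qed

context radon
begin

section \<open>Estimates on single cells and on their unions\<close>

lemma radon_loc_sqint:
  assumes f: "continuous_on UNIV f"
  shows "(\<lambda>x. indicator {a..<b} x * f x) \<in> sqint \<mu>"
proof -
  have [measurable]: "f \<in> borel_measurable \<mu>" by (rule measurable_radon[OF f])
  have [measurable]: "{a..<b} \<in> sets \<mu>" by simp
  have "compact (f ` {a..b})" using f by (intro compact_continuous_image) (auto intro: continuous_on_subset)
  then have "bounded (f ` {a..b})" by (rule compact_imp_bounded)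
  then obtain B where "\<forall>x\<in>{a..b}. cmod (f x) \<le> B" by (auto simp: bounded_iff)
  then have B: "\<And>x. x \<in> {a..b} \<Longrightarrow> cmod (f x) \<le> B" by blast
  have "integrable \<mu> (\<lambda>x. abs2 (indicator {a..<b} x * f x))"
  proof (rule Bochner_Integration.integrable_bound)
    show "integrable \<mu> (\<lambda>x. B\<^sup>2 * indicator {a..b} x)"
      using radon_emeasure_Icc by (intro integrable_mult_right integrable_real_indicator) auto
    show "AE x in \<mu>. norm (abs2 (indicator {a..<b} x * f x)) \<le> norm (B\<^sup>2 * indicator {a..b} x)"
    proof (rule AE_I2)
      fix x
      show "norm (abs2 (indicator {a..<b} x * f x)) \<le> norm (B\<^sup>2 * indicator {a..b} x)"
        using B[of x] by (auto simp: indicator_def intro: power_mono)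
    qed
  qed measurable
  then show ?thesis by (simp add: sqint_def)
qed

lemma radon_loc_le:
  assumes f: "continuous_on UNIV f"
    and B: "\<And>x. x \<in> {a..b} \<Longrightarrow> abs2 (f x) \<le> B" and m: "measure \<mu> {a..b} \<le> m" and "B \<ge> 0"
  shows "loc \<mu> {a..<b} f \<le> B * m"
proof -
  have "loc \<mu> {a..<b} f \<le> (\<integral>x. B * indicator {a..b} x \<partial>\<mu>)"
    unfolding loc_def nsq_def
  proof (rule integral_mono)
    show "integrable \<mu> (\<lambda>x. abs2 (indicator {a..<b} x * f x))"
      by (rule sqintD(2)[OF radon_loc_sqint[OF f]])
    show "integrable \<mu> (\<lambda>x. B * indicator {a..b} x)"
      using radon_emeasure_Icc by (intro integrable_mult_right integrable_real_indicator) auto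
    show "abs2 (indicator {a..<b} x * f x) \<le> B * indicator {a..b} x" for x
      using B[of x] \<open>B \<ge> 0\<close> by (auto simp: indicator_def)
  qed
  also have "\<dots> = B * measure \<mu> {a..b}" by simp
  also have "\<dots> \<le> B * m" using m \<open>B \<ge> 0\<close> by (rule mult_left_mono)
  finally show ?thesis .
qed

text \<open>The cellwise form of the key inequality. Only the number of points in \<open>P\<close>
  is ever counted; the constant \<open>C\<close> may depend on the partition in any way.\<close>

definition controlled :: "real \<Rightarrow> real \<Rightarrow> real \<Rightarrow> real set \<Rightarrow> real \<Rightarrow> bool" where
  "controlled l a b P C \<longleftrightarrow> finite P \<and> 0 \<le> C \<and> (\<forall>f g. H1_pair f g \<longrightarrow>
     loc \<mu> {a..<b} f \<le> 5 / 8 * locL {a..<b} g + 5 / 6 * l * locL {a..<b} f + C * (\<Sum>p\<in>P. abs2 (f p)))"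

lemma controlled_union:
  assumes 1: "controlled l a b P C" and 2: "controlled l b c Q D"
    and abc: "a \<le> b" "b \<le> c"
  shows "controlled l a c (P \<union> Q) (C + D)"
  unfolding controlled_def
proof (intro conjI allI impI)
  have fin: "finite P" "finite Q" "C \<ge> 0" "D \<ge> 0" using 1 2 by (auto simp: controlled_def)
  then show "finite (P \<union> Q)" "0 \<le> C + D" by auto
  fix f g assume fg: "H1_pair f g"
  note H = H1_pairD[OF fg]
  have add: "loc \<mu> {a..<c} f = loc \<mu> {a..<b} f + loc \<mu> {b..<c} f"
    "locL {a..<c} f = locL {a..<b} f + locL {b..<c} f"
    "locL {a..<c} g = locL {a..<b} g + locL {b..<c} g"
    by (rule loc_add[OF radon_loc_sqint[OF H(3)] radon_sets abc],
        rule loc_add[OF indicator_sqint[OF H(1)] _ abc], simp, simp,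
        rule loc_add[OF indicator_sqint[OF H(2)] _ abc], simp, simp)
  have "C * (\<Sum>p\<in>P. abs2 (f p)) \<le> C * (\<Sum>p\<in>P \<union> Q. abs2 (f p))"
    "D * (\<Sum>p\<in>Q. abs2 (f p)) \<le> D * (\<Sum>p\<in>P \<union> Q. abs2 (f p))"
    using fin by (auto intro!: mult_left_mono sum_mono2)
  moreover have "loc \<mu> {a..<b} f \<le> 5 / 8 * locL {a..<b} g + 5 / 6 * l * locL {a..<b} f + C * (\<Sum>p\<in>P. abs2 (f p))"
    "loc \<mu> {b..<c} f \<le> 5 / 8 * locL {b..<c} g + 5 / 6 * l * locL {b..<c} f + D * (\<Sum>p\<in>Q. abs2 (f p))"
    using 1 2 fg by (auto simp: controlled_def)
  ultimately show "loc \<mu> {a..<c} f \<le> 5 / 8 * locL {a..<c} g + 5 / 6 * l * locL {a..<c} f + (C + D) * (\<Sum>p\<in>P \<union> Q. abs2 (f p))"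
    unfolding add by (simp add: algebra_simps)
qed

text \<open>Lightness bounds the mass by 1/(b - a), which cancels the length in front of the
  gradient in the endpoint estimate. The cell may have any length, as the bisection
  requires.\<close>

lemma controlled_endpoints:
  assumes ab: "a < b" and light: "(b - a) * measure \<mu> {a..b} \<le> 1" and l: "l \<ge> 0"
  shows "controlled l a b {a, b} (5 / (b - a))"
  unfolding controlled_def
proof (intro conjI allI impI)
  show "0 \<le> 5 / (b - a)" using ab by simp
  fix f g assume fg: "H1_pair f g"
  note H = H1_pairD[OF fg]
  have m: "measure \<mu> {a..b} \<le> 1 / (b - a)" using light ab by (simp add: field_simps)
  have "loc \<mu> {a..<b} f \<le> (5 * (abs2 (f a) + abs2 (f b)) + 5 / 8 * (b - a) * locL {a..b} g) * (1 / (b - a))"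
    using ab by (intro radon_loc_le[OF H(3) H1_pair_endpoint_bound[OF fg] m]) auto
  also have "\<dots> = 5 / 8 * locL {a..<b} g + 5 / (b - a) * (\<Sum>p\<in>{a, b}. abs2 (f p))"
    using ab by (simp add: loc_lborel_Icc[OF H(2)] field_simps)
  also have "\<dots> \<le> 5 / 8 * locL {a..<b} g + 5 / 6 * l * locL {a..<b} f + 5 / (b - a) * (\<Sum>p\<in>{a, b}. abs2 (f p))"
    using l by simp
  finally show "loc \<mu> {a..<b} f \<le> \<dots>" .
qed simp

text \<open>The length 2 / sqrt l is chosen so that the averaged bound yields 10/(3 (b - a)^2) = 5/6
  l; no cut points are spent.\<close>

lemma controlled_light:
  assumes l: "l > 0" and ab: "b = a + 2 / sqrt l" and light: "(b - a) * measure \<mu> {a..b} \<le> 1"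
  shows "controlled l a b {} 0"
  unfolding controlled_def
proof (intro conjI allI impI)
  fix f g assume fg: "H1_pair f g"
  note H = H1_pairD[OF fg]
  have ab': "a < b" using ab l by simp
  have m: "measure \<mu> {a..b} \<le> 1 / (b - a)" using light ab' by (simp add: field_simps)
  have L: "(b - a)\<^sup>2 = 4 / l" using ab l by (simp add: power_divide)
  have "loc \<mu> {a..<b} f \<le> (10 / (3 * (b - a)) * locL {a..b} f + 5 / 8 * (b - a) * locL {a..b} g) * (1 / (b - a))"
    using ab' by (intro radon_loc_le[OF H(3) H1_pair_sup_bound[OF fg _ ab'] m]) auto
  also have "\<dots> = 10 / (3 * (b - a)\<^sup>2) * locL {a..<b} f + 5 / 8 * locL {a..<b} g"
  proof -
    have "(10 / (3 * d) * F + 5 / 8 * d * G) * (1 / d) = 10 / (3 * d\<^sup>2) * F + 5 / 8 * G" if "d > 0" for d F G :: real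
      using that by (simp add: field_simps power2_eq_square)
    from this[of "b - a"] ab' show ?thesis unfolding loc_lborel_Icc[OF H(1)] loc_lborel_Icc[OF H(2)] by simp
  qed
  also have "10 / (3 * (b - a)\<^sup>2) = 5 / 6 * l" unfolding L using l by (simp add: field_simps)
  finally show "loc \<mu> {a..<b} f \<le> 5 / 8 * locL {a..<b} g + 5 / 6 * l * locL {a..<b} f + 0 * (\<Sum>p\<in>{}. abs2 (f p))"
    by simp
qed auto

section \<open>Bisection of heavy cells and the number of cut points\<close>

abbreviation root_otelbaev :: "real \<Rightarrow> ennreal" where
  "root_otelbaev \<equiv> \<lambda>x. ennreal (sqrt (otelbaev \<mu> x))"

text \<open>Induction on a bound for (b - a) \<mu>[a, b], which each halving at least halves. The
  last hypothesis is the trace left by a heavy parent: its length is 2 (b - a), and 1/(4 (2 (b -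
  a))^2) is the bound stated.\<close>

lemma controlled_bisection:
  assumes l: "l \<ge> 0"
  shows "a < b \<Longrightarrow> (b - a) * measure \<mu> {a..b} \<le> 2 ^ n \<Longrightarrow> (\<And>x. x \<in> {a..b} \<Longrightarrow> 1 / (16 * (b - a)\<^sup>2) \<le> otelbaev \<mu> x)
    \<Longrightarrow> \<exists>P C. controlled l a b P C \<and> of_nat (card P) \<le> 8 * Ico_integral a b (root_otelbaev)"
proof (induction n arbitrary: a b)
  case 0
  \<comment> \<open>On a terminal cell \<open>root_otelbaev\<close> is at least 1/(4 (b - a)), so 8
    times its integral is at least 2, the number of endpoints.\<close>
  have "ennreal (1 / (4 * (b - a))) * ennreal (b - a) = (\<integral>\<^sup>+x\<in>{a..<b}. ennreal (1 / (4 * (b - a))) \<partial>lborel)"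
    using 0 by (simp add: nn_integral_cmult_indicator)
  also have "\<dots> \<le> Ico_integral a b (root_otelbaev)"
  proof (rule nn_integral_mono)
    fix x
    have "1 / (4 * (b - a)) \<le> sqrt (otelbaev \<mu> x)" if "x \<in> {a..<b}"
    proof (rule real_le_rsqrt)
      have "(1 / (4 * (b - a)))\<^sup>2 = 1 / (16 * (b - a)\<^sup>2)" by (simp only: power_divide power_mult_distrib) simp
      then show "(1 / (4 * (b - a)))\<^sup>2 \<le> otelbaev \<mu> x" using 0(3)[of x] that by simp
    qed
    then show "ennreal (1 / (4 * (b - a))) * indicator {a..<b} x \<le> ennreal (sqrt (otelbaev \<mu> x)) * indicator {a..<b} x"
      by (auto simp: indicator_def intro: ennreal_leI)
  qed
  finally have "8 * (ennreal (1 / (4 * (b - a))) * ennreal (b - a)) \<le> 8 * Ico_integral a b (root_otelbaev)"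
    by (rule mult_left_mono) simp
  also have "ennreal (1 / (4 * (b - a))) * ennreal (b - a) = ennreal (1 / 4)"
    using 0 by (simp flip: ennreal_mult)
  also have "8 * ennreal (1 / 4) = of_nat (card {a, b})"
  proof -
    have "8 * ennreal (1 / 4) = ennreal (8 * (1 / 4))" by (subst ennreal_mult) auto
    then show ?thesis using 0 by simp
  qed
  finally show ?case using controlled_endpoints[OF _ _ l, of a b] 0 by auto
next
  case (Suc n)
  have qm: "(\<lambda>x. ennreal (sqrt (otelbaev \<mu> x))) \<in> borel_measurable borel"
    by measurable
  show ?case
  proof (cases "(b - a) * measure \<mu> {a..b} \<le> 1")
    case True
    have "(b - a) * measure \<mu> {a..b} \<le> 2 ^ n" using True one_le_power[of "2::real" n] by linarith
    then show ?thesis using Suc.IH[of a b] Suc.prems by auto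
  next
    case False
    define c where "c = (a + b) / 2"
    have c: "a < c" "c < b" "c - a = (b - a) / 2" "b - c = (b - a) / 2" using Suc.prems(1) by (auto simp: c_def field_simps)
    \<comment> \<open>Heaviness of the present cell gives its halves exactly the lower bound
      demanded by the induction hypothesis.\<close>
    have q: "1 / (4 * (b - a)\<^sup>2) \<le> otelbaev \<mu> x" if "x \<in> {a..b}" for x
      using False that Suc.prems(1) by (intro otelbaev_ge_of_heavy_interval) auto
    have half: "(b - a) / 2 * measure \<mu> {d..e} \<le> 2 ^ n" if "{d..e} \<subseteq> {a..b}" for d e
    proof -
      have "(b - a) / 2 * measure \<mu> {d..e} \<le> (b - a) / 2 * measure \<mu> {a..b}"
        using radon_measure_mono[OF that] Suc.prems(1) by (intro mult_left_mono) auto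
      then show ?thesis using Suc.prems(2) by simp
    qed
    have sq: "16 * ((b - a) / 2)\<^sup>2 = 4 * (b - a)\<^sup>2" by (simp add: power_divide)
    obtain P C where P: "controlled l a c P C" "of_nat (card P) \<le> 8 * (\<integral>\<^sup>+x\<in>{a..<c}. ennreal (sqrt (otelbaev \<mu> x)) \<partial>lborel)"
      using Suc.IH[of a c] c half[of a c] q unfolding c(3) sq by fastforce
    obtain Q D where Q: "controlled l c b Q D" "of_nat (card Q) \<le> 8 * (\<integral>\<^sup>+x\<in>{c..<b}. ennreal (sqrt (otelbaev \<mu> x)) \<partial>lborel)"
      using Suc.IH[of c b] c half[of c b] q unfolding c(4) sq by fastforce
    have "controlled l a b (P \<union> Q) (C + D)"
      using controlled_union[OF P(1) Q(1)] c by simp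
    moreover have "(of_nat (card (P \<union> Q)) :: ennreal) \<le> of_nat (card P) + of_nat (card Q)"
      by (metis card_Un_le of_nat_add of_nat_mono)
    then have "of_nat (card (P \<union> Q)) \<le> 8 * Ico_integral a b (root_otelbaev)"
      unfolding nn_integral_Ico_split[OF qm less_imp_le[OF c(1)] less_imp_le[OF c(2)]] distrib_left
      using add_mono[OF P(2) Q(2)] by (rule order_trans)
    ultimately show ?thesis by blast
  qed
qed

text \<open>The cutoff l / 16 is 1/(4 (b - a)^2) for a cell of length 2 / sqrt l, the lower bound
  for \<open>otelbaev\<close> on a heavy grid cell.\<close>

definition counting_density :: "real \<Rightarrow> real \<Rightarrow> ennreal" where
  "counting_density l x = ennreal (sqrt (otelbaev \<mu> x)) * indicator {x. l / 16 \<le> otelbaev \<mu> x} x"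

abbreviation counting_integral :: "real \<Rightarrow> ennreal" where
  "counting_integral l \<equiv> \<integral>\<^sup>+x. counting_density l x \<partial>lborel"

lemma counting_density_measurable:
  shows "counting_density l \<in> borel_measurable borel"
proof -
  have [measurable]: "{x. l / 16 \<le> otelbaev \<mu> x} \<in> sets borel" by measurable
  show ?thesis unfolding counting_density_def[abs_def] by measurable
qed

lemma controlled_grid_cell:
  assumes l: "l > 0" and ab: "b = a + 2 / sqrt l"
  shows "\<exists>P C. controlled l a b P C \<and> of_nat (card P) \<le> 8 * (\<integral>\<^sup>+x\<in>{a..<b}. counting_density l x \<partial>lborel)"
proof (cases "(b - a) * measure \<mu> {a..b} \<le> 1")
  case True
  then show ?thesis using controlled_light[OF l ab] by (intro exI[of _ "{}"] exI[of _ 0]) auto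
next
  case False
  have ab': "a < b" using ab l by simp
  have L: "(b - a)\<^sup>2 = 4 / l" using ab l by (simp add: power_divide)
  have q: "1 / (4 * (b - a)\<^sup>2) \<le> otelbaev \<mu> x" if "x \<in> {a..b}" for x
    using False that ab' by (intro otelbaev_ge_of_heavy_interval) auto
  then have q': "l / 16 \<le> otelbaev \<mu> x" if "x \<in> {a..b}" for x using that unfolding L by simp
  obtain n where n: "(b - a) * measure \<mu> {a..b} < 2 ^ n"
    using real_arch_pow[of 2 "(b - a) * measure \<mu> {a..b}"] by auto
  \<comment> \<open>A heavy grid cell satisfies the bound required of a child with a factor 4 to
    spare, so the bisection can start from it.\<close>
  have "1 / (16 * (b - a)\<^sup>2) \<le> 1 / (4 * (b - a)\<^sup>2)" using ab' by (intro divide_left_mono) auto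
  then obtain P C where P: "controlled l a b P C" "of_nat (card P) \<le> 8 * Ico_integral a b (root_otelbaev)"
    using controlled_bisection[of l a b n] l ab' n q by (meson less_imp_le order_trans)
  moreover have "Ico_integral a b (root_otelbaev) = (\<integral>\<^sup>+x\<in>{a..<b}. counting_density l x \<partial>lborel)"
    using q' by (intro nn_integral_cong) (auto simp: counting_density_def indicator_def)
  ultimately show ?thesis by auto
qed

lemma controlled_grid:
  assumes l: "l > 0"
  shows "\<exists>P C. controlled l a (a + real n * (2 / sqrt l)) P C
    \<and> of_nat (card P) \<le> 8 * (\<integral>\<^sup>+x\<in>{a..<a + real n * (2 / sqrt l)}. counting_density l x \<partial>lborel)"
proof (induction n)
  case 0
  have "controlled l a a {} 0" by (auto simp: controlled_def loc_eq)
  then show ?case by (intro exI[of _ "{}"] exI[of _ 0]) auto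
next
  case (Suc n)
  define b where "b = a + real n * (2 / sqrt l)"
  define c where "c = b + 2 / sqrt l"
  have abc: "a \<le> b" "b \<le> c" using l by (auto simp: b_def c_def)
  have c: "a + real (Suc n) * (2 / sqrt l) = c" unfolding c_def b_def by (simp add: ring_distribs add_divide_distrib)
  obtain P C where P: "controlled l a b P C" "of_nat (card P) \<le> 8 * (\<integral>\<^sup>+x\<in>{a..<b}. counting_density l x \<partial>lborel)"
    using Suc by (auto simp: b_def)
  obtain Q D where Q: "controlled l b c Q D" "of_nat (card Q) \<le> 8 * (\<integral>\<^sup>+x\<in>{b..<c}. counting_density l x \<partial>lborel)"
    using controlled_grid_cell[OF l c_def] by auto
  have "controlled l a c (P \<union> Q) (C + D)"
    using controlled_union[OF P(1) Q(1)] abc by simp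
  moreover have "(of_nat (card (P \<union> Q)) :: ennreal) \<le> of_nat (card P) + of_nat (card Q)"
    by (metis card_Un_le of_nat_add of_nat_mono)
  then have "of_nat (card (P \<union> Q)) \<le> 8 * (\<integral>\<^sup>+x\<in>{a..<c}. counting_density l x \<partial>lborel)"
    unfolding nn_integral_Ico_split[OF counting_density_measurable abc] distrib_left
    using add_mono[OF P(2) Q(2)] by (rule order_trans)
  ultimately show ?case unfolding c by blast
qed

text \<open>Exhaustion by bounded windows and monotone convergence. Square integrability with
  respect to \<mu> is a conclusion here, not an assumption.\<close>

lemma nsq_le_of_loc_le:
  assumes f: "continuous_on UNIV f"
    and B: "\<And>n::nat. \<exists>m r. {- real n..real n} \<subseteq> {m..<r} \<and> loc \<mu> {m..<r} f \<le> B"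
  shows "f \<in> sqint \<mu>" "nsq \<mu> f \<le> B"
proof -
  have [measurable]: "f \<in> borel_measurable \<mu>" by (rule measurable_radon[OF f])
  have [measurable]: "{a..b} \<in> sets \<mu>" for a b :: real by simp
  let ?h = "\<lambda>n x. ennreal (indicator {- real n..real n} x * abs2 (f x))"
  have "(SUP n. ?h n x) = ennreal (abs2 (f x))" for x
  proof (rule antisym)
    show "(SUP n. ?h n x) \<le> ennreal (abs2 (f x))"
      by (intro SUP_least ennreal_leI) (auto simp: indicator_def)
    obtain n where n: "\<bar>x\<bar> \<le> real n" using real_arch_simple by blast
    then have "ennreal (abs2 (f x)) = ?h n x" by (auto simp: indicator_def)
    also have "\<dots> \<le> (SUP n. ?h n x)" by (rule SUP_upper) simp
    finally show "ennreal (abs2 (f x)) \<le> (SUP n. ?h n x)" .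
  qed
  then have "(\<integral>\<^sup>+x. ennreal (abs2 (f x)) \<partial>\<mu>) = (\<integral>\<^sup>+x. (SUP n. ?h n x) \<partial>\<mu>)" by simp
  also have "\<dots> = (SUP n. \<integral>\<^sup>+x. ?h n x \<partial>\<mu>)"
  proof (rule nn_integral_monotone_convergence_SUP)
    show "incseq ?h"
      by (auto simp: incseq_def le_fun_def indicator_def intro!: ennreal_leI)
  qed measurable
  also have "\<dots> \<le> ennreal B"
  proof (rule SUP_least)
    fix n
    obtain m r where mr: "{- real n..real n} \<subseteq> {m..<r}" "loc \<mu> {m..<r} f \<le> B" using B[of n] by blast
    have "(\<integral>\<^sup>+x. ?h n x \<partial>\<mu>) \<le> (\<integral>\<^sup>+x. ennreal (abs2 (indicator {m..<r} x * f x)) \<partial>\<mu>)"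
      using mr(1) by (intro nn_integral_mono ennreal_leI) (auto simp: indicator_def norm_mult)
    also have "\<dots> = ennreal (loc \<mu> {m..<r} f)"
      unfolding loc_def nsq_def by (intro nn_integral_eq_integral sqintD(2)[OF radon_loc_sqint[OF f]]) auto
    also have "\<dots> \<le> ennreal B" using mr(2) by (rule ennreal_leI)
    finally show "(\<integral>\<^sup>+x. ?h n x \<partial>\<mu>) \<le> ennreal B" .
  qed
  finally have le: "(\<integral>\<^sup>+x. ennreal (abs2 (f x)) \<partial>\<mu>) \<le> ennreal B" .
  have B0: "B \<ge> 0" using B[of 0] loc_nonneg order_trans by blast
  have int: "integrable \<mu> (\<lambda>x. abs2 (f x))"
    using le by (intro integrableI_nonneg) (auto simp: less_top[symmetric] top_unique)
  then show "f \<in> sqint \<mu>" by (simp add: sqint_def)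
  have "ennreal (nsq \<mu> f) \<le> ennreal B"
    using le int by (simp add: nsq_def nn_integral_eq_integral)
  then show "nsq \<mu> f \<le> B" using B0 by simp
qed

text \<open>Membership in \<open>sqint \<mu>\<close> is included because it is not known beforehand;
  it identifies the form domain with H^1.\<close>

definition key_bound :: "real \<Rightarrow> real set \<Rightarrow> real \<Rightarrow> bool" where
  "key_bound l P C \<longleftrightarrow> (\<forall>f g. H1_pair f g \<longrightarrow> f \<in> sqint \<mu> \<and>
     nsq \<mu> f \<le> 5 / 8 * nsqL g + 5 / 6 * l * nsqL f + C * (\<Sum>p\<in>P. abs2 (f p)))"

text \<open>Within w/8 of the centre the tent is at least 7/8, and 4 (7/8)^2 = 49/16 exceeds
  3.\<close>

lemma nsq_tent_ge:
  assumes w: "w > 0" and heavy: "4 / w \<le> measure \<mu> {x - w / 8..x + w / 8}"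
    and sq: "(\<lambda>t. of_real (tent w x t)) \<in> sqint \<mu>"
  shows "3 / w \<le> nsq \<mu> (\<lambda>t. of_real (tent w x t))"
proof -
  have "3 / w \<le> 49 / 64 * (4 / w)" using w by (simp add: field_simps)
  also have "\<dots> \<le> 49 / 64 * measure \<mu> {x - w / 8..x + w / 8}" using heavy by simp
  also have "\<dots> = (\<integral>t. 49 / 64 * indicator {x - w / 8..x + w / 8} t \<partial>\<mu>)" by simp
  also have "\<dots> \<le> nsq \<mu> (\<lambda>t. of_real (tent w x t))"
    unfolding nsq_def
  proof (rule integral_mono[OF _ sqintD(2)[OF sq]])
    show "integrable \<mu> (\<lambda>t. 49 / 64 * indicator {x - w / 8..x + w / 8} t :: real)"
      using radon_emeasure_Icc by (intro integrable_mult_right integrable_real_indicator) auto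
    fix t
    show "49 / 64 * indicator {x - w / 8..x + w / 8} t \<le> abs2 (of_real (tent w x t))"
    proof (cases "t \<in> {x - w / 8..x + w / 8}")
      case True
      then have "\<bar>t - x\<bar> \<le> w / 8" unfolding atLeastAtMost_iff abs_le_iff by linarith
      then have "\<bar>t - x\<bar> / w \<le> 1 / 8" using w by (simp add: field_simps)
      then have "7 / 8 \<le> 1 - \<bar>t - x\<bar> / w" by linarith
      then have "7 / 8 \<le> tent w x t" unfolding tent_def by (rule max.coboundedI2)
      then have "(7 / 8)\<^sup>2 \<le> (tent w x t)\<^sup>2" by (intro power_mono) auto
      then show ?thesis using True by (simp add: power2_eq_square)
    qed simp
  qed
  finally show ?thesis .
qed

end

text \<open>The hypothesis of the theorem in working form: windows of every length, located by their
  left endpoint.\<close>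

locale vanishing_tails = radon +
  assumes tails: "\<forall>e>0. \<forall>L. \<exists>R>0. \<forall>x. \<bar>x\<bar> \<ge> R \<longrightarrow> measure \<mu> {x..x + L} < e"
begin

text \<open>Beyond some distance every grid cell is light and costs no points, so \<open>P\<close>
  and \<open>C\<close> of a central block serve all larger blocks, and these exhaust the
  line.\<close>

lemma key_inequality:
  assumes l: "l > 0"
  shows "\<exists>P C. finite P \<and> C \<ge> 0 \<and> of_nat (card P) \<le> 8 * counting_integral l
    \<and> key_bound l P C"
proof -
  define L where "L = 2 / sqrt l"
  have L: "L > 0" using l by (simp add: L_def)
  have "1 / L > 0" using L by simp
  then obtain R where R: "R > 0" "\<And>x. \<bar>x\<bar> \<ge> R \<Longrightarrow> measure \<mu> {x..x + L} < 1 / L"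
    using tails by meson
  have far: "controlled l x (x + L) {} 0" if "\<bar>x\<bar> \<ge> R" for x
    using R(2)[OF that] L by (intro controlled_light[OF l]) (auto simp: L_def field_simps)
  obtain N :: nat where "R / L + 1 \<le> real N" using real_arch_simple by blast
  then have N: "real N * L \<ge> R + L" using L by (simp add: field_simps)
  obtain P C where P: "controlled l (- real N * L) (- real N * L + real (2 * N) * L) P C"
    and card: "of_nat (card P) \<le> 8 * (\<integral>\<^sup>+x\<in>{- real N * L..<- real N * L + real (2 * N) * L}. counting_density l x \<partial>lborel)"
    using controlled_grid[OF l, of "- real N * L" "2 * N"] unfolding L_def by auto
  have ctl: "controlled l (- real (N + k) * L) (real (N + k) * L) P C" for k
  proof (induction k)
    case 0
    then show ?case using P by (simp add: algebra_simps)
  next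
    case (Suc k)
    let ?a = "real (N + k) * L"
    have a: "?a \<ge> R + L" using N L by (smt (verit) mult_right_mono of_nat_add of_nat_0_le_iff)
    have e: "real (N + Suc k) * L = ?a + L" by (simp add: algebra_simps)
    have "controlled l (- ?a - L) (- ?a - L + L) {} 0" "controlled l ?a (?a + L) {} 0"
      using a R(1) L by (intro far; linarith)+
    moreover have "controlled l (- ?a) ?a P C" using Suc by (simp only: mult_minus_left)
    ultimately have "controlled l (- ?a - L) (?a + L) ({} \<union> (P \<union> {})) (0 + (C + 0))"
      using a R(1) L by (intro controlled_union[of _ _ "- ?a"] controlled_union[of _ _ ?a]) auto
    then have "controlled l (- ?a - L) (?a + L) P C"
      by (simp only: Un_empty_left Un_empty_right add_0_left add_0_right)
    moreover have "- real (N + Suc k) * L = - ?a - L" by (simp add: algebra_simps)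
    ultimately show ?case using e by (simp only:)
  qed
  have fin: "finite P" "C \<ge> 0" using P by (auto simp: controlled_def)
  have "(\<integral>\<^sup>+x\<in>{- real N * L..<- real N * L + real (2 * N) * L}. counting_density l x \<partial>lborel)
     \<le> counting_integral l"
    by (intro nn_integral_mono) (auto simp: indicator_def)
  then have "of_nat (card P) \<le> 8 * counting_integral l"
    using card by (meson mult_left_mono order_trans zero_le)
  moreover have "f \<in> sqint \<mu> \<and> nsq \<mu> f \<le> 5 / 8 * nsqL g + 5 / 6 * l * nsqL f + C * (\<Sum>p\<in>P. abs2 (f p))"
    if fg: "H1_pair f g" for f g
  proof -
    note H = H1_pairD[OF fg]
    let ?B = "5 / 8 * nsqL g + 5 / 6 * l * nsqL f + C * (\<Sum>p\<in>P. abs2 (f p))"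
    have "\<exists>m r. {- real n..real n} \<subseteq> {m..<r} \<and> loc \<mu> {m..<r} f \<le> ?B" for n :: nat
    proof -
      \<comment> \<open>The extra 1 places the closed window inside the half-open block.\<close>
      obtain k :: nat where "(real n + 1) / L \<le> real k" using real_arch_simple by blast
      then have "real n + 1 \<le> real k * L" using L by (simp add: field_simps)
      moreover have "real k * L \<le> real (N + k) * L" using L by (intro mult_right_mono) auto
      ultimately have k: "real n + 1 \<le> real (N + k) * L" by linarith
      let ?m = "- real (N + k) * L" and ?r = "real (N + k) * L"
      have "loc \<mu> {?m..<?r} f \<le> 5 / 8 * locL {?m..<?r} g + 5 / 6 * l * locL {?m..<?r} f + C * (\<Sum>p\<in>P. abs2 (f p))"
        using ctl[of k] fg by (simp add: controlled_def)
      also have "\<dots> \<le> ?B"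
        using l H fin by (intro add_mono mult_left_mono loc_le_nsq) auto
      finally have "loc \<mu> {?m..<?r} f \<le> ?B" .
      moreover have "{- real n..real n} \<subseteq> {?m..<?r}"
      proof
        fix x assume x: "x \<in> {- real n..real n}"
        have "?m = - (real (N + k) * L)" by (rule mult_minus_left)
        then show "x \<in> {?m..<?r}" using x k unfolding atLeastAtMost_iff atLeastLessThan_iff by linarith
      qed
      ultimately show ?thesis by blast
    qed
    from nsq_le_of_loc_le[OF H(3) this] show ?thesis by blast
  qed
  ultimately show ?thesis using fin unfolding key_bound_def by blast
qed

end

section \<open>Eigenfunctions\<close>

context vanishing_tails
begin

section \<open>The form on all of the Sobolev space\<close>

lemma H1_sqint_radon: "f \<in> H1 \<Longrightarrow> f \<in> sqint \<mu>"
  using key_inequality[of 1] by (auto simp: H1_iff key_bound_def)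

lemma form_dom_eq_H1: "form_dom \<mu> = H1"
  using H1_sqint_radon by (auto simp: form_dom_def sqint_def)

sublocale F: hermitian_form H1 "form \<mu>"
proof
  fix f g h c
  assume f: "f \<in> H1"
  then obtain f' where f': "H1_pair f f'" by (auto simp: H1_iff)
  { assume g: "g \<in> H1"
    then obtain g' where g': "H1_pair g g'" by (auto simp: H1_iff)
    show "cnj (form \<mu> f g) = form \<mu> g f"
      by (simp add: form_eq[OF f' g'] form_eq[OF g' f'] ip_cnj)
    assume h: "h \<in> H1"
    then obtain h' where h': "H1_pair h h'" by (auto simp: H1_iff)
    show "form \<mu> (f + g) h = form \<mu> f h + form \<mu> g h"
      using H1_pairD(2)[OF f'] H1_pairD(2)[OF g'] H1_pairD(2)[OF h'] H1_sqint_radon[OF f] H1_sqint_radon[OF g] H1_sqint_radon[OF h]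
      by (simp add: form_eq[OF H1_pair_add[OF f' g'] h'] form_eq[OF f' h'] form_eq[OF g' h'] ip_add_left) }
  { assume h: "h \<in> H1"
    then obtain h' where h': "H1_pair h h'" by (auto simp: H1_iff)
    show "form \<mu> (\<lambda>x. c * f x) h = c * form \<mu> f h"
      by (simp add: form_eq[OF H1_pair_scale[OF f'] h'] form_eq[OF f' h'] ip_scale_left right_diff_distrib) }
qed (auto intro: I.X_add I.X_scale I.X_zero)

lemma eigenspace_iff:
  shows "u \<in> eigenspace \<mu> l \<longleftrightarrow> u \<in> H1 \<and> (\<forall>v\<in>H1. form \<mu> u v = of_real l * ipL u v)"
  by (auto simp: eigenspace_def form_operator_def form_dom_eq_H1 L2_eq_sqint L2_inner_eq_ip ip_scale_left
      intro: sqint_scale H1_sqint)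

text \<open>A relative form bound below 1. The point values in the key inequality are absorbed by
  the Sobolev embedding at a small length, which raises 5/8 to 3/4. It yields semiboundedness and
  continuity of the form in the Sobolev norm.\<close>

lemma form_bounded:
  shows "\<exists>C\<ge>0. \<forall>f g. H1_pair f g \<longrightarrow> f \<in> sqint \<mu> \<and> nsq \<mu> f \<le> 3 / 4 * nsqL g + C * nsqL f"
proof -
  obtain P C where P: "finite P" "C \<ge> 0"
    and K: "key_bound 1 P C"
    using key_inequality[of 1] by auto
  define D where "D = C * real (card P)"
  have D: "D \<ge> 0" using P by (simp add: D_def)
  \<comment> \<open>Chosen so that D times 5/8 L equals D / (8 (D + 1)), which is at most
    1/8.\<close>
  define L where "L = 1 / (5 * (D + 1))"
  have L: "L > 0" using D by (simp add: L_def)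
  have DL: "D * (5 / 8 * L) \<le> 1 / 8" using D by (simp add: L_def field_simps)
  have "nsq \<mu> f \<le> 3 / 4 * nsqL g + (5 / 6 + D * (10 / (3 * L))) * nsqL f" if fg: "H1_pair f g" for f g
  proof -
    have "C * (\<Sum>p\<in>P. abs2 (f p)) \<le> C * (\<Sum>p\<in>P. 10 / (3 * L) * nsqL f + 5 / 8 * L * nsqL g)"
      using P by (intro mult_left_mono sum_mono H1_pair_global_bound[OF fg L])
    also have "\<dots> = D * (10 / (3 * L)) * nsqL f + D * (5 / 8 * L) * nsqL g"
      by (simp add: D_def algebra_simps)
    also have "\<dots> \<le> D * (10 / (3 * L)) * nsqL f + 1 / 8 * nsqL g"
      using DL by (intro add_left_mono mult_right_mono) auto
    finally show ?thesis using K fg by (fastforce simp: key_bound_def algebra_simps)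
  qed
  moreover have "5 / 6 + D * (10 / (3 * L)) \<ge> 0" using D L by simp
  ultimately show ?thesis using K unfolding key_bound_def by blast
qed

lemma eigenspace_sum:
  assumes B: "B \<subseteq> eigenspace \<mu> l"
  shows "(\<Sum>b\<in>B. (\<lambda>x. c b * b x)) \<in> eigenspace \<mu> l"
proof -
  have bH: "b \<in> H1" if "b \<in> B" for b using B that by (auto simp: eigenspace_iff)
  have sH: "(\<lambda>x. c b * b x) \<in> H1" if "b \<in> B" for b using bH[OF that] by (rule F.X_scale)
  have "form \<mu> (\<Sum>b\<in>B. (\<lambda>x. c b * b x)) v = of_real l * ipL (\<Sum>b\<in>B. (\<lambda>x. c b * b x)) v" if v: "v \<in> H1" for v
  proof -
    have "form \<mu> (\<Sum>b\<in>B. (\<lambda>x. c b * b x)) v = (\<Sum>b\<in>B. c b * form \<mu> b v)"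
      using v bH by (subst F.sum_left[OF sH v]) (auto intro!: sum.cong F.scale_left)
    also have "\<dots> = (\<Sum>b\<in>B. of_real l * (c b * ipL b v))"
      using B v by (intro sum.cong) (auto simp: eigenspace_iff subset_iff)
    also have "\<dots> = of_real l * (\<Sum>b\<in>B. ipL (\<lambda>x. c b * b x) v)"
      by (simp add: ip_scale_left sum_distrib_left)
    also have "\<dots> = of_real l * ipL (\<Sum>b\<in>B. (\<lambda>x. c b * b x)) v"
      using v by (subst I.sum_left[OF sH v]) auto
    finally show ?thesis .
  qed
  then show ?thesis using F.X_sum[OF sH] by (simp add: eigenspace_iff)
qed

lemma eigenspace_orthogonal:
  assumes u: "u \<in> eigenspace \<mu> k" and v: "v \<in> eigenspace \<mu> l" and kl: "k \<noteq> l"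
  shows "ipL u v = 0"
proof -
  have H: "u \<in> H1" "v \<in> H1" using u v by (auto simp: eigenspace_iff)
  have "of_real k * ipL u v = form \<mu> u v" using u H by (simp add: eigenspace_iff)
  also have "\<dots> = cnj (form \<mu> v u)" using F.cnj_sym[OF H(2,1)] by simp
  also have "\<dots> = cnj (of_real l * ipL v u)" using v H by (simp add: eigenspace_iff)
  also have "\<dots> = of_real l * ipL u v" by (simp add: ip_cnj)
  finally show ?thesis using kl by simp
qed

text \<open>Any more eigenfunctions than points in \<open>P\<close> admit a nontrivial combination that vanishes on \<open>P\<close>; on it
  the form is at least \<open>-(5/6) l\<close> by the key inequality and at most \<open>-l\<close> by the spectral assumption.\<close>

lemma eigenfunctions_le_points:
  assumes l: "l > 0" and P: "finite P"
    and K: "key_bound l P C"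
    and S: "finite S" "\<And>k. k \<in> S \<Longrightarrow> k \<le> - l"
    and B: "\<And>k. k \<in> S \<Longrightarrow> finite (B k) \<and> B k \<subseteq> eigenspace \<mu> k \<and> cfun.independent (B k)"
  shows "(\<Sum>k\<in>S. card (B k)) \<le> card P"
proof (rule ccontr)
  assume "\<not> ?thesis"
  then have "card P < card (Sigma S B)" using S(1) B by (subst card_SigmaI) auto
  moreover have "finite (Sigma S B)" using S B by auto
  ultimately obtain c where c: "\<exists>i\<in>Sigma S B. c i \<noteq> 0" "\<And>p. p \<in> P \<Longrightarrow> (\<Sum>i\<in>Sigma S B. c i * (snd i) p) = 0"
    using underdetermined_system[OF P, of "Sigma S B" "\<lambda>i p. (snd i) p"] by auto
  \<comment> \<open>Grouping by eigenvalue makes the parts \<open>f k\<close> mutually orthogonal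
    without orthogonalizing inside an eigenspace; independence of \<open>B k\<close> enters only at
    the end.\<close>
  define f where "f k = (\<Sum>b\<in>B k. (\<lambda>x. c (k, b) * b x))" for k
  have f: "f k \<in> eigenspace \<mu> k" if "k \<in> S" for k
    unfolding f_def using B[OF that] by (intro eigenspace_sum) auto
  have fH: "f k \<in> H1" if "k \<in> S" for k using f[OF that] by (simp add: eigenspace_iff)
  define h where "h = (\<Sum>k\<in>S. f k)"
  have hH: "h \<in> H1" unfolding h_def using fH by (rule F.X_sum)
  then obtain g where hg: "H1_pair h g" by (auto simp: H1_iff)
  have h0: "h p = 0" if "p \<in> P" for p
  proof -
    have "h p = (\<Sum>k\<in>S. \<Sum>b\<in>B k. c (k, b) * b p)"
      by (simp add: h_def f_def sum_fun_apply)
    also have "\<dots> = (\<Sum>i\<in>Sigma S B. c i * (snd i) p)"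
      using S B by (subst sum.Sigma) (auto intro!: sum.cong)
    finally show ?thesis using c(2)[OF that] by simp
  qed
  have orth: "ipL (f j) (f k) = (if j = k then of_real (nsqL (f k)) else 0)" if "j \<in> S" "k \<in> S" for j k
    using eigenspace_orthogonal[OF f f] that by (auto simp: ip_self)
  have ip_k: "ipL (f k) h = of_real (nsqL (f k))" if "k \<in> S" for k
  proof -
    have "ipL (f k) h = (\<Sum>j\<in>S. ipL (f k) (f j))"
      unfolding h_def by (rule I.sum_right[OF fH fH[OF that]])
    also have "\<dots> = (\<Sum>j\<in>S. if k = j then of_real (nsqL (f k)) else 0)"
      using that by (intro sum.cong) (auto simp: orth)
    also have "\<dots> = of_real (nsqL (f k))" using that S(1) by simp
    finally show ?thesis .
  qed
  have "ipL h h = (\<Sum>k\<in>S. ipL (f k) h)"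
    unfolding h_def by (rule I.sum_left[OF fH]) (use hH h_def in auto)
  then have nh: "nsqL h = (\<Sum>k\<in>S. nsqL (f k))"
    by (simp add: ip_k ip_self flip: of_real_sum)
  have "form \<mu> h h = (\<Sum>k\<in>S. form \<mu> (f k) h)"
    unfolding h_def by (rule F.sum_left[OF fH]) (use hH h_def in auto)
  also have "\<dots> = (\<Sum>k\<in>S. of_real (k * nsqL (f k)))"
    using f hH by (intro sum.cong) (auto simp: eigenspace_iff ip_k)
  finally have "Re (form \<mu> h h) = (\<Sum>k\<in>S. k * nsqL (f k))"
    by (simp flip: of_real_sum)
  also have "\<dots> \<le> (\<Sum>k\<in>S. - l * nsqL (f k))"
    using S(2) by (intro sum_mono mult_right_mono) auto
  also have "\<dots> = - l * nsqL h" by (simp add: nh sum_distrib_left)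
  finally have up: "nsqL g - nsq \<mu> h \<le> - l * nsqL h" by (simp add: Re_form_self[OF hg])
  have "nsq \<mu> h \<le> 5 / 8 * nsqL g + 5 / 6 * l * nsqL h"
    using K hg h0 by (fastforce simp: key_bound_def)
  \<comment> \<open>The two bounds together leave 3/8 \<open>nsqL g\<close> plus 1/6
    \<open>l * nsqL h\<close> at most 0.\<close>
  then have "1 / 6 * (l * nsqL h) \<le> 0" using up nsq_nonneg[of lborel g] by linarith
  then have "nsqL h = 0" using l nsq_nonneg[of lborel h] by (simp add: mult_le_0_iff)
  then have "\<forall>k\<in>S. nsqL (f k) = 0" using S(1) by (simp add: nh sum_nonneg_eq_0_iff)
  then have fk: "f k = 0" if "k \<in> S" for k using H1_nsq_eq_0[OF fH[OF that]] that by blast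
  obtain k b where kb: "k \<in> S" "b \<in> B k" "c (k, b) \<noteq> 0" using c(1) by auto
  have "(\<Sum>b\<in>B k. (\<lambda>x. c (k, b) * b x)) = 0" using fk[OF kb(1)] by (simp add: f_def)
  then have "c (k, b) = 0"
    using cfun.independentD[of "B k" "B k" "\<lambda>b. c (k, b)" b] B[OF kb(1)] kb(2) by blast
  then show False using kb(3) by simp
qed

text \<open>Direct method in the orthogonal complement of \<open>S\<close>. The trial function
  \<open>f0\<close> pushes the infimum \<open>m\<close> to at most -l; its negativity matters, since
  the key inequality at level -m then leaves a positive multiple of the norm. The Euler equation is
  obtained on the complement and extends to H^1 because \<open>S\<close> consists of
  eigenfunctions.\<close>

lemma eigenfunction_exists:
  assumes l: "l > 0"
    and S: "finite S" "\<And>e. e \<in> S \<Longrightarrow> \<exists>k. e \<in> eigenspace \<mu> k"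
      "\<And>e e'. e \<in> S \<Longrightarrow> e' \<in> S \<Longrightarrow> ipL e e' = (if e = e' then 1 else 0)"
    and f0: "f0 \<in> H1" "f0 \<noteq> 0" "\<And>e. e \<in> S \<Longrightarrow> ipL f0 e = 0" "Re (form \<mu> f0 f0) \<le> - l * nsqL f0"
  shows "\<exists>e k. e \<in> eigenspace \<mu> k \<and> k \<le> - l \<and> nsqL e = 1 \<and> (\<forall>e'\<in>S. ipL e e' = 0)"
proof -
  define Y where "Y = {f \<in> H1. \<forall>e\<in>S. ipL f e = 0}"
  have YH: "f \<in> H1" if "f \<in> Y" for f using that by (simp add: Y_def)
  have SH: "e \<in> H1" if "e \<in> S" for e using S(2)[OF that] by (auto simp: eigenspace_iff)
  have Y_add: "f + g \<in> Y" if "f \<in> Y" "g \<in> Y" for f g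
    using that SH by (auto simp: Y_def I.add_left F.X_add)
  have Y_diff: "f - g \<in> Y" if "f \<in> Y" "g \<in> Y" for f g
    using that SH by (auto simp: Y_def I.diff_left F.X_diff)
  have Y_scale: "(\<lambda>x. c * f x) \<in> Y" if "f \<in> Y" for f c
    using that SH by (auto simp: Y_def ip_scale_left F.X_scale)
  define E where "E f = Re (form \<mu> f f)" for f
  have E_scale: "E (\<lambda>x. c * f x) = abs2 c * E f" if "f \<in> H1" for f c
  proof -
    have "form \<mu> (\<lambda>x. c * f x) (\<lambda>x. c * f x) = c * cnj c * form \<mu> f f"
      using that by (simp add: F.scale_left F.scale_right F.X_scale)
    also have "c * cnj c = of_real (abs2 c)" by (simp add: complex_norm_square[symmetric])
    finally show ?thesis by (simp add: E_def)
  qed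
  have normalize: "\<exists>c. nsqL (\<lambda>x. c * f x) = 1 \<and> abs2 c = 1 / nsqL f" if "nsqL f > 0" for f
  proof (intro exI conjI)
    show "abs2 (of_real (1 / sqrt (nsqL f))) = 1 / nsqL f"
      using that by (simp only: norm_of_real power2_abs power_divide) simp
    then show "nsqL (\<lambda>x. of_real (1 / sqrt (nsqL f)) * f x) = 1"
      using that by (simp only: nsq_scale) simp
  qed
  obtain D where D: "D \<ge> 0" "\<And>f g. H1_pair f g \<Longrightarrow> f \<in> sqint \<mu> \<and> nsq \<mu> f \<le> 3 / 4 * nsqL g + D * nsqL f"
    using form_bounded by blast
  have E_lower: "E f \<ge> 1 / 4 * nsqL g - D * nsqL f" if "H1_pair f g" for f g
    using D(2)[OF that] by (simp add: E_def Re_form_self[OF that])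
  define V where "V = {E f | f. f \<in> Y \<and> nsqL f = 1}"
  define m where "m = Inf V"
  have bdd: "bdd_below V"
  proof (rule bdd_belowI[of _ "- D"])
    fix v assume "v \<in> V"
    then obtain f where f: "v = E f" "f \<in> Y" "nsqL f = 1" by (auto simp: V_def)
    then obtain g where "H1_pair f g" using YH by (auto simp: H1_iff)
    then have "1 / 4 * nsqL g - D * 1 \<le> v" using E_lower f by metis
    then show "- D \<le> v" using nsq_nonneg[of lborel g] by linarith
  qed
  have f0Y: "f0 \<in> Y" using f0 by (simp add: Y_def)
  have f0n: "nsqL f0 > 0" using H1_nsq_eq_0[OF f0(1)] f0(2) nsq_nonneg[of lborel f0] by (metis order_le_less)
  obtain c0 where c0: "nsqL (\<lambda>x. c0 * f0 x) = 1" "abs2 c0 = 1 / nsqL f0"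
    using normalize[OF f0n] by blast
  have c0V: "E (\<lambda>x. c0 * f0 x) \<in> V" using c0(1) Y_scale[OF f0Y] by (auto simp: V_def)
  have "m \<le> E (\<lambda>x. c0 * f0 x)" unfolding m_def using c0V bdd by (rule cInf_lower)
  also have "\<dots> = E f0 / nsqL f0" using c0(2) E_scale[OF f0(1)] by simp
  also have "\<dots> \<le> - l" using f0(4) f0n by (simp add: E_def field_simps)
  finally have ml: "m \<le> - l" .
  then have m: "m < 0" using l by simp
  have E_ge: "m * nsqL f \<le> E f" if f: "f \<in> Y" for f
  proof (cases "nsqL f > 0")
    case True
    then obtain c where c: "nsqL (\<lambda>x. c * f x) = 1" "abs2 c = 1 / nsqL f"
      using normalize by blast
    have "m \<le> E (\<lambda>x. c * f x)" unfolding m_def using c(1) Y_scale[OF f] bdd by (intro cInf_lower) (auto simp: V_def)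
    also have "\<dots> = E f / nsqL f" using c(2) E_scale[OF YH[OF f]] by simp
    finally show ?thesis using True by (simp add: field_simps)
  next
    case False
    then have "f = 0" using H1_nsq_eq_0[OF YH[OF f]] nsq_nonneg[of lborel f] by (metis order_le_less)
    then show ?thesis using F.X_zero by (simp add: E_def)
  qed
  \<comment> \<open>The shift by the infimum makes the form nonnegative on \<open>Y\<close>, with
    values tending to 0 along a normalized minimizing sequence.\<close>
  define q where "q f h = form \<mu> f h - of_real m * ipL f h" for f h
  interpret Q: hermitian_form H1 q
  proof
    fix f g h c assume fg: "f \<in> H1" "g \<in> H1"
    show "cnj (q f g) = q g f" using fg by (simp add: q_def F.cnj_sym ip_cnj)
    show "q (\<lambda>x. c * f x) g = c * q f g" using fg by (simp add: q_def F.scale_left ip_scale_left algebra_simps)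
    assume "h \<in> H1"
    then show "q (f + g) h = q f h + q g h" using fg by (simp add: q_def F.add_left I.add_left algebra_simps)
  qed (auto intro: F.X_add F.X_scale F.X_zero)
  have Req: "Re (q f f) = E f - m * nsqL f" for f by (simp add: q_def E_def ip_self)
  have q_pos: "0 \<le> Re (q f f)" if "f \<in> Y" for f using E_ge[OF that] by (simp add: Req)
  have "\<exists>u. u \<in> Y \<and> nsqL u = 1 \<and> E u < m + 1 / real (Suc n)" for n
  proof -
    have "V \<noteq> {}" "Inf V < m + 1 / real (Suc n)" using c0V by (auto simp: m_def)
    then obtain v where "v \<in> V" "v < m + 1 / real (Suc n)" using cInf_lessD by blast
    then show ?thesis by (auto simp: V_def)
  qed
  then obtain u where u: "\<And>n. u n \<in> Y" "\<And>n. nsqL (u n) = 1" "\<And>n. E (u n) < m + 1 / real (Suc n)" by metis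
  have "\<exists>g. H1_pair (u n) g" for n using YH[OF u(1)] by (simp add: H1_iff)
  then obtain g where g: "\<And>n. H1_pair (u n) (g n)" by metis
  have gb: "nsqL (g n) \<le> 4 * (1 + D)" for n
  proof -
    have "1 / 4 * nsqL (g n) - D \<le> E (u n)" using E_lower[OF g[of n]] u(2)[of n] by simp
    also have "\<dots> < m + 1 / real (Suc n)" by (rule u(3))
    also have "\<dots> \<le> 1" using m by (smt (verit) divide_le_eq_1 of_nat_Suc of_nat_0_le_iff)
    finally show ?thesis by simp
  qed
  have "cmod (u n p) \<le> sqrt (10 / (3 * 1) * 1 + 5 / 8 * 1 * (4 * (1 + D)))" for n p
  proof (rule real_le_rsqrt)
    have "abs2 (u n p) \<le> 10 / (3 * 1) * nsqL (u n) + 5 / 8 * 1 * nsqL (g n)"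
      by (rule H1_pair_global_bound[OF g]) simp
    also have "\<dots> \<le> 10 / (3 * 1) * 1 + 5 / 8 * 1 * (4 * (1 + D))"
      using gb[of n] u(2)[of n] by (intro add_mono mult_left_mono) auto
    finally show "abs2 (u n p) \<le> 10 / (3 * 1) * 1 + 5 / 8 * 1 * (4 * (1 + D))" .
  qed
  note ub = this
  \<comment> \<open>Level -m matches the shift in \<open>q\<close>: of the norm term, 1 - 5/6 = 1/6
    survives.\<close>
  obtain P C where P: "finite P" "C \<ge> 0"
    and K: "key_bound (- m) P C"
    using key_inequality[of "- m"] m by auto
  obtain r z where r: "strict_mono r" "\<And>p. p \<in> P \<Longrightarrow> (\<lambda>n. u (r n) p) \<longlonglongrightarrow> z p"
    using finite_pointwise_subsequence[OF P(1), of u, OF ub] by blast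
  define w where "w n = u (r n)" for n
  define w' where "w' n = g (r n)" for n
  have w: "w n \<in> Y" "nsqL (w n) = 1" "H1_pair (w n) (w' n)" for n
    using u(1,2) g by (auto simp: w_def w'_def)
  have Ew: "E (w n) \<le> m + 1 / real (Suc n)" for n
  proof -
    have "E (w n) \<le> m + 1 / real (Suc (r n))" unfolding w_def by (rule less_imp_le[OF u(3)])
    also have "1 / real (Suc (r n)) \<le> 1 / real (Suc n)" using seq_suble[OF r(1), of n] by (intro divide_left_mono) auto
    finally show ?thesis by simp
  qed
  \<comment> \<open>Error budget of one index: the excess energy from the parallelogram law and the
    distance of the point values from their limits.\<close>
  define t where "t n = 2 / real (Suc n) + 2 * C * (\<Sum>p\<in>P. abs2 (w n p - z p))" for n
  have t0: "t \<longlonglongrightarrow> 0"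
  proof -
    have "(\<lambda>n. 2 * (1 / real (Suc n)) + 2 * C * (\<Sum>p\<in>P. abs2 (w n p - z p))) \<longlonglongrightarrow> 2 * 0 + 2 * C * (\<Sum>p\<in>P. abs2 (z p - z p))"
      unfolding w_def using LIMSEQ_inverse_real_of_nat
      by (intro tendsto_intros r(2)) (simp_all add: inverse_eq_divide)
    then show ?thesis by (simp add: t_def[abs_def])
  qed
  have main: "3 / 8 * nsqL (w' n - w' k) + 1 / 6 * (- m) * nsqL (w n - w k) \<le> t n + t k" for n k
  proof -
    let ?h = "w n - w k" and ?h' = "w' n - w' k"
    have hp: "H1_pair ?h ?h'" by (rule H1_pair_diff[OF w(3) w(3)])
    have "Re (q ?h ?h) + Re (q (w n + w k) (w n + w k)) = 2 * Re (q (w n) (w n)) + 2 * Re (q (w k) (w k))"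
      using YH[OF w(1)] by (intro Q.parallelogram)
    moreover have "0 \<le> Re (q (w n + w k) (w n + w k))" by (intro q_pos Y_add w)
    moreover have "Re (q (w j) (w j)) \<le> 1 / real (Suc j)" for j using Ew[of j] w(2)[of j] by (simp add: Req)
    ultimately have "Re (q ?h ?h) \<le> 2 * (1 / real (Suc n)) + 2 * (1 / real (Suc k))" by (smt (verit))
    moreover have "Re (q ?h ?h) = nsqL ?h' - nsq \<mu> ?h - m * nsqL ?h"
      by (simp add: Req E_def Re_form_self[OF hp])
    moreover have "nsq \<mu> ?h \<le> 5 / 8 * nsqL ?h' + 5 / 6 * (- m) * nsqL ?h + C * (\<Sum>p\<in>P. abs2 (?h p))"
      using K hp unfolding key_bound_def by blast
    moreover have "C * (\<Sum>p\<in>P. abs2 (?h p)) \<le> 2 * C * (\<Sum>p\<in>P. abs2 (w n p - z p)) + 2 * C * (\<Sum>p\<in>P. abs2 (w k p - z p))"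
    proof -
      have "abs2 (?h p) \<le> 2 * abs2 (w n p - z p) + 2 * abs2 (w k p - z p)" for p
        using norm_add_square_le[of 1 "w n p - z p" "z p - w k p"] by (simp add: norm_minus_commute)
      then have "C * (\<Sum>p\<in>P. abs2 (?h p)) \<le> C * (\<Sum>p\<in>P. 2 * abs2 (w n p - z p) + 2 * abs2 (w k p - z p))"
        using P by (intro mult_left_mono sum_mono) auto
      then show ?thesis by (simp add: sum.distrib sum_distrib_left[symmetric] algebra_simps)
    qed
    ultimately show ?thesis by (simp add: t_def)
  qed
  have small: "\<exists>N. \<forall>n\<ge>N. \<forall>k\<ge>N. t n + t k < e" if "e > 0" for e :: real
  proof -
    obtain N where "\<And>n. n \<ge> N \<Longrightarrow> norm (t n - 0) < e / 2" using LIMSEQ_D[OF t0, of "e / 2"] \<open>e > 0\<close> by auto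
    then have "\<And>n. n \<ge> N \<Longrightarrow> t n < e / 2"
      by (metis abs_ge_self diff_zero le_less_trans real_norm_def)
    then show ?thesis by (intro exI[of _ N]) (smt (verit) field_sum_of_halves)
  qed
  have cw: "\<exists>N. \<forall>n\<ge>N. \<forall>k\<ge>N. nsqL (w n - w k) < e" if e: "e > 0" for e :: real
  proof -
    have "1 / 6 * (- m) * e > 0" using e m by (simp add: mult_neg_pos)
    from small[OF this] obtain N where N: "\<forall>n\<ge>N. \<forall>k\<ge>N. t n + t k < 1 / 6 * (- m) * e" by blast
    have "nsqL (w n - w k) < e" if "n \<ge> N" "k \<ge> N" for n k
    proof -
      have "1 / 6 * (- m) * nsqL (w n - w k) < 1 / 6 * (- m) * e"
        using main[of n k] N[rule_format, OF that] nsq_nonneg[of lborel "w' n - w' k"] by linarith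
      then show ?thesis using m by simp
    qed
    then show ?thesis by blast
  qed
  have cw': "\<exists>N. \<forall>n\<ge>N. \<forall>k\<ge>N. nsqL (w' n - w' k) < e" if e: "e > 0" for e :: real
  proof -
    have "3 / 8 * e > 0" using e by simp
    from small[OF this] obtain N where N: "\<forall>n\<ge>N. \<forall>k\<ge>N. t n + t k < 3 / 8 * e" by blast
    have "nsqL (w' n - w' k) < e" if "n \<ge> N" "k \<ge> N" for n k
    proof -
      have "0 \<le> 1 / 6 * (- m) * nsqL (w n - w k)" using m by (intro mult_nonneg_nonneg) auto
      then have "3 / 8 * nsqL (w' n - w' k) < 3 / 8 * e"
        using main[of n k] N[rule_format, OF that] by linarith
      then show ?thesis by simp
    qed
    then show ?thesis by blast
  qed
  obtain h h' where h: "H1_pair h h'" "(\<lambda>n. nsqL (w n - h)) \<longlonglongrightarrow> 0" "(\<lambda>n. nsqL (w' n - h')) \<longlonglongrightarrow> 0"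
    using H1_complete[OF w(3) cw cw'] by blast
  have hH: "h \<in> H1" using h(1) by (auto simp: H1_iff)
  have sq: "w n \<in> sqintL" "w' n \<in> sqintL" "h \<in> sqintL" "h' \<in> sqintL" for n
    using H1_pairD[OF w(3)] H1_pairD[OF h(1)] by auto
  have "(\<lambda>n. nsqL (w n)) \<longlonglongrightarrow> nsqL h" by (rule tendsto_nsq[OF sq(1,3) h(2)])
  then have h1: "nsqL h = 1" using w(2) by (simp add: LIMSEQ_const_iff)
  have hY: "h \<in> Y"
  proof -
    have "ipL h e = 0" if "e \<in> S" for e
    proof -
      have "(\<lambda>n. ipL (w n) e) \<longlonglongrightarrow> ipL h e"
        by (rule tendsto_ip_left[OF sq(1,3) H1_sqint[OF SH[OF that]] h(2)])
      moreover have "ipL (w n) e = 0" for n using w(1)[of n] that by (simp add: Y_def)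
      ultimately show ?thesis by (simp add: LIMSEQ_const_iff)
    qed
    then show ?thesis using hH by (simp add: Y_def)
  qed
  have "(\<lambda>n. nsq \<mu> (w n - h)) \<longlonglongrightarrow> 0"
  proof (rule tendsto_sandwich[of "\<lambda>_. 0"])
    show "(\<lambda>n. 3 / 4 * nsqL (w' n - h') + D * nsqL (w n - h)) \<longlonglongrightarrow> 0"
      using tendsto_add[OF tendsto_mult_left[OF h(3), of "3/4"] tendsto_mult_left[OF h(2), of D]] by simp
    show "\<forall>\<^sub>F n in sequentially. nsq \<mu> (w n - h) \<le> 3 / 4 * nsqL (w' n - h') + D * nsqL (w n - h)"
      using D(2)[OF H1_pair_diff[OF w(3) h(1)]] by simp
  qed auto
  then have "(\<lambda>n. nsq \<mu> (w n)) \<longlonglongrightarrow> nsq \<mu> h"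
    using D(2)[OF w(3)] D(2)[OF h(1)] by (intro tendsto_nsq) auto
  then have "(\<lambda>n. nsqL (w' n) - nsq \<mu> (w n)) \<longlonglongrightarrow> nsqL h' - nsq \<mu> h"
    by (intro tendsto_diff tendsto_nsq[OF sq(2,4) h(3)])
  then have limE: "(\<lambda>n. E (w n)) \<longlonglongrightarrow> E h"
    by (simp add: E_def Re_form_self[OF w(3)] Re_form_self[OF h(1)])
  have "E h \<le> m"
  proof (rule LIMSEQ_le[OF limE])
    have "(\<lambda>n. m + 1 / real (Suc n)) \<longlonglongrightarrow> m + 0"
      using LIMSEQ_inverse_real_of_nat by (intro tendsto_intros) (simp add: inverse_eq_divide)
    then show "(\<lambda>n. m + 1 / real (Suc n)) \<longlonglongrightarrow> m" by simp
    show "\<exists>N. \<forall>n\<ge>N. E (w n) \<le> m + 1 / real (Suc n)" using Ew by blast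
  qed
  then have qh: "Re (q h h) = 0" using q_pos[OF hY] h1 by (simp add: Req)
  have qhY: "q h v = 0" if v: "v \<in> Y" for v
    by (rule Q.minimizer_orthogonal[OF hH YH[OF v] qh]) (intro q_pos Y_add Y_scale hY v)
  \<comment> \<open>For an eigenfunction \<open>e\<close> both parts of \<open>q h e\<close> are
    multiples of the inner product of \<open>h\<close> and \<open>e\<close>, which is 0.\<close>
  have qhS: "q h e = 0" if e: "e \<in> S" for e
  proof -
    obtain k where k: "e \<in> eigenspace \<mu> k" using S(2)[OF e] by blast
    have he: "ipL h e = 0" using hY e by (simp add: Y_def)
    then have eh: "ipL e h = 0" using ip_cnj[of lborel h e] by simp
    have "form \<mu> e h = 0" using k hH eh by (simp add: eigenspace_iff)
    then have "form \<mu> h e = 0" using F.cnj_sym[OF SH[OF e] hH] by simp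
    then show ?thesis using he by (simp add: q_def)
  qed
  \<comment> \<open>An arbitrary \<open>v\<close> is split into its projection onto the span of
    \<open>S\<close> and a remainder in \<open>Y\<close>.\<close>
  have "q h v = 0" if v: "v \<in> H1" for v
  proof -
    define s where "s = (\<Sum>e\<in>S. (\<lambda>x. ipL v e * e x))"
    have sH: "s \<in> H1" unfolding s_def using SH by (intro F.X_sum F.X_scale)
    have "ipL s e = ipL v e" if e: "e \<in> S" for e
    proof -
      have "ipL s e = (\<Sum>e'\<in>S. ipL (\<lambda>x. ipL v e' * e' x) e)"
        unfolding s_def using SH e by (intro I.sum_left F.X_scale)
      also have "\<dots> = (\<Sum>e'\<in>S. if e = e' then ipL v e else 0)"
        using S(3)[OF _ e] by (intro sum.cong) (auto simp: ip_scale_left)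
      also have "\<dots> = ipL v e" using S(1) e by simp
      finally show ?thesis .
    qed
    then have "v - s \<in> Y" using v sH SH by (auto simp: Y_def F.X_diff I.diff_left)
    then have "q h (v - s) = 0" by (rule qhY)
    moreover have "q h s = 0"
    proof -
      have "q h s = (\<Sum>e\<in>S. q h (\<lambda>x. ipL v e * e x))"
        unfolding s_def using SH hH by (intro Q.sum_right F.X_scale)
      also have "\<dots> = 0" using qhS SH hH by (intro sum.neutral ballI) (simp add: Q.scale_right)
      finally show ?thesis .
    qed
    ultimately show ?thesis using v sH hH by (simp add: Q.diff_right)
  qed
  then have "h \<in> eigenspace \<mu> m" using hH by (simp add: eigenspace_iff q_def)
  then show ?thesis using ml h1 hY by (auto simp: Y_def)
qed

end

section \<open>Counting eigenvalues\<close>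

lemma eigenvalue_mult_ge:
  assumes "finite B" "B \<subseteq> eigenspace \<mu> l" "cfun.independent B"
  shows "of_nat (card B) \<le> eigenvalue_mult \<mu> l"
proof (cases "\<exists>B0. finite B0 \<and> eigenspace \<mu> l \<subseteq> cfun.span B0")
  case True
  then obtain B0 where B0: "finite B0" "eigenspace \<mu> l \<subseteq> cfun.span B0" by auto
  obtain B' where B': "B' \<subseteq> eigenspace \<mu> l" "cfun.independent B'" "eigenspace \<mu> l \<subseteq> cfun.span B'"
    "card B' = cfun.dim (eigenspace \<mu> l)"
    by (rule cfun.basis_exists)
  have "finite B'" using cfun.independent_span_bound[OF B0(1) B'(2)] B'(1) B0(2) by blast
  then have "card B \<le> card B'" using cfun.independent_span_bound[OF _ assms(3)] assms(2) B'(3) by blast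
  then show ?thesis using True B'(4) by (simp add: eigenvalue_mult_def)
next
  case False
  then show ?thesis by (simp only: eigenvalue_mult_def if_False) simp
qed

text \<open>A uniform bound on independent families rules out the infinite branch of
  \<open>eigenvalue_mult\<close>, and a basis realizes the dimension.\<close>

lemma eigenvalue_mult_witness:
  assumes bound: "\<And>B. finite B \<Longrightarrow> B \<subseteq> eigenspace \<mu> l \<Longrightarrow> cfun.independent B \<Longrightarrow> card B \<le> n"
  shows "\<exists>B. finite B \<and> B \<subseteq> eigenspace \<mu> l \<and> cfun.independent B \<and> eigenvalue_mult \<mu> l = of_nat (card B)"
proof -
  obtain B where B: "B \<subseteq> eigenspace \<mu> l" "cfun.independent B" "eigenspace \<mu> l \<subseteq> cfun.span B"
    "card B = cfun.dim (eigenspace \<mu> l)"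
    by (rule cfun.basis_exists)
  have fin: "finite B"
  proof (rule ccontr)
    assume "infinite B"
    then obtain T where T: "T \<subseteq> B" "finite T" "card T = Suc n" using infinite_arbitrarily_large by metis
    have "card T \<le> n" using T B cfun.independent_mono[OF B(2) T(1)] by (intro bound) auto
    then show False using T by simp
  qed
  then have "\<exists>B. finite B \<and> eigenspace \<mu> l \<subseteq> cfun.span B" using B(3) by blast
  then have "eigenvalue_mult \<mu> l = of_nat (card B)" using B(4) by (simp add: eigenvalue_mult_def)
  then show ?thesis using B fin by blast
qed

text \<open>Greedy selection from the left: the smallest point of \<open>F\<close> is taken,
  everything closer than \<open>s\<close> is dropped, and the rest fits into a window shorter by
  \<open>s\<close>. Closedness makes the infimum a point of \<open>F\<close>; each chosen point
  accounts for measure at most \<open>s\<close>.\<close>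

lemma separated_points:
  fixes F :: "real set"
  assumes "s > 0"
  shows "closed F \<Longrightarrow> F \<subseteq> {A..A + real n * s} \<Longrightarrow> \<exists>X\<subseteq>F. finite X \<and> (\<forall>x\<in>X. \<forall>y\<in>X. x \<noteq> y \<longrightarrow> s \<le> \<bar>x - y\<bar>)
    \<and> emeasure lborel F \<le> of_nat (card X) * ennreal s"
proof (induction n arbitrary: A F)
  case 0
  show ?case
  proof (cases "F = {}")
    case False
    then have "F = {A}" using 0 by auto
    then show ?thesis by (intro exI[of _ "{A}"]) auto
  qed (auto intro!: exI[of _ "{}"])
next
  case (Suc n)
  show ?case
  proof (cases "F = {}")
    case False
    define x where "x = Inf F"
    have bdd: "bdd_below F" using Suc.prems(2) by (meson bdd_below_Icc bdd_below_mono)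
    have xF: "x \<in> F" unfolding x_def by (rule closed_contains_Inf[OF False bdd Suc.prems(1)])
    have le: "x \<le> y" if "y \<in> F" for y unfolding x_def using that bdd by (rule cInf_lower)
    define F' where "F' = F \<inter> {x + s..}"
    have "closed F'" unfolding F'_def using Suc.prems(1) by (intro closed_Int) auto
    have "F' \<subseteq> {(A + s)..(A + s) + real n * s}"
    proof
      fix y assume "y \<in> F'"
      then have "y \<in> F" "x + s \<le> y" by (auto simp: F'_def)
      moreover from this have "y \<le> A + real (Suc n) * s" "A \<le> x" using Suc.prems(2) xF by auto
      ultimately show "y \<in> {(A + s)..(A + s) + real n * s}" by (simp add: algebra_simps)
    qed
    from Suc.IH[OF \<open>closed F'\<close> this] obtain X where X: "X \<subseteq> F'" "finite X" "\<forall>x\<in>X. \<forall>y\<in>X. x \<noteq> y \<longrightarrow> s \<le> \<bar>x - y\<bar>"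
      "emeasure lborel F' \<le> of_nat (card X) * ennreal s" by blast
    have far: "x + s \<le> y" if "y \<in> X" for y using X(1) that by (auto simp: F'_def)
    have "x \<notin> X" using far assms by force
    have "emeasure lborel F \<le> emeasure lborel ({x..x + s} \<union> F')"
      using le \<open>closed F'\<close> by (intro emeasure_mono) (auto simp: F'_def)
    also have "\<dots> \<le> emeasure lborel {x..x + s} + emeasure lborel F'"
      using \<open>closed F'\<close> by (intro emeasure_subadditive) auto
    also have "\<dots> \<le> ennreal s + of_nat (card X) * ennreal s"
      using X(4) assms by (intro add_mono) auto
    also have "\<dots> = of_nat (card (insert x X)) * ennreal s"
      using X(2) \<open>x \<notin> X\<close> by (simp add: distrib_right)
    finally have "emeasure lborel F \<le> of_nat (card (insert x X)) * ennreal s" .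
    moreover have "insert x X \<subseteq> F" using X(1) xF by (auto simp: F'_def)
    moreover have "\<forall>y\<in>insert x X. \<forall>z\<in>insert x X. y \<noteq> z \<longrightarrow> s \<le> \<bar>y - z\<bar>"
      using X(3) far by (smt (verit) insert_iff)
    ultimately show ?thesis using X(2) by (intro exI[of _ "insert x X"]) auto
  qed (auto intro!: exI[of _ "{}"])
qed

context vanishing_tails
begin

lemma sum_eigenvalue_mult_le:
  assumes l: "l > 0" and S: "finite S" "\<And>k. k \<in> S \<Longrightarrow> k \<le> - l"
  shows "(\<Sum>k\<in>S. eigenvalue_mult \<mu> k) \<le> 8 * counting_integral l"
proof -
  obtain P C where P: "finite P" "of_nat (card P) \<le> 8 * counting_integral l"
    and K: "key_bound l P C"
    using key_inequality[OF l] by blast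
  \<comment> \<open>Used first for a single eigenvalue, where it shows finite multiplicity, and then
    for all of \<open>S\<close> with bases realizing the multiplicities.\<close>
  have count: "(\<Sum>k\<in>S. card (B k)) \<le> card P"
    if "finite S" "\<And>k. k \<in> S \<Longrightarrow> k \<le> - l"
      "\<And>k. k \<in> S \<Longrightarrow> finite (B k) \<and> B k \<subseteq> eigenspace \<mu> k \<and> cfun.independent (B k)" for S B
    by (rule eigenfunctions_le_points[OF l P(1) K that])
  have "\<exists>B. finite B \<and> B \<subseteq> eigenspace \<mu> k \<and> cfun.independent B \<and> eigenvalue_mult \<mu> k = of_nat (card B)" if k: "k \<in> S" for k
  proof (rule eigenvalue_mult_witness)
    fix B assume "finite B" "B \<subseteq> eigenspace \<mu> k" "cfun.independent B"
    then show "card B \<le> card P" using count[of "{k}" "\<lambda>_. B"] S(2)[OF k] by simp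
  qed
  then obtain B where B: "\<And>k. k \<in> S \<Longrightarrow> finite (B k) \<and> B k \<subseteq> eigenspace \<mu> k \<and> cfun.independent (B k)
      \<and> eigenvalue_mult \<mu> k = of_nat (card (B k))" by metis
  have "(\<Sum>k\<in>S. eigenvalue_mult \<mu> k) = of_nat (\<Sum>k\<in>S. card (B k))" using B by simp
  also have "\<dots> \<le> of_nat (card P)" using count[OF S, of B] B by (intro of_nat_mono) auto
  also note P(2)
  finally show ?thesis .
qed

text \<open>As long as there are fewer eigenfunctions than vectors \<open>\<phi> x\<close>, a
  nontrivial combination is orthogonal to all of them and starts the next minimization. The clause
  \<open>f \<noteq> 0\<close> in \<open>neg\<close> encodes linear independence of the
  family.\<close>

lemma orthonormal_eigenfunctions_exist:
  fixes X :: "'i set" and \<phi> :: "'i \<Rightarrow> real \<Rightarrow> complex"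
  assumes l: "l > 0" and X: "finite X" "\<And>x. x \<in> X \<Longrightarrow> \<phi> x \<in> H1"
    and neg: "\<And>c f. \<exists>x\<in>X. c x \<noteq> 0 \<Longrightarrow> f = (\<Sum>x\<in>X. (\<lambda>t. c x * \<phi> x t)) \<Longrightarrow> f \<noteq> 0 \<and> Re (form \<mu> f f) \<le> - l * nsqL f"
  shows "n \<le> card X \<Longrightarrow> \<exists>S. finite S \<and> card S = n \<and> (\<forall>e\<in>S. \<exists>k\<le>- l. e \<in> eigenspace \<mu> k)
    \<and> orthonormal S"
proof (induction n)
  case 0
  then show ?case by (intro exI[of _ "{}"]) auto
next
  case (Suc n)
  obtain S where S: "finite S" "card S = n" "\<forall>e\<in>S. \<exists>k\<le>- l. e \<in> eigenspace \<mu> k"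
     "orthonormal S" using Suc by auto
  have SH: "e \<in> H1" if "e \<in> S" for e using S(3) that by (auto simp: eigenspace_iff)
  obtain c where c: "\<exists>x\<in>X. c x \<noteq> 0" "\<And>e. e \<in> S \<Longrightarrow> (\<Sum>x\<in>X. c x * ipL (\<phi> x) e) = 0"
    using underdetermined_system[OF S(1) X(1), of "\<lambda>x e. ipL (\<phi> x) e"] S(2) Suc.prems by auto
  define f where "f = (\<Sum>x\<in>X. (\<lambda>t. c x * \<phi> x t))"
  have fH: "f \<in> H1" unfolding f_def using X by (intro I.X_sum I.X_scale)
  have orth: "ipL f e = 0" if "e \<in> S" for e
  proof -
    have "ipL f e = (\<Sum>x\<in>X. ipL (\<lambda>t. c x * \<phi> x t) e)"
      unfolding f_def using X SH[OF that] by (intro I.sum_left I.X_scale)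
    then show ?thesis using c(2)[OF that] by (simp add: ip_scale_left)
  qed
  obtain e k where e: "e \<in> eigenspace \<mu> k" "k \<le> - l" "nsqL e = 1" "\<forall>e'\<in>S. ipL e e' = 0"
    using eigenfunction_exists[OF l S(1) _ _ fH _ orth, of] neg[OF c(1) f_def] S(3,4) by blast
  have "e \<notin> S" using e(3,4) ip_self[of lborel e] by auto
  moreover have "ipL e' e = 0" if "e' \<in> S" for e'
    using e(4) that ip_cnj[of lborel e e'] by simp
  ultimately show ?case using S e ip_self[of lborel e]
    by (intro exI[of _ "insert e S"]) auto
qed

text \<open>One half of the min-max principle. The orthonormal eigenfunctions are sorted by
  eigenvalue; each class is an independent subset of one eigenspace, hence no larger than the
  multiplicity.\<close>

lemma negative_subspace_dim_le:
  fixes X :: "'i set" and \<phi> :: "'i \<Rightarrow> real \<Rightarrow> complex"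
  assumes l: "l > 0" and X: "finite X" "\<And>x. x \<in> X \<Longrightarrow> \<phi> x \<in> H1"
    and neg: "\<And>c f. \<exists>x\<in>X. c x \<noteq> 0 \<Longrightarrow> f = (\<Sum>x\<in>X. (\<lambda>t. c x * \<phi> x t)) \<Longrightarrow> f \<noteq> 0 \<and> Re (form \<mu> f f) \<le> - l * nsqL f"
  shows "\<exists>T. finite T \<and> T \<subseteq> negative_eigenvalues \<mu> \<inter> {..- l} \<and> of_nat (card X) \<le> (\<Sum>k\<in>T. eigenvalue_mult \<mu> k)"
proof -
  have "\<exists>S. finite S \<and> card S = card X \<and> (\<forall>e\<in>S. \<exists>k\<le>- l. e \<in> eigenspace \<mu> k)
    \<and> orthonormal S"
    by (rule orthonormal_eigenfunctions_exist[OF l X _ order_refl]) (assumption, rule neg)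
  then obtain S where S: "finite S" "card S = card X" "\<forall>e\<in>S. \<exists>k\<le>- l. e \<in> eigenspace \<mu> k"
     "orthonormal S"
    by blast
  obtain \<kappa> where \<kappa>: "\<And>e. e \<in> S \<Longrightarrow> \<kappa> e \<le> - l \<and> e \<in> eigenspace \<mu> (\<kappa> e)" using S(3) by metis
  have nz: "e \<noteq> 0" if "e \<in> S" for e
  proof
    assume "e = 0"
    then have "ipL e e = 0" by (simp add: ip_def)
    then show False using S(4) that by auto
  qed
  have sub: "\<kappa> ` S \<subseteq> negative_eigenvalues \<mu> \<inter> {..- l}"
  proof safe
    fix e assume e: "e \<in> S"
    show "\<kappa> e \<le> - l" using \<kappa>[OF e] by simp
    then show "\<kappa> e \<in> negative_eigenvalues \<mu>"
      using \<kappa>[OF e] l nz[OF e] by (auto simp: negative_eigenvalues_def)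
  qed
  have "card X = (\<Sum>k\<in>\<kappa> ` S. card {e \<in> S. \<kappa> e = k})"
    using sum.image_gen[OF S(1), of "\<lambda>_. 1::nat" \<kappa>] S(2) by simp
  then have "of_nat (card X) = (\<Sum>k\<in>\<kappa> ` S. of_nat (card {e \<in> S. \<kappa> e = k}) :: ennreal)" by simp
  also have "\<dots> \<le> (\<Sum>k\<in>\<kappa> ` S. eigenvalue_mult \<mu> k)"
  proof (intro sum_mono eigenvalue_mult_ge)
    fix k
    show "finite {e \<in> S. \<kappa> e = k}" using S(1) by simp
    show "{e \<in> S. \<kappa> e = k} \<subseteq> eigenspace \<mu> k" using \<kappa> by auto
    show "cfun.independent {e \<in> S. \<kappa> e = k}"
    proof (rule orthonormal_independent)
      show "e \<in> H1" if "e \<in> {e \<in> S. \<kappa> e = k}" for e using \<kappa>[of e] that by (auto simp: eigenspace_iff)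
    qed (use S in auto)
  qed
  finally show ?thesis using S(1) sub by (intro exI[of _ "\<kappa> ` S"]) auto
qed

text \<open>A large value of \<open>otelbaev\<close> forces a window of fixed width to carry a fixed
  mass, which cannot happen far out. The width 2 / sqrt c gives 1/d^2 = c/4, strictly below
  \<open>c\<close>.\<close>

lemma otelbaev_level_set_bounded:
  assumes c: "c > 0"
  shows "\<exists>R>0. {x. c \<le> otelbaev \<mu> x} \<subseteq> {-R..R}"
proof -
  define d where "d = 2 / sqrt c"
  have d: "d > 0" "1 / d\<^sup>2 < c" using c by (auto simp: d_def power_divide)
  have "1 / d > 0" using d by simp
  then obtain R where R: "R > 0" "\<And>x. \<bar>x\<bar> \<ge> R \<Longrightarrow> measure \<mu> {x..x + d} < 1 / d"
    using tails by meson
  have "\<bar>x\<bar> \<le> R + d" if x: "c \<le> otelbaev \<mu> x" for x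
  proof (rule ccontr)
    assume "\<not> ?thesis"
    then have "\<bar>x - d / 2\<bar> \<ge> R" using d by linarith
    then have "measure \<mu> {x - d / 2..x - d / 2 + d} < 1 / d" by (rule R(2))
    moreover have "ennreal (1 / d) \<le> emeasure \<mu> {x - d / 2..x + d / 2}"
      using d x by (intro otelbaev_gt_imp) auto
    then have "1 / d \<le> measure \<mu> {x - d / 2..x + d / 2}" using radon_emeasure_Icc by simp
    ultimately show False by (simp add: field_simps)
  qed
  then have "{x. c \<le> otelbaev \<mu> x} \<subseteq> {-(R + d)..R + d}" by (fastforce simp: abs_le_iff)
  then show ?thesis using R(1) d by (intro exI[of _ "R + d"]) auto
qed

text \<open>The greedy points have spacing s = 1 / sqrt l, the full width of a tent, so the tents do
  not overlap; sqrt l times s is 1, which turns the number of points into a measure.\<close>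

lemma sum_eigenvalue_mult_ge:
  assumes l: "l > 0" and k: "k > 64"
  shows "\<exists>T. finite T \<and> T \<subseteq> negative_eigenvalues \<mu> \<inter> {..- l}
    \<and> ennreal (sqrt l) * emeasure lborel {x. k * l \<le> otelbaev \<mu> x} \<le> (\<Sum>j\<in>T. eigenvalue_mult \<mu> j)"
proof -
  define F where "F = {x. k * l \<le> otelbaev \<mu> x}"
  have "F = - {x. otelbaev \<mu> x < k * l}" by (auto simp: F_def)
  then have cF: "closed F" using otelbaev_less_open by (simp only: closed_Compl)
  define s where "s = 1 / sqrt l"
  define w where "w = s / 2"
  have s: "s > 0" "w > 0" using l by (auto simp: s_def w_def)
  obtain R where R: "F \<subseteq> {-R..R}"
    using otelbaev_level_set_bounded[of "k * l"] k l by (auto simp: F_def)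
  obtain n :: nat where "2 * R / s \<le> real n" using real_arch_simple by blast
  then have "2 * R \<le> real n * s" using s by (simp add: field_simps)
  then have "F \<subseteq> {-R..-R + real n * s}" using R by auto
  from separated_points[OF s(1) cF this]
  obtain X where X: "X \<subseteq> F" "finite X" "\<forall>x\<in>X. \<forall>y\<in>X. x \<noteq> y \<longrightarrow> s \<le> \<bar>x - y\<bar>"
    "emeasure lborel F \<le> of_nat (card X) * ennreal s" by blast
  let ?\<phi> = "\<lambda>x t. complex_of_real (tent w x t)" and ?\<phi>' = "\<lambda>x t. complex_of_real (tent' w x t)"
  note pair = tent_H1_pair[OF s(2)]
  have sq\<mu>: "?\<phi> x \<in> sqint \<mu>" for x
    using form_bounded pair by blast
  \<comment> \<open>Width w/4 gives 1/d^2 = 64 l, whence the threshold on \<open>k\<close>; it is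
    strict because \<open>otelbaev_gt_imp\<close> wants 1/d^2 strictly below
    \<open>otelbaev\<close>.\<close>
  have heavy: "4 / w \<le> measure \<mu> {x - w / 8..x + w / 8}" if "x \<in> X" for x
  proof -
    have w2: "w\<^sup>2 = 1 / (4 * l)" using l by (simp add: w_def s_def power_divide)
    have "1 / (w / 4)\<^sup>2 = 64 * l" by (simp add: power_divide w2)
    also have "\<dots> < k * l" using k l by simp
    also have "\<dots> \<le> otelbaev \<mu> x" using X(1) that by (auto simp: F_def)
    finally have "ennreal (1 / (w / 4)) \<le> emeasure \<mu> {x - w / 4 / 2..x + w / 4 / 2}"
      using s by (intro otelbaev_gt_imp) auto
    then show ?thesis using radon_emeasure_Icc by simp
  qed
  have disj: "tent w x t * tent w y t = 0" "tent' w x t * tent' w y t = 0" if "x \<in> X" "y \<in> X" "x \<noteq> y" for x y t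
  proof -
    have "2 * w \<le> \<bar>x - y\<bar>" using X(3) that by (simp add: w_def)
    then have "w \<le> \<bar>t - x\<bar> \<or> w \<le> \<bar>t - y\<bar>" by linarith
    then show "tent w x t * tent w y t = 0" using tent_outside[OF s(2)] by auto
    show "tent' w x t * tent' w y t = 0"
      using \<open>w \<le> \<bar>t - x\<bar> \<or> w \<le> \<bar>t - y\<bar>\<close> by (auto simp: tent'_def)
  qed
  have orth: "ip M (?\<phi> x) (?\<phi> y) = 0" "ip M (?\<phi>' x) (?\<phi>' y) = 0" if "x \<in> X" "y \<in> X" "x \<noteq> y" for x y M
    unfolding ip_def complex_cnj_complex_of_real of_real_mult[symmetric] disj[OF that] by simp_all
  have neg: "f \<noteq> 0 \<and> Re (form \<mu> f f) \<le> - l * nsqL f"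
    if c: "\<exists>x\<in>X. c x \<noteq> 0" and f: "f = (\<Sum>x\<in>X. (\<lambda>t. c x * ?\<phi> x t))" for c f
  proof
    obtain x where x: "x \<in> X" "c x \<noteq> 0" using c by auto
    have "f x = (\<Sum>y\<in>X. if x = y then c x else 0)"
      unfolding f sum_fun_apply
    proof (rule sum.cong)
      fix y assume y: "y \<in> X"
      have "tent w x x = 1" by (simp add: tent_def)
      then show "c y * ?\<phi> y x = (if x = y then c x else 0)" using disj(1)[OF x(1) y, of x] by auto
    qed simp
    then have "f x = c x" using x X(2) by simp
    then show "f \<noteq> 0" using x by auto
    define g where "g = (\<Sum>x\<in>X. (\<lambda>t. c x * ?\<phi>' x t))"
    have fg: "H1_pair f g" unfolding f g_def by (intro H1_pair_sum H1_pair_scale pair)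
    have "Re (form \<mu> f f) = nsqL g - nsq \<mu> f" by (rule Re_form_self[OF fg])
    also have "\<dots> = (\<Sum>x\<in>X. abs2 (c x) * (nsqL (?\<phi>' x) - nsq \<mu> (?\<phi> x)))"
      unfolding f g_def using X(2) orth sq\<mu> tent'_sqint(1)[OF s(2)]
      by (simp add: nsq_sum_orthogonal right_diff_distrib sum_subtractf)
    also have "\<dots> \<le> (\<Sum>x\<in>X. abs2 (c x) * (- l * nsqL (?\<phi> x)))"
    proof (intro sum_mono mult_left_mono)
      \<comment> \<open>In units of 1/w: the gradient costs at most 2, the term with
        \<open>l\<close> at most 1/2, and \<mu> returns at least 3.\<close>
      fix x assume x: "x \<in> X"
      have "l * nsqL (?\<phi> x) \<le> l * (2 * w)" using l nsq_tent_le[OF s(2)] by (intro mult_left_mono) auto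
      also have "\<dots> = 1 / 2 / w"
        using l by (simp add: w_def s_def field_simps)
      finally have "l * nsqL (?\<phi> x) \<le> 1 / 2 / w" .
      moreover have "nsqL (?\<phi>' x) \<le> 2 / w" by (rule tent'_sqint(2)[OF s(2)])
      moreover have "3 / w \<le> nsq \<mu> (?\<phi> x)" by (rule nsq_tent_ge[OF s(2) heavy[OF x] sq\<mu>])
      moreover have "1 / 2 / w + 2 / w \<le> 3 / w" using s(2) by (simp add: field_simps)
      ultimately show "nsqL (?\<phi>' x) - nsq \<mu> (?\<phi> x) \<le> - l * nsqL (?\<phi> x)" by linarith
    qed simp
    also have "\<dots> = - l * nsqL f"
      unfolding f using X(2) orth tent_sqint[OF s(2)]
      by (simp add: nsq_sum_orthogonal sum_distrib_left mult.left_commute flip: sum_negf)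
    finally show "Re (form \<mu> f f) \<le> - l * nsqL f" .
  qed
  have \<phi>H: "?\<phi> x \<in> H1" for x using pair by (auto simp: H1_iff)
  have "\<exists>T. finite T \<and> T \<subseteq> negative_eigenvalues \<mu> \<inter> {..- l} \<and> of_nat (card X) \<le> (\<Sum>k\<in>T. eigenvalue_mult \<mu> k)"
    by (rule negative_subspace_dim_le[OF l X(2), of ?\<phi>]) (rule \<phi>H, rule neg)
  then obtain T where T: "finite T" "T \<subseteq> negative_eigenvalues \<mu> \<inter> {..- l}"
      "of_nat (card X) \<le> (\<Sum>k\<in>T. eigenvalue_mult \<mu> k)"
    by blast
  have "ennreal (sqrt l) * emeasure lborel F \<le> ennreal (sqrt l) * (of_nat (card X) * ennreal s)"
    by (intro mult_left_mono X) simp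
  also have "\<dots> = of_nat (card X) * (ennreal (sqrt l) * ennreal s)" by (simp add: ac_simps)
  also have "ennreal (sqrt l) * ennreal s = 1" using l by (simp add: s_def flip: ennreal_mult)
  finally show ?thesis using T by (auto simp: F_def intro: order_trans)
qed

end

section \<open>Eigenvalue moments\<close>

text \<open>The layer-cake weight that turns counts into moments. The point 0 can be left out since
  \<open>0 powr a = 0\<close>.\<close>

lemma nn_integral_powr_density:
  fixes y g :: real
  assumes y: "y \<ge> 0" and g: "g > 0"
  shows "(\<integral>\<^sup>+l. ennreal (g * l powr (g - 1)) * indicator {0<..y} l \<partial>lborel) = ennreal (y powr g)"
proof -
  have "((\<lambda>l. l powr (g - 1)) has_integral (y powr (g - 1 + 1) / (g - 1 + 1))) {0..y}"
    using y g by (intro has_integral_powr_from_0) auto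
  then have "((\<lambda>l. g * l powr (g - 1)) has_integral (g * (y powr g / g))) {0..y}"
    by (intro has_integral_mult_right) simp
  then have "((\<lambda>l. g * l powr (g - 1)) has_integral (y powr g)) {0..y}" using g by simp
  then have "((\<lambda>l. if l \<in> {0..y} then g * l powr (g - 1) else 0) has_integral (y powr g)) UNIV"
    by (simp only: has_integral_restrict_UNIV)
  then have "(\<integral>\<^sup>+l. ennreal (if l \<in> {0..y} then g * l powr (g - 1) else 0) \<partial>lborel) = ennreal (y powr g)"
    using g by (intro nn_integral_has_integral_lborel) auto
  moreover have "ennreal (if l \<in> {0..y} then g * l powr (g - 1) else 0) = ennreal (g * l powr (g - 1)) * indicator {0<..y} l" for l
    by (auto simp: indicator_def)
  ultimately show ?thesis by simp
qed

context vanishing_tails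
begin

text \<open>Layer cake for each eigenvalue, the upper count at every level \<open>l\<close>, then
  Tonelli; the infinite sum is controlled by its finite partial sums.\<close>

lemma eigenvalue_moment_le:
  assumes \<gamma>: "\<gamma> > 0"
  shows "eigenvalue_moment \<mu> \<gamma> \<le> ennreal (2 powr (4 * \<gamma> + 3)) * (\<integral>\<^sup>+x. ennreal (otelbaev \<mu> x powr (1 / 2 + \<gamma>)) \<partial>lborel)"
  unfolding eigenvalue_moment_def
proof (rule infsum_le_finite_sums)
  note q0 = otelbaev_nonneg
  let ?h = "\<lambda>l. ennreal (\<gamma> * l powr (\<gamma> - 1))"
  let ?t = "\<lambda>k l. eigenvalue_mult \<mu> k * (?h l * indicator {0<..\<bar>k\<bar>} l)"
  let ?D = "\<lambda>l x. 8 * (?h l * indicator {0<..} l * counting_density l x)"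
  fix S assume S: "finite S" "S \<subseteq> negative_eigenvalues \<mu>"
  have neg: "k < 0" if "k \<in> S" for k using S(2) that by (auto simp: negative_eigenvalues_def)
  have "(\<Sum>k\<in>S. eigenvalue_mult \<mu> k * ennreal (\<bar>k\<bar> powr \<gamma>))
      = (\<Sum>k\<in>S. \<integral>\<^sup>+l. ?t k l \<partial>lborel)"
    using \<gamma> by (intro sum.cong) (simp_all add: nn_integral_cmult nn_integral_powr_density)
  also have "\<dots> = (\<integral>\<^sup>+l. (\<Sum>k\<in>S. ?t k l) \<partial>lborel)"
    by (rule nn_integral_sum[symmetric]) measurable
  also have "\<dots> \<le> (\<integral>\<^sup>+l. (\<integral>\<^sup>+x. ?D l x \<partial>lborel) \<partial>lborel)"
  proof (rule nn_integral_mono)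
    fix l :: real
    show "(\<Sum>k\<in>S. ?t k l) \<le> (\<integral>\<^sup>+x. ?D l x \<partial>lborel)"
    proof (cases "l > 0")
      case True
      have "(\<Sum>k\<in>S. ?t k l)
          = (\<Sum>k\<in>S. if k \<in> {k \<in> S. k \<le> - l} then ?h l * eigenvalue_mult \<mu> k else 0)"
      proof (rule sum.cong)
        fix k assume "k \<in> S"
        then have "\<bar>k\<bar> = - k" using neg[of k] by simp
        then show "?t k l = (if k \<in> {k \<in> S. k \<le> - l} then ?h l * eigenvalue_mult \<mu> k else 0)"
          using True \<open>k \<in> S\<close> by (auto simp: indicator_def mult.commute)
      qed simp
      also have "\<dots> = ?h l * (\<Sum>k\<in>{k \<in> S. k \<le> - l}. eigenvalue_mult \<mu> k)"
        using S(1) by (simp add: sum.If_cases sum_distrib_left Int_def)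
      also have "\<dots> \<le> ?h l * (8 * counting_integral l)"
        using S(1) by (intro mult_left_mono sum_eigenvalue_mult_le[OF True]) auto
      also have "\<dots> = (\<integral>\<^sup>+x. ?D l x \<partial>lborel)"
        using True counting_density_measurable[of l] by (simp add: nn_integral_cmult mult.left_commute)
      finally show ?thesis .
    qed simp
  qed
  also have "\<dots> = (\<integral>\<^sup>+x. (\<integral>\<^sup>+l. ?D l x \<partial>lborel) \<partial>lborel)"
  proof (rule lborel_pair.Fubini')
    have "(\<lambda>(l, x). 8 * (?h l * indicator {0<..} l * (ennreal (sqrt (otelbaev \<mu> x)) * indicator {(l, x). l / 16 \<le> otelbaev \<mu> x} (l, x))))
        \<in> borel_measurable (lborel \<Otimes>\<^sub>M lborel)"
      by measurable
    moreover have "(\<lambda>(l, x). ?D l x) = (\<lambda>(l, x). 8 * (?h l * indicator {0<..} l * (ennreal (sqrt (otelbaev \<mu> x)) * indicator {(l, x). l / 16 \<le> otelbaev \<mu> x} (l, x))))"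
      by (auto simp: fun_eq_iff counting_density_def indicator_def)
    ultimately show "(\<lambda>(x, l). ?D l x) \<in> borel_measurable (lborel \<Otimes>\<^sub>M lborel)"
      by (subst measurable_pair_swap_iff) simp
  qed
  also have "\<dots> = (\<integral>\<^sup>+x. ennreal (2 powr (4 * \<gamma> + 3)) * ennreal (otelbaev \<mu> x powr (1 / 2 + \<gamma>)) \<partial>lborel)"
  proof (rule nn_integral_cong)
    fix x
    let ?q = "otelbaev \<mu> x"
    \<comment> \<open>As a condition on \<open>l\<close>, the cutoff reads l \<le> 16 q. This
      produces 16^\<gamma> and, with the 8, the constant 2^(4 \<gamma> + 3).\<close>
    have "(\<integral>\<^sup>+l. ?D l x \<partial>lborel)
       = (\<integral>\<^sup>+l. (8 * ennreal (sqrt ?q)) * (?h l * indicator {0<..16 * ?q} l) \<partial>lborel)"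
      by (intro nn_integral_cong) (auto simp: counting_density_def indicator_def ac_simps)
    also have "\<dots> = (8 * ennreal (sqrt ?q)) * ennreal ((16 * ?q) powr \<gamma>)"
      using q0[of x] \<gamma> by (simp add: nn_integral_cmult nn_integral_powr_density)
    also have "\<dots> = ennreal (8 * sqrt ?q * (16 * ?q) powr \<gamma>)"
      using q0[of x] by (simp add: ennreal_mult)
    also have "8 * sqrt ?q * (16 * ?q) powr \<gamma> = 2 powr (4 * \<gamma> + 3) * ?q powr (1 / 2 + \<gamma>)"
    proof -
      have "(16::real) powr \<gamma> = 2 powr (4 * \<gamma>)"
        using powr_powr[of 2 4 \<gamma>] by simp
      then show ?thesis using q0[of x] by (simp add: powr_mult powr_add powr_half_sqrt)
    qed
    finally show "(\<integral>\<^sup>+l. ?D l x \<partial>lborel) = ennreal (2 powr (4 * \<gamma> + 3)) * ennreal (?q powr (1 / 2 + \<gamma>))"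
      by (simp add: ennreal_mult)
  qed
  also have "\<dots> = ennreal (2 powr (4 * \<gamma> + 3)) * (\<integral>\<^sup>+x. ennreal (otelbaev \<mu> x powr (1 / 2 + \<gamma>)) \<partial>lborel)"
    by (rule nn_integral_cmult) measurable
  finally show "(\<Sum>k\<in>S. eigenvalue_mult \<mu> k * ennreal (\<bar>k\<bar> powr \<gamma>)) \<le> \<dots>" .
qed (rule nonneg_summable_on_complete, simp)

text \<open>One eigenvector per eigenvalue already obeys the bound by the number of cut points. The
  lower bound for moments thereby gets one finite index set for all levels above a cutoff.\<close>

lemma finite_eigenvalues_below:
  assumes l: "l > 0"
  shows "finite (negative_eigenvalues \<mu> \<inter> {..- l})"
proof -
  obtain P C where P: "finite P"
    and K: "key_bound l P C"
    using key_inequality[OF l] by blast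
  have "\<exists>u. u \<in> eigenspace \<mu> k \<and> u \<noteq> 0" if "k \<in> negative_eigenvalues \<mu>" for k
    using that by (auto simp: negative_eigenvalues_def)
  then obtain u where u: "\<And>k. k \<in> negative_eigenvalues \<mu> \<Longrightarrow> u k \<in> eigenspace \<mu> k \<and> u k \<noteq> 0" by metis
  have "card S \<le> card P" if S: "finite S" "S \<subseteq> negative_eigenvalues \<mu> \<inter> {..- l}" for S
  proof -
    have "(\<Sum>k\<in>S. card {u k}) \<le> card P"
    proof (rule eigenfunctions_le_points[OF l P K S(1)])
      fix k assume "k \<in> S"
      then have k: "k \<in> negative_eigenvalues \<mu>" "k \<le> - l" using S(2) by auto
      then show "k \<le> - l" by simp
      have "cfun.independent {u k}" using u[OF k(1)] cfun.dependent_single by blast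
      then show "finite {u k} \<and> {u k} \<subseteq> eigenspace \<mu> k \<and> cfun.independent {u k}" using u[OF k(1)] by simp
    qed
    then show ?thesis by simp
  qed
  then show ?thesis by (metis infinite_arbitrarily_large not_less_eq_eq order_refl)
qed

text \<open>Layer cake in the opposite direction. The finite set of eigenvalues in the lower count
  varies with \<open>l\<close>; restricting to l > 1/(n + 1) places all of them in one finite set,
  and monotone convergence removes the restriction.\<close>

lemma eigenvalue_moment_ge:
  assumes \<gamma>: "\<gamma> > 0" and c: "c > 8"
  shows "ennreal (\<gamma> / (\<gamma> + 1 / 2) * (1 / c) powr (1 + 2 * \<gamma>)) * (\<integral>\<^sup>+x. ennreal (otelbaev \<mu> x powr (1 / 2 + \<gamma>)) \<partial>lborel)
    \<le> eigenvalue_moment \<mu> \<gamma>"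
proof -
  note q0 = otelbaev_nonneg
  have "8\<^sup>2 < c\<^sup>2" using c by (intro power_strict_mono) auto
  then have c2: "c\<^sup>2 > 64" by simp
  let ?h = "\<lambda>l. ennreal (\<gamma> * l powr (\<gamma> - 1))"
  let ?t = "\<lambda>k l. eigenvalue_mult \<mu> k * (?h l * indicator {0<..\<bar>k\<bar>} l)"
  let ?I = "\<lambda>l x. (indicator {(l, x). c\<^sup>2 * l \<le> otelbaev \<mu> x} (l, x) :: ennreal)"
  let ?H = "\<lambda>l x. ?h l * (indicator {0<..} l * ennreal (sqrt l)) * ?I l x"
  have Hm: "(\<lambda>(l, x). ?H l x) \<in> borel_measurable (lborel \<Otimes>\<^sub>M lborel)" by measurable
  define G where "G l = (\<integral>\<^sup>+x. ?H l x \<partial>lborel)" for l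
  have Gm [measurable]: "G \<in> borel_measurable borel"
    unfolding G_def[abs_def] using lborel.borel_measurable_nn_integral[OF Hm] by simp
  let ?G = "\<lambda>n l. G l * indicator {1 / real (Suc n)<..} l"
  \<comment> \<open>The weight times sqrt l, integrated up to q/c^2, gives the power \<gamma> + 1/2
    and the factor \<gamma> / (\<gamma> + 1/2); from (1/c^2)^(\<gamma> + 1/2) comes the exponent 1 +
    2 \<gamma> of 1/c.\<close>
  have inner: "(\<integral>\<^sup>+l. ?H l x \<partial>lborel) = ennreal (\<gamma> / (\<gamma> + 1 / 2) * (1 / c) powr (1 + 2 * \<gamma>)) * ennreal (otelbaev \<mu> x powr (1 / 2 + \<gamma>))" for x
  proof -
    let ?q = "otelbaev \<mu> x"
    have "?H l x = ennreal (\<gamma> / (\<gamma> + 1 / 2)) * (ennreal ((\<gamma> + 1 / 2) * l powr (\<gamma> + 1 / 2 - 1)) * indicator {0<..?q / c\<^sup>2} l)" for l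
    proof (cases "0 < l \<and> l \<le> ?q / c\<^sup>2")
      case True
      then have "c\<^sup>2 * l \<le> ?q" using c by (simp add: field_simps)
      have "l powr (\<gamma> - 1) * sqrt l = l powr (\<gamma> + 1 / 2 - 1)"
        using True by (simp add: powr_half_sqrt[symmetric] flip: powr_add)
      then have "\<gamma> * l powr (\<gamma> - 1) * sqrt l = \<gamma> / (\<gamma> + 1 / 2) * ((\<gamma> + 1 / 2) * l powr (\<gamma> + 1 / 2 - 1))"
        using \<gamma> by (simp add: mult.assoc)
      then have "ennreal (\<gamma> * l powr (\<gamma> - 1)) * ennreal (sqrt l) = ennreal (\<gamma> / (\<gamma> + 1 / 2)) * ennreal ((\<gamma> + 1 / 2) * l powr (\<gamma> + 1 / 2 - 1))"
        using \<gamma> True by (simp only: ennreal_mult[symmetric] mult_nonneg_nonneg powr_ge_zero real_sqrt_ge_zero less_imp_le divide_nonneg_pos)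
      then show ?thesis using True \<open>c\<^sup>2 * l \<le> ?q\<close> by simp
    next
      case False
      then have "l \<le> 0 \<or> \<not> c\<^sup>2 * l \<le> ?q" using c by (auto simp: field_simps)
      then show ?thesis using False by auto
    qed
    then have "(\<integral>\<^sup>+l. ?H l x \<partial>lborel) = ennreal (\<gamma> / (\<gamma> + 1 / 2)) * (\<integral>\<^sup>+l. ennreal ((\<gamma> + 1 / 2) * l powr (\<gamma> + 1 / 2 - 1)) * indicator {0<..?q / c\<^sup>2} l \<partial>lborel)"
      by (simp only:) (rule nn_integral_cmult; measurable)
    also have "\<dots> = ennreal (\<gamma> / (\<gamma> + 1 / 2)) * ennreal ((?q / c\<^sup>2) powr (\<gamma> + 1 / 2))"
      using q0[of x] \<gamma> by (subst nn_integral_powr_density) auto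
    also have "(?q / c\<^sup>2) powr (\<gamma> + 1 / 2) = (1 / c) powr (1 + 2 * \<gamma>) * ?q powr (1 / 2 + \<gamma>)"
    proof -
      have "(?q / c\<^sup>2) powr (\<gamma> + 1 / 2) = (1 / c\<^sup>2 * ?q) powr (\<gamma> + 1 / 2)" by simp
      also have "\<dots> = (1 / c\<^sup>2) powr (\<gamma> + 1 / 2) * ?q powr (\<gamma> + 1 / 2)"
        by (rule powr_mult)
      also have "1 / c\<^sup>2 = (1 / c) powr 2" using c by (simp add: power_divide)
      also have "((1 / c) powr 2) powr (\<gamma> + 1 / 2) = (1 / c) powr (1 + 2 * \<gamma>)"
        by (simp add: powr_powr algebra_simps)
      finally show ?thesis by (simp add: add.commute)
    qed
    also have "ennreal (\<gamma> / (\<gamma> + 1 / 2)) * ennreal ((1 / c) powr (1 + 2 * \<gamma>) * ?q powr (1 / 2 + \<gamma>))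
        = ennreal (\<gamma> / (\<gamma> + 1 / 2) * (1 / c) powr (1 + 2 * \<gamma>)) * ennreal (?q powr (1 / 2 + \<gamma>))"
    proof -
      have "ennreal A * ennreal (B * C) = ennreal (A * B) * ennreal C" if "A \<ge> 0" "B \<ge> 0" "C \<ge> 0" for A B C
        using that by (simp add: ennreal_mult mult.assoc)
      then show ?thesis using \<gamma> by (metis powr_ge_zero divide_nonneg_pos less_imp_le add_pos_pos half_gt_zero zero_less_one)
    qed
    finally show ?thesis .
  qed
  have "ennreal (\<gamma> / (\<gamma> + 1 / 2) * (1 / c) powr (1 + 2 * \<gamma>)) * (\<integral>\<^sup>+x. ennreal (otelbaev \<mu> x powr (1 / 2 + \<gamma>)) \<partial>lborel)
     = (\<integral>\<^sup>+x. (\<integral>\<^sup>+l. ?H l x \<partial>lborel) \<partial>lborel)"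
    unfolding inner by (rule nn_integral_cmult[symmetric]) measurable
  also have "\<dots> = (\<integral>\<^sup>+l. G l \<partial>lborel)"
    unfolding G_def by (rule lborel_pair.Fubini'[symmetric]) (use Hm in \<open>subst measurable_pair_swap_iff, simp\<close>)
  also have "\<dots> = (\<integral>\<^sup>+l. (SUP n. ?G n l) \<partial>lborel)"
  proof (rule nn_integral_cong)
    fix l :: real
    show "G l = (SUP n. ?G n l)"
    proof (rule antisym)
      show "(SUP n. ?G n l) \<le> G l"
        by (rule SUP_least) (auto simp: indicator_def)
      show "G l \<le> (SUP n. ?G n l)"
      proof (cases "l > 0")
        case True
        then obtain n where "inverse (real (Suc n)) < l" using reals_Archimedean by blast
        then have "G l = ?G n l" by (simp add: inverse_eq_divide)
        also have "\<dots> \<le> (SUP n. ?G n l)" by (rule SUP_upper) simp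
        finally show ?thesis .
      qed (simp add: G_def)
    qed
  qed
  also have "\<dots> = (SUP n. \<integral>\<^sup>+l. ?G n l \<partial>lborel)"
  proof (rule nn_integral_monotone_convergence_SUP)
    show "incseq ?G"
    proof (intro incseq_SucI le_funI mult_left_mono)
      fix n l
      have "1 / real (Suc (Suc n)) \<le> 1 / real (Suc n)" by (simp add: field_simps)
      then show "indicator {1 / real (Suc n)<..} l \<le> (indicator {1 / real (Suc (Suc n))<..} l :: ennreal)"
        by (auto simp: indicator_def simp del: of_nat_Suc)
    qed simp
  qed measurable
  also have "\<dots> \<le> eigenvalue_moment \<mu> \<gamma>"
  proof (rule SUP_least)
    fix n
    define e where "e = 1 / real (Suc n)"
    have e: "e > 0" by (simp add: e_def)
    define S where "S = negative_eigenvalues \<mu> \<inter> {..- e}"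
    have S: "finite S" unfolding S_def by (rule finite_eigenvalues_below[OF e])
    have "(\<integral>\<^sup>+l. G l * indicator {e<..} l \<partial>lborel) \<le> (\<integral>\<^sup>+l. (\<Sum>k\<in>S. ?t k l) \<partial>lborel)"
    proof (rule nn_integral_mono)
      fix l
      show "G l * indicator {e<..} l \<le> (\<Sum>k\<in>S. ?t k l)"
      proof (cases "l > e")
        case True
        then have l: "l > 0" using e by simp
        obtain T where T: "finite T" "T \<subseteq> negative_eigenvalues \<mu> \<inter> {..- l}"
          "ennreal (sqrt l) * emeasure lborel {x. c\<^sup>2 * l \<le> otelbaev \<mu> x} \<le> (\<Sum>j\<in>T. eigenvalue_mult \<mu> j)"
          using sum_eigenvalue_mult_ge[OF l c2] by blast
        have "G l = (\<integral>\<^sup>+x. (?h l * ennreal (sqrt l)) * indicator {x. c\<^sup>2 * l \<le> otelbaev \<mu> x} x \<partial>lborel)"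
          unfolding G_def using l by (intro nn_integral_cong) (auto simp: indicator_def)
        also have "\<dots> = ?h l * (ennreal (sqrt l) * emeasure lborel {x. c\<^sup>2 * l \<le> otelbaev \<mu> x})"
          by (subst nn_integral_cmult_indicator) (auto simp: mult.assoc)
        also have "\<dots> \<le> ?h l * (\<Sum>j\<in>T. eigenvalue_mult \<mu> j)" by (intro mult_left_mono T) simp
        also have "\<dots> = (\<Sum>k\<in>T. ?t k l)"
          unfolding sum_distrib_left using T(2) l by (intro sum.cong) (auto simp: indicator_def mult.commute)
        also have "\<dots> \<le> (\<Sum>k\<in>S. ?t k l)"
          using T(2) True S by (intro sum_mono2) (auto simp: S_def)
        finally show ?thesis using True by simp
      qed simp
    qed
    also have "\<dots> = (\<Sum>k\<in>S. \<integral>\<^sup>+l. ?t k l \<partial>lborel)"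
      by (rule nn_integral_sum) measurable
    also have "\<dots> = (\<Sum>k\<in>S. eigenvalue_mult \<mu> k * ennreal (\<bar>k\<bar> powr \<gamma>))"
      using \<gamma> by (intro sum.cong) (simp_all add: nn_integral_cmult nn_integral_powr_density)
    also have "\<dots> \<le> eigenvalue_moment \<mu> \<gamma>"
      unfolding eigenvalue_moment_def infsum_finite[OF S, symmetric]
      by (rule infsum_mono_neutral) (auto simp: S_def intro: nonneg_summable_on_complete)
    finally show "(\<integral>\<^sup>+l. G l * indicator {1 / real (Suc n)<..} l \<partial>lborel) \<le> eigenvalue_moment \<mu> \<gamma>"
      by (simp only: e_def)
  qed
  finally show ?thesis .
qed

end

theorem theorem4p17:
  fixes \<mu> :: "real measure" and \<gamma> :: real
  assumes "radon_measure \<mu>"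
    and "\<exists>a>0. ((\<lambda>x. emeasure \<mu> {x - a<..<x + a}) \<longlongrightarrow> 0) at_top
            \<and> ((\<lambda>x. emeasure \<mu> {x - a<..<x + a}) \<longlongrightarrow> 0) at_bot"
    and "\<gamma> > 0"
  shows "ennreal (\<gamma> / (\<gamma> + 1 / 2) * (1 / (2 * pi\<^sup>2 + 3 / 2)) powr (1 + 2 * \<gamma>))
           * (\<integral>\<^sup>+x. ennreal (\<bar>otelbaev \<mu> x\<bar> powr (1 / 2 + \<gamma>)) \<partial>lborel)
         \<le> eigenvalue_moment \<mu> \<gamma>
       \<and> eigenvalue_moment \<mu> \<gamma>
         \<le> ennreal (2 powr (4 * \<gamma> + 3))
           * (\<integral>\<^sup>+x. ennreal (\<bar>otelbaev \<mu> x\<bar> powr (1 / 2 + \<gamma>)) \<partial>lborel)"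
proof -
  interpret vanishing_tails \<mu>
    by unfold_locales (use assms(1,2) radon.small_measure_far_away[OF radon.intro] in blast)+
  \<comment> \<open>The lower bound holds for each c > 8, and pi > 3 already makes 2 pi^2 + 3/2
    larger than 19.\<close>
  have "3\<^sup>2 < pi\<^sup>2" using pi_gt3 by (intro power_strict_mono) auto
  then have c: "2 * pi\<^sup>2 + 3 / 2 > 8" by simp
  show ?thesis
    using eigenvalue_moment_ge[OF assms(3) c] eigenvalue_moment_le[OF assms(3)]
    by (simp add: abs_of_nonneg[OF otelbaev_nonneg])
qed

end
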